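(* Assume that $\{c_\theta:\theta\in\Theta\}$ is a first-order regular family of covariance functions and is asymptotically identifiable around $\theta_0$ (notions as defined in the context). Then any sequence $(\hat\theta_n(c))_{n\in\mathbb{N}_+}$ of ML estimators for $\theta_0$ is consistent, i.e. $\hat\theta_n(c)\to\theta_0$ in $\mathbb{P}$-probability as $n\to\infty$.
   Context: Notation. $\mathbb{N}_+=\{1,2,\dots\}$; $\|\cdot\|$ is the Euclidean norm, $\mathrm{B}[0;r]$ the closed ball of radius $r$ in $\mathbb{R}^d$, $\|\cdot\|_\infty$ the supremum norm of a function. $\mathcal{B}_{\mathrm C}(\mathbb{R}^d;S)$ is the space of real valued, uniformly bounded functions on $\mathbb{R}^d$ with compact support $S$. Setting. $\Theta\subset\mathbb{R}^p$ is compact and convex, $\theta_0\in\Theta$, and $\{c_\theta:\theta\in\Theta\}$ is a family of (stationary) covariance functions on $\mathbb{R}^d$. On a probability space $(\Omega,\mathcal F,\mathbb{P})$, $Z=\{Z_s:s\in\mathbb{R}^d\}$ is a real valued, jointly measurable, stationary Gaussian random field with zero mean and covariance function $c_{\theta_0}$. Let $\mathcal Q=[-1,1]^d$ and let $(X_i)_{i\in\mathbb{N}_+}$ be i.i.d. $\mathcal Q$-valued random vectors, independent of $Z$, whose common law has a strictly positive probability density on $\mathcal Q$. Fix $\tau\in[0,1/2)$ and deterministic $v_i\in\mathbb{N}_+^d$ with $\{v_i:1\le i\le I^d\}=\{1,\dots,I\}^d$ for all $I\in\mathbb{N}_+$. Put $S_i=v_i+\tau X_i$, $Z_{(n)}=(Z_{S_1},\dots,Z_{S_n})$,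 $\Sigma_{n,\theta}=[c_\theta(S_i-S_j)]_{1\le i,j\le n}$. ML estimators. For a square symmetric matrix $A$, $\det_+(A)$ is the product of its strictly positive eigenvalues ($=1$ if there are none) and $A^+$ the Moore–Penrose inverse. Put $l_n(\theta)=\frac1n\log\det_+(\Sigma_{n,\theta})+\frac1n\langle Z_{(n)},\Sigma_{n,\theta}^{+}Z_{(n)}\rangle$ (under the hypotheses of the claim, $\Sigma_{n,\theta}$ is a.s. positive-definite so $\det_+=\det$ and $\Sigma^+=\Sigma^{-1}$). A sequence of ML estimators is a sequence of estimators with $\hat\theta_n(c)\in\arg\min_{\theta\in\Theta}l_n(\theta)$ for every $n$. First-order regular family: (1) there are finite constants $C,L$, independent of $\theta$, such that $c_\theta\in\mathcal{B}_{\mathrm C}(\mathbb{R}^d;S_\theta)$ with $S_\theta\subset\mathrm B[0;C]$ and $\|c_\theta\|_\infty\le L$; (2) for every $s$ the first order partial derivatives of $\theta\mapsto c_\theta(s)$ exist and are continuous in $\theta$, and there are finite $C',L'$ independent of $\theta$ such that each $\frac{\partial c_\theta}{\partial\theta_i}\in\mathcal{B}_{\mathrm C}(\mathbb{R}^d;S_\theta(i))$ with $S_\theta(i)\subset\mathrm B[0;C']$ and $\|\frac{\partial c_\theta}{\partial\theta_i}\|_\infty\le L'$; (3) $c_\theta(s)=\int_{\mathbb{R}^d}\hat c_\theta(f)e^{\mathrm i\langle f,s\rangle}\,df$ with $(\theta,f)\mapsto\hat c_\theta(f)$ continuous and strictly positive on $\Theta\times\mathbb{R}^d$. Asymptotic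 identifiability around $\theta_0$: let $D_\tau=\bigcup_{z\in\mathbb{Z}^d\setminus\{0\}}(z+\tau U_{\mathcal Q})$ with $U_{\mathcal Q}=\{u_1-u_2:u_1,u_2\in\mathcal Q\}$. If $\tau=0$: there is no $\theta\in\Theta$, $\theta\ne\theta_0$, with $c_\theta(z)=c_{\theta_0}(z)$ for all $z\in\mathbb{Z}^d$. If $\tau\ne0$: there is no $\theta\in\Theta$, $\theta\neq\theta_0$, such that $c_\theta-c_{\theta_0}$ is zero Lebesgue-a.e. on $D_\tau$ and $c_\theta(0)=c_{\theta_0}(0)$.
   Formalization: Joint measurability of Z and its independence of (X_i) are combined: Z is jointly measurable with respect to a sub-σ-algebra independent of (X_i); assumed separately, for τ>0 one may set Z to 0 at the random locations S_i, and consistency fails. *)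

theory Defs
  imports "HOL-Probability.Probability" "Jordan_Normal_Form.Char_Poly"
begin

no_notation scalar_prod (infix "\<bullet>" 70)
no_notation Matrix.vec_index (infixl "$" 100)

section \<open>Covariance functions and Gaussian random fields\<close>

text \<open>Stationary covariance functions: the covariance kernel is \<open>(s, t) \<mapsto> c (s - t)\<close>.\<close>

definition covariance_function :: "(real^'d \<Rightarrow> real) \<Rightarrow> bool" where
  "covariance_function c \<longleftrightarrow>
     (\<forall>s. c (- s) = c s) \<and>
     (\<forall>F a. finite F \<longrightarrow> 0 \<le> (\<Sum>s\<in>F. \<Sum>t\<in>F. a s * a t * c (s - t)))"

text \<open>A constant counts as a (degenerate) Gaussian variable.\<close>

definition gaussian_rv :: "'w measure \<Rightarrow> ('w \<Rightarrow> real) \<Rightarrow> bool" where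
  "gaussian_rv M Y \<longleftrightarrow>
     Y \<in> borel_measurable M \<and>
     (\<exists>\<mu> \<sigma>. (\<sigma> = 0 \<and> (AE \<omega> in M. Y \<omega> = \<mu>)) \<or>
            (0 < \<sigma> \<and> distributed M lborel Y (\<lambda>x. ennreal (normal_density \<mu> \<sigma> x))))"

text \<open>All finite linear combinations of the field are Gaussian. Since the covariance of
  \<open>Z s\<close> and \<open>Z t\<close> depends on \<open>s - t\<close> only, such a centred field is stationary.\<close>

definition centered_gaussian_field ::
    "'w measure \<Rightarrow> (real^'d \<Rightarrow> 'w \<Rightarrow> real) \<Rightarrow> (real^'d \<Rightarrow> real) \<Rightarrow> bool" where
  "centered_gaussian_field M Z c \<longleftrightarrow>
     (\<forall>F a. finite F \<longrightarrow> gaussian_rv M (\<lambda>\<omega>. \<Sum>s\<in>F. a s * Z s \<omega>)) \<and>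
     (\<forall>s. (\<integral>\<omega>. Z s \<omega> \<partial>M) = 0) \<and>
     (\<forall>s t. (\<integral>\<omega>. Z s \<omega> * Z t \<omega> \<partial>M) = c (s - t))"

section \<open>Sampling locations\<close>

definition unit_cube :: "(real^'d) set" where
  "unit_cube = {x. \<forall>k. - 1 \<le> x $ k \<and> x $ k \<le> 1}"

text \<open>Sequences are indexed by the positive integers; values at index 0 play no role.\<close>

definition iid_positive_density :: "'w measure \<Rightarrow> (nat \<Rightarrow> 'w \<Rightarrow> real^'d) \<Rightarrow> bool" where
  "iid_positive_density M X \<longleftrightarrow>
     (\<forall>i\<ge>1. \<forall>\<omega>\<in>space M. X i \<omega> \<in> unit_cube) \<and>
     prob_space.indep_vars M (\<lambda>_. borel) X {1..} \<and>
     (\<exists>g. g \<in> borel_measurable borel \<and> (\<forall>x\<in>unit_cube. 0 < g x) \<and>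
        (\<forall>i\<ge>1. distributed M lborel (X i) (\<lambda>x. ennreal (g x * indicator unit_cube x))))"

text \<open>Joint measurability of \<open>Z\<close> and independence of \<open>Z\<close> and \<open>X\<close>. The two are combined: \<open>Z\<close> is
  jointly measurable with respect to a \<open>\<sigma>\<close>-algebra \<open>A\<close> which is independent of \<open>X\<close> (for example
  the first factor of a product space that carries \<open>Z\<close> and \<open>X\<close> on separate factors, or the
  \<open>\<sigma>\<close>-algebra generated by \<open>Z\<close>). Joint measurability with respect to \<open>M\<close> and independence of the
  \<open>\<sigma>\<close>-algebras generated by \<open>(Z s)\<^sub>s\<close> and \<open>X\<close> would not determine the law of \<open>Z\<close> at the random
  locations: overwriting \<open>Z\<close> by 0 at these locations would preserve both properties
  whenever the locations have diffuse laws. Only the space and the sets of \<open>A\<close> matter.\<close>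

definition jointly_measurable_independent ::
    "'w measure \<Rightarrow> (real^'d \<Rightarrow> 'w \<Rightarrow> real) \<Rightarrow> (nat \<Rightarrow> 'w \<Rightarrow> real^'d) \<Rightarrow> bool" where
  "jointly_measurable_independent M Z X \<longleftrightarrow>
     (\<exists>A. subalgebra M A \<and>
        (\<lambda>(s, \<omega>). Z s \<omega>) \<in> borel_measurable (borel \<Otimes>\<^sub>M A) \<and>
        prob_space.indep_set M (sets A)
          (sets (vimage_algebra (space M) (\<lambda>\<omega>. \<lambda>i\<in>{1..}. X i \<omega>) (Pi\<^sub>M {1..} (\<lambda>_. borel)))))"

definition grid_enumeration :: "(nat \<Rightarrow> nat^'d) \<Rightarrow> bool" where
  "grid_enumeration v \<longleftrightarrow>
     (\<forall>i\<ge>1. \<forall>k. 1 \<le> v i $ k) \<and>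
     (\<forall>I\<ge>1. v ` {1..I ^ CARD('d)} = {u. \<forall>k. 1 \<le> u $ k \<and> u $ k \<le> I})"

definition location ::
    "(nat \<Rightarrow> nat^'d) \<Rightarrow> real \<Rightarrow> (nat \<Rightarrow> 'w \<Rightarrow> real^'d) \<Rightarrow> nat \<Rightarrow> 'w \<Rightarrow> real^'d" where
  "location v \<tau> X i \<omega> = (\<chi> k. real (v i $ k)) + \<tau> *\<^sub>R X i \<omega>"

section \<open>Maximum likelihood estimators\<close>

text \<open>Product of the strictly positive eigenvalues, counted with (algebraic) multiplicity.\<close>

definition det_plus :: "real mat \<Rightarrow> real" where
  "det_plus A = (\<Prod>x | eigenvalue A x \<and> 0 < x. x ^ order x (char_poly A))"

text \<open>The unique solution of the four Penrose equations.\<close>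

definition moore_penrose :: "real mat \<Rightarrow> real mat" where
  "moore_penrose A = (THE B. B \<in> carrier_mat (dim_col A) (dim_row A) \<and>
     A * B * A = A \<and> B * A * B = B \<and>
     transpose_mat (A * B) = A * B \<and> transpose_mat (B * A) = B * A)"

text \<open>Matrices and vectors of \<^typ>\<open>real mat\<close> and \<^typ>\<open>real Matrix.vec\<close> are indexed from 0,
  the sampling locations from 1.\<close>

definition cov_matrix :: "(real^'d \<Rightarrow> real) \<Rightarrow> (nat \<Rightarrow> real^'d) \<Rightarrow> nat \<Rightarrow> real mat" where
  "cov_matrix c S n = Matrix.mat n n (\<lambda>(i, j). c (S (Suc i) - S (Suc j)))"

definition neg_log_lik ::
    "(real^'p \<Rightarrow> real^'d \<Rightarrow> real) \<Rightarrow> (real^'d \<Rightarrow> 'w \<Rightarrow> real) \<Rightarrow> (nat \<Rightarrow> 'w \<Rightarrow> real^'d)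
      \<Rightarrow> nat \<Rightarrow> 'w \<Rightarrow> real^'p \<Rightarrow> real" where
  "neg_log_lik c Z S n \<omega> \<theta> =
     (let \<Sigma> = cov_matrix (c \<theta>) (\<lambda>i. S i \<omega>) n;
          z = Matrix.vec n (\<lambda>i. Z (S (Suc i) \<omega>) \<omega>)
      in 1 / real n * ln (det_plus \<Sigma>) +
         1 / real n * scalar_prod z (mult_mat_vec (moore_penrose \<Sigma>) z))"

definition ml_estimators ::
    "'w measure \<Rightarrow> (real^'p) set \<Rightarrow> (real^'p \<Rightarrow> real^'d \<Rightarrow> real) \<Rightarrow> (real^'d \<Rightarrow> 'w \<Rightarrow> real)
      \<Rightarrow> (nat \<Rightarrow> 'w \<Rightarrow> real^'d) \<Rightarrow> (nat \<Rightarrow> 'w \<Rightarrow> real^'p) \<Rightarrow> bool" where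
  "ml_estimators M \<Theta> c Z S est \<longleftrightarrow>
     (\<forall>n\<ge>1. est n \<in> borel_measurable M \<and>
        (\<forall>\<omega>\<in>space M. est n \<omega> \<in> \<Theta> \<and>
           (\<forall>\<theta>\<in>\<Theta>. neg_log_lik c Z S n \<omega> (est n \<omega>) \<le> neg_log_lik c Z S n \<omega> \<theta>)))"

definition tendsto_in_probability ::
    "'w measure \<Rightarrow> (nat \<Rightarrow> 'w \<Rightarrow> 'a::metric_space) \<Rightarrow> 'a \<Rightarrow> bool" where
  "tendsto_in_probability M Y y \<longleftrightarrow>
     (\<forall>\<epsilon>>0. (\<lambda>n. measure M {\<omega>\<in>space M. \<epsilon> < dist (Y n \<omega>) y}) \<longlonglongrightarrow> 0)"

section \<open>First-order regular families\<close>

definition compact_support_bounded :: "(real^'d) set \<Rightarrow> (real^'d \<Rightarrow> real) set" where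
  "compact_support_bounded S =
     {f. bounded (range f) \<and> closure {x. f x \<noteq> 0} = S \<and> compact S}"

definition uniformly_supported_bounded ::
    "(real^'p) set \<Rightarrow> (real^'p \<Rightarrow> real^'d \<Rightarrow> real) \<Rightarrow> real \<Rightarrow> real \<Rightarrow> bool" where
  "uniformly_supported_bounded \<Theta> h C L \<longleftrightarrow>
     (\<forall>\<theta>\<in>\<Theta>. (\<exists>S \<subseteq> cball 0 C. h \<theta> \<in> compact_support_bounded S) \<and>
            (SUP s. \<bar>h \<theta> s\<bar>) \<le> L)"

text \<open>\<open>D i\<close> are continuous first order partial derivatives on \<open>\<Theta>\<close> of a function \<open>f\<close> on \<open>\<Theta>\<close>.
  The set \<open>\<Theta>\<close> is closed and may have empty interior, so partial derivatives at its points
  are understood, as usual on closed sets, as those of an extension of \<open>f\<close>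
  that is continuously differentiable on an open neighbourhood of \<open>\<Theta>\<close>. Only the values of
  \<open>f\<close> and \<open>D i\<close> on \<open>\<Theta>\<close> matter.\<close>

definition continuous_partials_on ::
    "(real^'p) set \<Rightarrow> (real^'p \<Rightarrow> real) \<Rightarrow> ('p \<Rightarrow> real^'p \<Rightarrow> real) \<Rightarrow> bool" where
  "continuous_partials_on \<Theta> f D \<longleftrightarrow>
     (\<exists>U F G. open U \<and> \<Theta> \<subseteq> U \<and>
        (\<forall>\<theta>\<in>\<Theta>. F \<theta> = f \<theta>) \<and> (\<forall>i. \<forall>\<theta>\<in>\<Theta>. G i \<theta> = D i \<theta>) \<and>
        (\<forall>i. \<forall>\<theta>\<in>U. ((\<lambda>t. F (\<theta> + t *\<^sub>R axis i 1)) has_real_derivative G i \<theta>) (at 0)) \<and>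
        (\<forall>i. continuous_on U (G i)))"

definition first_order_regular ::
    "(real^'p) set \<Rightarrow> (real^'p \<Rightarrow> real^'d \<Rightarrow> real) \<Rightarrow> bool" where
  "first_order_regular \<Theta> c \<longleftrightarrow>
     (\<exists>C L. uniformly_supported_bounded \<Theta> c C L) \<and>
     (\<exists>D. (\<forall>s. continuous_partials_on \<Theta> (\<lambda>\<theta>. c \<theta> s) (\<lambda>i \<theta>. D i \<theta> s)) \<and>
          (\<exists>C' L'. \<forall>i. uniformly_supported_bounded \<Theta> (D i) C' L')) \<and>
     (\<exists>chat :: real^'p \<Rightarrow> real^'d \<Rightarrow> real.
          continuous_on (\<Theta> \<times> UNIV) (\<lambda>(\<theta>, f). chat \<theta> f) \<and>
          (\<forall>\<theta>\<in>\<Theta>. \<forall>f. 0 < chat \<theta> f) \<and>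
          (\<forall>\<theta>\<in>\<Theta>. \<forall>s. has_bochner_integral lborel
             (\<lambda>f. complex_of_real (chat \<theta> f) * exp (\<i> * complex_of_real (f \<bullet> s)))
             (complex_of_real (c \<theta> s))))"

section \<open>Asymptotic identifiability\<close>

definition integer_lattice :: "(real^'d) set" where
  "integer_lattice = {z. \<forall>k. z $ k \<in> \<int>}"

definition lag_set :: "real \<Rightarrow> (real^'d) set" where
  "lag_set \<tau> = (\<Union>z \<in> integer_lattice - {0}.
     {z + \<tau> *\<^sub>R (u1 - u2) | u1 u2. u1 \<in> unit_cube \<and> u2 \<in> unit_cube})"

definition asymptotically_identifiable ::
    "(real^'p) set \<Rightarrow> (real^'p \<Rightarrow> real^'d \<Rightarrow> real) \<Rightarrow> real \<Rightarrow> real^'p \<Rightarrow> bool" where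
  "asymptotically_identifiable \<Theta> c \<tau> \<theta>0 \<longleftrightarrow>
     (if \<tau> = 0
      then \<not> (\<exists>\<theta>\<in>\<Theta>. \<theta> \<noteq> \<theta>0 \<and> (\<forall>z\<in>integer_lattice. c \<theta> z = c \<theta>0 z))
      else \<not> (\<exists>\<theta>\<in>\<Theta>. \<theta> \<noteq> \<theta>0 \<and>
                (AE s in lebesgue. s \<in> lag_set \<tau> \<longrightarrow> c \<theta> s - c \<theta>0 s = 0) \<and>
                c \<theta> 0 = c \<theta>0 0))"

end

theory Submission
  imports Defs
begin

text \<open>
  Consistency is proved by comparing the likelihood at a wrong parameter \<open>\<theta>\<^sub>1\<close> with the one at \<open>\<theta>\<^sub>0\<close>,
  conditionally on the locations. Let \<open>A\<close> and \<open>B\<close> be the covariance matrices of the observations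
  under \<open>\<theta>\<^sub>0\<close> and \<open>\<theta>\<^sub>1\<close>. In coordinates \<open>y\<close> that turn \<open>A\<close> into the identity and \<open>B\<close> into
  \<open>diag(\<mu>\<^sub>1, \<dots>, \<mu>\<^sub>n)\<close> (\<open>pencil_coordinates\<close>), the difference of the two values of \<open>n l\<^sub>n\<close> is
  \<open>\<Sum>\<^sub>k (ln \<mu>\<^sub>k + (1 / \<mu>\<^sub>k - 1) y\<^sub>k\<^sup>2)\<close>, where the \<open>y\<^sub>k\<close> are uncorrelated standard Gaussian variables.
  Its mean \<open>\<Sum>\<^sub>k (ln \<mu>\<^sub>k + 1 / \<mu>\<^sub>k - 1)\<close> dominates a multiple of \<open>\<Sum>\<^sub>k (\<mu>\<^sub>k - 1)\<^sup>2\<close>, hence of the squared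
  Frobenius norm of \<open>B - A\<close>, as long as the eigenvalues of \<open>A\<close> and \<open>B\<close> stay in a fixed compact part
  of \<open>(0, \<infinity>)\<close>; its variance is \<open>O(n)\<close>. By Chebyshev's inequality the likelihoods are
  separated by a constant, provided that the squared Frobenius norm grows linearly
  (\<open>contrast_separation\<close>).

  Three properties of the model feed this argument. First, the uniform eigenvalue bounds: the locations
  are uniformly separated, so compact supports bound the row sums, which gives the upper bound
  (\<open>compact_support_form_bound\<close>), and a spectral density that is positive on a large frequency window gives
  the lower bound by comparison with a Fejer kernel (\<open>covariance_form_lower_bound\<close>). Second, the
  growth of the Frobenius norm: identifiability provides a lag \<open>z + \<tau> (u\<^sub>1 - u\<^sub>2)\<close> at which the two
  covariance functions differ, by continuity they differ near this lag, and a law of large numbers for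
  pairs of grid points at distance \<open>z\<close> shows that a positive fraction of all points sees such a lag
  (\<open>lag_statistic_lower_bound\<close>). Third, uniform continuity: \<open>\<theta> \<mapsto> c\<^sub>\<theta>\<close> is continuous in the
  supremum norm by Scheffe's lemma (\<open>covariance_uniformly_continuous\<close>), so that the comparison with
  \<open>\<theta>\<^sub>0\<close> extends from \<open>\<theta>\<^sub>1\<close> to a whole neighbourhood of \<open>\<theta>\<^sub>1\<close>, on one event that does not depend on the
  parameter (\<open>contrast_perturbation\<close>).

  Finally, the parameters at distance at least \<open>\<epsilon>\<close> from \<open>\<theta>\<^sub>0\<close> form a compact set. It is
  covered by finitely many of these neighbourhoods, and a minimizer of the likelihood can lie in one of them
  only on an event whose probability tends to 0.
\<close>

section \<open>Diagonalization of real symmetric matrices\<close>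

lemma symmetric_matD:
  assumes "A \<in> carrier_mat n n" "transpose_mat A = A" "i < n" "j < n"
  shows "A $$ (i, j) = A $$ (j, i)"
  using assms by (metis carrier_matD(1,2) index_transpose_mat(1))

lemma mult_mat_vec_nth:
  assumes "A \<in> carrier_mat n m" "v \<in> carrier_vec m" "i < n"
  shows "Matrix.vec_index (mult_mat_vec A v) i = (\<Sum>j<m. A $$ (i, j) * Matrix.vec_index v j)"
  using assms by (auto simp: scalar_prod_def lessThan_atLeast0 intro!: sum.cong)

lemma mult_mat_nth:
  assumes "A \<in> carrier_mat n m" "B \<in> carrier_mat m k" "i < n" "j < k"
  shows "(A * B) $$ (i, j) = (\<Sum>l<m. A $$ (i, l) * B $$ (l, j))"
  using assms by (auto simp: scalar_prod_def lessThan_atLeast0 intro!: sum.cong)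

lemma scalar_prod_sum:
  assumes "w \<in> carrier_vec n"
  shows "scalar_prod v w = (\<Sum>i<n. Matrix.vec_index v i * Matrix.vec_index w i)"
  using assms by (auto simp: scalar_prod_def lessThan_atLeast0)

text \<open>A complex eigenvector \<open>x + \<i> y\<close> for the eigenvalue \<open>a + \<i> b\<close> gives \<open>A x = a x - b y\<close> and
  \<open>A y = b x + a y\<close>; comparing \<open>y \<cdot> A x\<close> with \<open>x \<cdot> A y\<close> yields \<open>b = 0\<close>, so that \<open>x\<close> or \<open>y\<close> is a
  real eigenvector.\<close>

lemma symmetric_real_eigenvector:
  fixes A :: "real mat"
  assumes A: "A \<in> carrier_mat n n" and sym: "transpose_mat A = A" and n: "0 < n"
  shows "\<exists>v r. (\<Sum>i<n. v i * v i) = (1::real) \<and> (\<forall>i<n. (\<Sum>j<n. A $$ (i, j) * v j) = r * v i)"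
proof -
  define C where "C = map_mat complex_of_real A"
  have C: "C \<in> carrier_mat n n" using A by (auto simp: C_def)
  have "\<not> constant (poly (char_poly C))"
    using degree_monic_char_poly[OF C] n by (simp add: constant_degree)
  then obtain k where "poly (char_poly C) k = 0"
    using fundamental_theorem_of_algebra by blast
  then have "eigenvalue C k" using eigenvalue_root_char_poly[OF C] by simp
  then obtain w where w: "w \<in> carrier_vec n" "w \<noteq> 0\<^sub>v n" "mult_mat_vec C w = k \<cdot>\<^sub>v w"
    using C by (auto simp: eigenvalue_def eigenvector_def)
  define x where "x i = Re (Matrix.vec_index w i)" for i
  define y where "y i = Im (Matrix.vec_index w i)" for i
  define a where "a = Re k" define b where "b = Im k"
  have eq: "(\<Sum>j<n. complex_of_real (A $$ (i, j)) * Matrix.vec_index w j) = k * Matrix.vec_index w i"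
    if "i < n" for i
  proof -
    have "(\<Sum>j<n. C $$ (i, j) * Matrix.vec_index w j) = k * Matrix.vec_index w i"
      using mult_mat_vec_nth[OF C w(1) that] w that by simp
    moreover have "(\<Sum>j<n. C $$ (i, j) * Matrix.vec_index w j) = (\<Sum>j<n. complex_of_real (A $$ (i, j)) * Matrix.vec_index w j)"
      using A that by (intro sum.cong) (auto simp: C_def)
    ultimately show ?thesis by simp
  qed
  have ex: "(\<Sum>j<n. A $$ (i, j) * x j) = a * x i - b * y i" if "i < n" for i
    using arg_cong[OF eq[OF that], of Re] by (simp add: x_def y_def a_def b_def)
  have ey: "(\<Sum>j<n. A $$ (i, j) * y j) = b * x i + a * y i" if "i < n" for i
    using arg_cong[OF eq[OF that], of Im] by (simp add: x_def y_def a_def b_def)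
  have "(\<Sum>i<n. y i * (\<Sum>j<n. A $$ (i, j) * x j)) = (\<Sum>i<n. \<Sum>j<n. y i * (A $$ (i, j) * x j))"
    by (simp add: sum_distrib_left)
  also have "\<dots> = (\<Sum>j<n. \<Sum>i<n. y i * (A $$ (i, j) * x j))"
    by (rule sum.swap)
  also have "\<dots> = (\<Sum>j<n. x j * (\<Sum>i<n. A $$ (j, i) * y i))"
    unfolding sum_distrib_left
    by (intro sum.cong refl) (auto simp: symmetric_matD[OF A sym])
  finally have "(\<Sum>i<n. y i * (a * x i - b * y i)) = (\<Sum>i<n. x i * (b * x i + a * y i))"
    using ex ey by simp
  then have "b * ((\<Sum>i<n. x i * x i) + (\<Sum>i<n. y i * y i)) = 0"
    by (simp add: algebra_simps sum.distrib sum_subtractf sum_distrib_left)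
  moreover have pos: "(\<Sum>i<n. x i * x i) + (\<Sum>i<n. y i * y i) \<noteq> 0"
  proof
    assume "(\<Sum>i<n. x i * x i) + (\<Sum>i<n. y i * y i) = 0"
    then have "(\<Sum>i<n. x i * x i) = 0" "(\<Sum>i<n. y i * y i) = 0"
      using sum_nonneg[of "{..<n}" "\<lambda>i. x i * x i"] sum_nonneg[of "{..<n}" "\<lambda>i. y i * y i"] by auto
    then have "\<forall>i<n. x i = 0 \<and> y i = 0"
      by (subst (asm) (1 2) sum_nonneg_eq_0_iff) auto
    then have "w = 0\<^sub>v n" using w(1) by (intro eq_vecI) (auto simp: x_def y_def complex_eq_iff)
    then show False using w(2) by simp
  qed
  ultimately have b: "b = 0" by simp
  have fin: ?thesis if e: "\<And>i. i < n \<Longrightarrow> (\<Sum>j<n. A $$ (i, j) * u j) = a * u i"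
    and p: "(\<Sum>i<n. u i * u i) \<noteq> 0" for u :: "nat \<Rightarrow> real"
  proof -
    define s where "s = (\<Sum>i<n. u i * u i)"
    have s: "0 < s" using p sum_nonneg[of "{..<n}" "\<lambda>i. u i * u i"] by (auto simp: s_def)
    define v where "v i = u i / sqrt s" for i
    have "(\<Sum>i<n. v i * v i) = (\<Sum>i<n. u i * u i) / s"
      using s by (simp add: v_def sum_divide_distrib)
    moreover have "(\<Sum>j<n. A $$ (i, j) * v j) = a * v i" if "i < n" for i
      using e[OF that] by (simp add: v_def sum_divide_distrib[symmetric])
    ultimately show ?thesis using s by (auto simp: s_def)
  qed
  show ?thesis
  proof (cases "(\<Sum>i<n. x i * x i) = 0")
    case True
    then show ?thesis using pos ey b by (intro fin[of y]) auto
  next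
    case False
    then show ?thesis using ex b by (intro fin[of x]) auto
  qed
qed

text \<open>The Householder reflection along \<open>v - e\<^sub>0\<close> exchanges \<open>e\<^sub>0\<close> and the unit vector \<open>v\<close>. It extends a
  unit eigenvector to an orthogonal matrix without a Gram-Schmidt process.\<close>

lemma reflection_with_first_column:
  fixes v :: "nat \<Rightarrow> real"
  assumes unit: "(\<Sum>i<Suc m. v i * v i) = 1"
  shows "\<exists>H \<in> carrier_mat (Suc m) (Suc m). transpose_mat H = H \<and> H * H = 1\<^sub>m (Suc m) \<and>
    (\<forall>i<Suc m. H $$ (i, 0) = v i)"
proof -
  define w where "w i = v i - (if i = 0 then 1 else 0)" for i
  define c where "c = 1 / (1 - v 0)"
  define H where "H = Matrix.mat (Suc m) (Suc m) (\<lambda>(i, j). (if i = j then 1 else 0) - c * w i * w j)"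
  have H: "H \<in> carrier_mat (Suc m) (Suc m)" by (simp add: H_def)
  have ww: "(\<Sum>i<Suc m. w i * w i) = 2 - 2 * v 0"
  proof -
    have "(\<Sum>i<Suc m. w i * w i) = (\<Sum>i<Suc m. v i * v i + (if i = 0 then 1 - 2 * v i else 0))"
      by (intro sum.cong) (auto simp: w_def algebra_simps)
    also have "\<dots> = 2 - 2 * v 0" using unit by (simp add: sum.distrib)
    finally show ?thesis .
  qed
  show ?thesis
  proof (cases "v 0 = 1")
    case True
    then have "(\<Sum>i<Suc m. w i * w i) = 0" using ww by simp
    then have "\<forall>i\<in>{..<Suc m}. w i * w i = 0" by (subst (asm) sum_nonneg_eq_0_iff) auto
    then have "\<forall>i<Suc m. v i = (if i = 0 then 1 else 0)" by (auto simp: w_def)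
    then show ?thesis by (intro bexI[of _ "1\<^sub>m (Suc m)"]) auto
  next
    case False
    then have c: "c * (1 - v 0) = 1" by (simp add: c_def)
    have "H * H = 1\<^sub>m (Suc m)"
    proof (rule eq_matI)
      fix i j assume ij: "i < dim_row (1\<^sub>m (Suc m))" "j < dim_col (1\<^sub>m (Suc m))"
      have "(H * H) $$ (i, j) = (\<Sum>l<Suc m. H $$ (i, l) * H $$ (l, j))"
        using ij by (intro mult_mat_nth[OF H H]) auto
      also have "\<dots> = (\<Sum>l<Suc m. (if l = i then (if i = j then 1 else 0) - c * w i * w j else 0)
          + (if l = j then - c * w i * w j else 0) + c * c * w i * w j * (w l * w l))"
        using ij by (intro sum.cong) (auto simp: H_def algebra_simps)
      also have "\<dots> = (if i = j then 1 else 0) - 2 * c * w i * w j + c * c * w i * w j * (2 - 2 * v 0)"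
        using ij by (simp only: sum.distrib sum_distrib_left[symmetric] ww) (simp add: sum.delta)
      also have "\<dots> = (if i = j then 1 else 0) - 2 * c * w i * w j * (1 - c * (1 - v 0))"
        by (simp add: algebra_simps)
      finally show "(H * H) $$ (i, j) = 1\<^sub>m (Suc m) $$ (i, j)" using ij c by simp
    qed (auto simp: H_def)
    moreover have "H $$ (i, 0) = v i" if "i < Suc m" for i
    proof -
      have "H $$ (i, 0) = (if i = 0 then 1 else 0) + c * (1 - v 0) * w i"
        using that by (simp add: H_def w_def algebra_simps)
      then show ?thesis using c by (simp add: w_def)
    qed
    moreover have "transpose_mat H = H" by (rule eq_matI) (auto simp: H_def)
    ultimately show ?thesis using H by blast
  qed
qed

text \<open>Conjugation with a reflection that moves an eigenvector to the first axis clears the first column,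
  and by symmetry the first row, so that a smaller symmetric block remains.\<close>

theorem symmetric_orthogonally_diagonalizable:
  fixes A :: "real mat"
  assumes "A \<in> carrier_mat n n" and "transpose_mat A = A"
  shows "\<exists>U d. U \<in> carrier_mat n n \<and> transpose_mat U * U = 1\<^sub>m n \<and>
    transpose_mat U * A * U = mat_diag n d"
  using assms
proof (induction n arbitrary: A)
  case 0
  have "transpose_mat (1\<^sub>m 0) * A * 1\<^sub>m 0 = mat_diag 0 (\<lambda>_. 0)"
    using 0 by (intro eq_matI) (auto simp: mat_diag_def)
  then show ?case
    by (intro exI[of _ "1\<^sub>m 0"] exI[of _ "\<lambda>_. 0"]) auto
next
  case (Suc m)
  let ?n = "Suc m"
  note A = Suc.prems(1) and sym = Suc.prems(2)
  obtain v r where v: "(\<Sum>i<?n. v i * v i) = (1::real)"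
    and ev: "\<forall>i<?n. (\<Sum>j<?n. A $$ (i, j) * v j) = r * v i"
    using symmetric_real_eigenvector[OF A sym] by blast
  obtain H where H: "H \<in> carrier_mat ?n ?n" "transpose_mat H = H" "H * H = 1\<^sub>m ?n"
    "\<forall>i<?n. H $$ (i, 0) = v i"
    using reflection_with_first_column[OF v] by blast
  define B where "B = H * A * H"
  have B: "B \<in> carrier_mat ?n ?n" using A H by (simp add: B_def)
  have symB: "transpose_mat B = B"
    unfolding B_def using A H sym
    by (simp add: transpose_mult[of _ ?n ?n _ ?n] assoc_mult_mat[of _ ?n ?n _ ?n _ ?n])
  have B0: "B $$ (i, 0) = (if i = 0 then r else 0)" if i: "i < ?n" for i
  proof -
    have "B $$ (i, 0) = (H * (A * H)) $$ (i, 0)"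
      using A H by (simp add: B_def assoc_mult_mat[of _ ?n ?n _ ?n _ ?n])
    also have "\<dots> = (\<Sum>k<?n. H $$ (i, k) * (A * H) $$ (k, 0))"
      using A H i by (intro mult_mat_nth) auto
    also have "\<dots> = (\<Sum>k<?n. r * (H $$ (i, k) * H $$ (k, 0)))"
    proof (intro sum.cong refl)
      fix k assume k: "k \<in> {..<?n}"
      have "(A * H) $$ (k, 0) = (\<Sum>j<?n. A $$ (k, j) * H $$ (j, 0))"
        using A H k by (intro mult_mat_nth) auto
      also have "\<dots> = (\<Sum>j<?n. A $$ (k, j) * v j)"
        using H(4) by (intro sum.cong) auto
      also have "\<dots> = r * H $$ (k, 0)" using ev H(4) k by auto
      finally show "H $$ (i, k) * (A * H) $$ (k, 0) = r * (H $$ (i, k) * H $$ (k, 0))" by simp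
    qed
    also have "\<dots> = r * (H * H) $$ (i, 0)"
      unfolding mult_mat_nth[OF H(1) H(1) i zero_less_Suc] by (simp only: sum_distrib_left)
    finally show ?thesis using i H(3) by simp
  qed
  define A' where "A' = Matrix.mat m m (\<lambda>(i, j). B $$ (Suc i, Suc j))"
  have A': "A' \<in> carrier_mat m m" by (simp add: A'_def)
  have "transpose_mat A' = A'"
    by (rule eq_matI) (auto simp: A'_def symmetric_matD[OF B symB])
  from Suc.IH[OF A' this] obtain V d where V: "V \<in> carrier_mat m m"
    "transpose_mat V * V = 1\<^sub>m m" "transpose_mat V * A' * V = mat_diag m d" by blast
  define W where "W = four_block_mat (1\<^sub>m 1) (0\<^sub>m 1 m) (0\<^sub>m m 1) V"
  have W: "W \<in> carrier_mat ?n ?n" using V by (auto simp: W_def)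
  define R where "R = mat_diag 1 (\<lambda>_. r)"
  have R: "R \<in> carrier_mat 1 1" "R \<in> carrier_mat (Suc 0) (Suc 0)"
    by (auto simp: R_def mat_diag_def)
  have Bblock: "B = four_block_mat R (0\<^sub>m 1 m) (0\<^sub>m m 1) A'"
  proof (rule eq_matI)
    fix i j assume "i < dim_row (four_block_mat R (0\<^sub>m 1 m) (0\<^sub>m m 1) A')"
      "j < dim_col (four_block_mat R (0\<^sub>m 1 m) (0\<^sub>m m 1) A')"
    then have ij: "i < ?n" "j < ?n" by (auto simp: R_def mat_diag_def A'_def)
    show "B $$ (i, j) = four_block_mat R (0\<^sub>m 1 m) (0\<^sub>m m 1) A' $$ (i, j)"
      using ij B0[OF ij(1)] B0[OF ij(2)] symmetric_matD[OF B symB ij]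
      by (cases i; cases j) (auto simp: R_def mat_diag_def A'_def)
  qed (use B in \<open>auto simp: R_def mat_diag_def A'_def\<close>)
  have Wt: "transpose_mat W = four_block_mat (1\<^sub>m 1) (0\<^sub>m 1 m) (0\<^sub>m m 1) (transpose_mat V)"
    unfolding W_def using V by (subst transpose_four_block_mat) auto
  have WW: "transpose_mat W * W = 1\<^sub>m ?n"
    unfolding Wt unfolding W_def using V
    by (subst mult_four_block_mat) (auto simp: four_block_one_mat)
  have "transpose_mat W * B = four_block_mat R (0\<^sub>m 1 m) (0\<^sub>m m 1) (transpose_mat V * A')"
    unfolding Wt Bblock using V A' R by (subst mult_four_block_mat) auto
  then have "transpose_mat W * B * W = four_block_mat R (0\<^sub>m 1 m) (0\<^sub>m m 1) (mat_diag m d)"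
    unfolding W_def using V A' R by (simp, subst mult_four_block_mat) auto
  also have "\<dots> = mat_diag ?n (case_nat r d)"
    by (rule eq_matI) (auto simp: R_def mat_diag_def split: nat.split)
  finally have WBW: "transpose_mat W * B * W = mat_diag ?n (case_nat r d)" .
  define U where "U = H * W"
  have Ut: "transpose_mat U = transpose_mat W * H"
    using H W by (simp add: U_def transpose_mult[of _ ?n ?n _ ?n])
  have "transpose_mat U * U = transpose_mat W * (H * H) * W"
    using H(1) W unfolding Ut unfolding U_def
    by (simp add: assoc_mult_mat[of _ ?n ?n _ ?n _ ?n])
  also have "\<dots> = 1\<^sub>m ?n" using H W WW by simp
  finally have 1: "transpose_mat U * U = 1\<^sub>m ?n" .
  have "transpose_mat U * A * U = transpose_mat W * B * W"
    using H(1) W A unfolding Ut B_def unfolding U_def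
    by (simp add: assoc_mult_mat[of _ ?n ?n _ ?n _ ?n])
  with WBW 1 H W show ?case
    by (intro exI[of _ U] exI[of _ "case_nat r d"]) (auto simp: U_def)
qed

section \<open>Positive definite matrices and pencils\<close>

definition quadratic_form :: "nat \<Rightarrow> real mat \<Rightarrow> (nat \<Rightarrow> real) \<Rightarrow> real" where
  "quadratic_form n A x = (\<Sum>i<n. \<Sum>j<n. x i * A $$ (i, j) * x j)"

definition pos_def_mat :: "nat \<Rightarrow> real mat \<Rightarrow> bool" where
  "pos_def_mat n A \<longleftrightarrow> A \<in> carrier_mat n n \<and> transpose_mat A = A \<and>
     (\<forall>x. (\<exists>i<n. x i \<noteq> 0) \<longrightarrow> 0 < quadratic_form n A x)"

lemma congruence_nth:
  fixes A :: "real mat"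
  assumes "P \<in> carrier_mat n n" "A \<in> carrier_mat n n" "k < n" "l < n"
  shows "(transpose_mat P * A * P) $$ (k, l) = (\<Sum>i<n. \<Sum>j<n. P $$ (i, k) * A $$ (i, j) * P $$ (j, l))"
proof -
  have "(transpose_mat P * A * P) $$ (k, l) = (\<Sum>j<n. (transpose_mat P * A) $$ (k, j) * P $$ (j, l))"
    using assms by (intro mult_mat_nth) auto
  also have "\<dots> = (\<Sum>j<n. \<Sum>i<n. P $$ (i, k) * A $$ (i, j) * P $$ (j, l))"
  proof (intro sum.cong refl)
    fix j assume j: "j \<in> {..<n}"
    have "(transpose_mat P * A) $$ (k, j) = (\<Sum>i<n. transpose_mat P $$ (k, i) * A $$ (i, j))"
      using assms j by (intro mult_mat_nth) auto
    then show "(transpose_mat P * A) $$ (k, j) * P $$ (j, l) = (\<Sum>i<n. P $$ (i, k) * A $$ (i, j) * P $$ (j, l))"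
      using assms by (simp add: sum_distrib_right)
  qed
  also have "\<dots> = (\<Sum>i<n. \<Sum>j<n. P $$ (i, k) * A $$ (i, j) * P $$ (j, l))"
    by (rule sum.swap)
  finally show ?thesis .
qed

lemma congruence_diag_nth:
  fixes A :: "real mat"
  assumes "P \<in> carrier_mat n n" "A \<in> carrier_mat n n" "k < n"
  shows "(transpose_mat P * A * P) $$ (k, k) = quadratic_form n A (\<lambda>i. P $$ (i, k))"
  using congruence_nth[OF assms(1-3,3)] by (simp add: quadratic_form_def)

lemma right_invertible_column_nonzero:
  fixes P :: "real mat"
  assumes "Q \<in> carrier_mat n n" "P \<in> carrier_mat n n" "Q * P = 1\<^sub>m n" "k < n"
  shows "\<exists>i<n. P $$ (i, k) \<noteq> 0"
proof (rule ccontr)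
  assume "\<not> ?thesis"
  then have "(Q * P) $$ (k, k) = 0"
    using mult_mat_nth[OF assms(1,2,4,4)] by simp
  then show False using assms by simp
qed

lemma mat_diag_mult:
  "mat_diag n f * mat_diag n g = mat_diag n (\<lambda>i. f i * g i :: real)"
  by (subst mat_diag_mult_left[of _ n n]) (auto simp: mat_diag_def intro!: eq_matI)

lemma transpose_mat_diag: "transpose_mat (mat_diag n f) = mat_diag n f"
  by (auto simp: mat_diag_def intro!: eq_matI)

lemma mat_diag_one: "mat_diag n (\<lambda>_. 1) = 1\<^sub>m n"
  by (auto simp: mat_diag_def intro!: eq_matI)

lemma pos_def_mat_spectral:
  assumes "pos_def_mat n A"
  shows "\<exists>U d. U \<in> carrier_mat n n \<and> transpose_mat U * U = 1\<^sub>m n \<and>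
    transpose_mat U * A * U = mat_diag n d \<and> (\<forall>k<n. 0 < d k)"
proof -
  have A: "A \<in> carrier_mat n n" "transpose_mat A = A" using assms by (auto simp: pos_def_mat_def)
  obtain U d where U: "U \<in> carrier_mat n n" "transpose_mat U * U = 1\<^sub>m n"
    "transpose_mat U * A * U = mat_diag n d"
    using symmetric_orthogonally_diagonalizable[OF A] by blast
  have "0 < d k" if k: "k < n" for k
  proof -
    have "d k = quadratic_form n A (\<lambda>i. U $$ (i, k))"
      using congruence_diag_nth[OF U(1) A(1) k] U(3) k by (simp add: mat_diag_def)
    moreover have "\<exists>i<n. U $$ (i, k) \<noteq> 0"
      using U k by (intro right_invertible_column_nonzero[of "transpose_mat U"]) auto
    ultimately show ?thesis using assms by (auto simp: pos_def_mat_def)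
  qed
  with U show ?thesis by blast
qed

text \<open>First \<open>A\<close> is reduced to the identity by an orthogonal diagonalization followed by a rescaling
  of the axes; what \<open>B\<close> has become is then diagonalized by a rotation, which preserves the identity.\<close>

theorem simultaneous_diagonalization:
  assumes A: "pos_def_mat n A" and B: "B \<in> carrier_mat n n" "transpose_mat B = B"
  shows "\<exists>P \<mu>. P \<in> carrier_mat n n \<and> transpose_mat P * A * P = 1\<^sub>m n \<and>
    transpose_mat P * B * P = mat_diag n \<mu>"
proof -
  have A': "A \<in> carrier_mat n n" using A by (auto simp: pos_def_mat_def)
  obtain U d where U: "U \<in> carrier_mat n n" "transpose_mat U * U = 1\<^sub>m n"
    "transpose_mat U * A * U = mat_diag n d" "\<forall>k<n. 0 < d k"
    using pos_def_mat_spectral[OF A] by blast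
  define E where "E = mat_diag n (\<lambda>i. 1 / sqrt (d i))"
  have E: "E \<in> carrier_mat n n" "transpose_mat E = E" by (auto simp: E_def transpose_mat_diag)
  define Q where "Q = U * E"
  have Q: "Q \<in> carrier_mat n n" using U E by (auto simp: Q_def)
  have Qt: "transpose_mat Q = E * transpose_mat U"
    using U E by (simp add: Q_def transpose_mult[of _ n n _ n])
  have "transpose_mat Q * A * Q = E * (transpose_mat U * A * U) * E"
    using U(1) E(1) A' unfolding Qt unfolding Q_def by (simp add: assoc_mult_mat[of _ n n _ n _ n])
  also have "\<dots> = mat_diag n (\<lambda>i. 1 / sqrt (d i) * d i * (1 / sqrt (d i)))"
    by (simp add: U(3) E_def mat_diag_mult)
  also have "\<dots> = 1\<^sub>m n"
    using U(4) by (auto simp: mat_diag_def intro!: eq_matI)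
  finally have QAQ: "transpose_mat Q * A * Q = 1\<^sub>m n" .
  define B' where "B' = transpose_mat Q * B * Q"
  have "B' \<in> carrier_mat n n" "transpose_mat B' = B'"
    using Q B by (auto simp: B'_def transpose_mult[of _ n n _ n] assoc_mult_mat[of _ n n _ n _ n])
  from symmetric_orthogonally_diagonalizable[OF this] obtain V \<mu> where
    V: "V \<in> carrier_mat n n" "transpose_mat V * V = 1\<^sub>m n" "transpose_mat V * B' * V = mat_diag n \<mu>"
    by blast
  have Pt: "transpose_mat (Q * V) = transpose_mat V * transpose_mat Q"
    using Q V by (simp add: transpose_mult[of _ n n _ n])
  have "transpose_mat (Q * V) * A * (Q * V) = transpose_mat V * (transpose_mat Q * A * Q) * V"
    using Q V(1) A' unfolding Pt by (simp add: assoc_mult_mat[of _ n n _ n _ n])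
  then have "transpose_mat (Q * V) * A * (Q * V) = 1\<^sub>m n" using QAQ V by simp
  moreover have "transpose_mat (Q * V) * B * (Q * V) = transpose_mat V * B' * V"
    using Q V(1) B unfolding Pt B'_def by (simp add: assoc_mult_mat[of _ n n _ n _ n])
  ultimately show ?thesis using V Q by (intro exI[of _ "Q * V"] exI[of _ \<mu>]) auto
qed

lemma order_prod_linear:
  fixes d :: "'i \<Rightarrow> real"
  assumes "finite I"
  shows "order x (\<Prod>i\<in>I. [:- d i, 1:]) = card {i\<in>I. d i = x}"
  using assms
proof (induction I rule: finite_induct)
  case (insert j I)
  have nz: "(\<Prod>i\<in>insert j I. [:- d i, 1:]) \<noteq> 0"
    using insert.hyps by (subst prod_zero_iff) auto
  have "order x (\<Prod>i\<in>insert j I. [:- d i, 1:]) = order x [:- d j, 1:] + card {i\<in>I. d i = x}"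
    using insert nz by (simp only: prod.insert order_mult simp_thms)
  also have "order x [:- d j, 1:] = (if d j = x then 1 else 0)"
    by (cases "d j = x") (auto simp: order_root order_linear_power[of _ _ 1, simplified] intro!: order_0I)
  also have "{i\<in>insert j I. d i = x} = (if d j = x then insert j {i\<in>I. d i = x} else {i\<in>I. d i = x})"
    by auto
  then have "(if d j = x then 1 else 0) + card {i\<in>I. d i = x} = card {i\<in>insert j I. d i = x}"
    using insert by (simp add: card_insert_if)
  finally show ?case .
qed auto

lemma det_mat_diag: "det (mat_diag n d) = (\<Prod>k<n. d k :: real)"
proof -
  have "upper_triangular (mat_diag n d)" "mat_diag n d \<in> carrier_mat n n"
    by (auto simp: mat_diag_def upper_triangular_def)
  moreover have "diag_mat (mat_diag n d) = map d [0..<n]"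
    by (intro nth_equalityI) (auto simp: diag_mat_def mat_diag_def)
  ultimately have "det (mat_diag n d) = prod_list (map d [0..<n])"
    using det_upper_triangular by metis
  then show ?thesis by (simp add: prod.distinct_set_conv_list[symmetric] lessThan_atLeast0)
qed

text \<open>The characteristic polynomial is that of a similar diagonal matrix, so it splits over the reals and
  all its roots are positive; the product over the distinct positive eigenvalues then loses nothing.\<close>

lemma det_plus_pos_def:
  assumes "pos_def_mat n A"
  shows "det_plus A = det A" "0 < det A"
proof -
  have A: "A \<in> carrier_mat n n" using assms by (auto simp: pos_def_mat_def)
  obtain U d where U: "U \<in> carrier_mat n n" "transpose_mat U * U = 1\<^sub>m n"
    "transpose_mat U * A * U = mat_diag n d" "\<forall>k<n. 0 < d k"
    using pos_def_mat_spectral[OF assms] by blast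
  let ?D = "mat_diag n d"
  have UU: "U * transpose_mat U = 1\<^sub>m n"
    by (rule mat_mult_left_right_inverse[OF _ U(1) U(2)]) (use U in auto)
  have "dim_row ?D = n" by (simp add: mat_diag_def)
  then have "similar_mat_wit ?D A (transpose_mat U) U"
    using U A UU by (auto simp: similar_mat_wit_def Let_def)
  then have sim: "similar_mat ?D A" unfolding similar_mat_def by blast
  have D: "upper_triangular ?D" "?D \<in> carrier_mat n n"
    by (auto simp: mat_diag_def upper_triangular_def)
  have "char_poly A = char_poly ?D" using char_poly_similar[OF sim] by simp
  also have "\<dots> = prod_list (map (\<lambda>i. [:- d i, 1:]) [0..<n])"
  proof -
    have "diag_mat ?D = map d [0..<n]"
      by (intro nth_equalityI) (auto simp: diag_mat_def mat_diag_def)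
    then show ?thesis using char_poly_upper_triangular[OF D(2,1)] by (simp add: comp_def)
  qed
  also have "\<dots> = (\<Prod>i<n. [:- d i, 1:])"
    by (simp add: prod.distinct_set_conv_list[symmetric] lessThan_atLeast0)
  finally have cp: "char_poly A = (\<Prod>i<n. [:- d i, 1:])" .
  have ev: "eigenvalue A x \<longleftrightarrow> x \<in> d ` {..<n}" for x
    unfolding eigenvalue_root_char_poly[OF A] cp by (auto simp: poly_prod prod_zero_iff)
  have "det_plus A = (\<Prod>x\<in>d ` {..<n}. x ^ card {i\<in>{..<n}. d i = x})"
    unfolding det_plus_def cp order_prod_linear[OF finite_lessThan] ev using U(4)
    by (intro prod.cong) auto
  also have "\<dots> = (\<Prod>x\<in>d ` {..<n}. \<Prod>i\<in>{i\<in>{..<n}. d i = x}. d i)"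
    by (intro prod.cong refl) simp
  also have "\<dots> = (\<Prod>k<n. d k)"
    by (rule prod.image_gen[symmetric]) simp
  also have "\<dots> = det A"
    using det_similar[OF sim] by (simp add: det_mat_diag)
  finally show "det_plus A = det A" .
  have "0 < (\<Prod>k<n. d k)" using U(4) by (intro prod_pos) auto
  then show "0 < det A" using det_similar[OF sim] by (simp add: det_mat_diag)
qed

lemma moore_penrose_inverse:
  assumes "A \<in> carrier_mat n n" "B \<in> carrier_mat n n" "A * B = 1\<^sub>m n"
  shows "moore_penrose A = B"
proof -
  have BA: "B * A = 1\<^sub>m n" by (rule mat_mult_left_right_inverse[OF assms])
  show ?thesis unfolding moore_penrose_def
  proof (rule the_equality)
    show "B \<in> carrier_mat (dim_col A) (dim_row A) \<and> A * B * A = A \<and> B * A * B = B \<and>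
      transpose_mat (A * B) = A * B \<and> transpose_mat (B * A) = B * A"
      using assms BA by auto
  next
    fix X assume X: "X \<in> carrier_mat (dim_col A) (dim_row A) \<and> A * X * A = A \<and> X * A * X = X \<and>
      transpose_mat (A * X) = A * X \<and> transpose_mat (X * A) = X * A"
    have Xc: "X \<in> carrier_mat n n" using X assms by auto
    have "X = (B * A) * X * (A * B)" using BA assms Xc by simp
    also have "\<dots> = B * (A * X * A) * B"
      using assms(1,2) Xc by (simp add: assoc_mult_mat[of _ n n _ n _ n])
    also have "\<dots> = B" using X BA assms by simp
    finally show "X = B" .
  qed
qed

lemma quadratic_form_diag_congruence:
  fixes P :: "real mat"
  assumes P: "P \<in> carrier_mat n n"
  shows "scalar_prod (Matrix.vec n z) (mult_mat_vec (P * mat_diag n f * transpose_mat P) (Matrix.vec n z))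
    = (\<Sum>k<n. f k * (\<Sum>i<n. P $$ (i, k) * z i)\<^sup>2)"
proof -
  let ?Q = "P * mat_diag n f * transpose_mat P"
  have Q: "?Q \<in> carrier_mat n n" using P by (intro mult_carrier_mat[of _ n n]) auto
  have nth: "?Q $$ (i, j) = (\<Sum>k<n. f k * P $$ (i, k) * P $$ (j, k))" if "i < n" "j < n" for i j
  proof -
    have "?Q $$ (i, j) = (\<Sum>k<n. (P * mat_diag n f) $$ (i, k) * transpose_mat P $$ (k, j))"
      using P that by (intro mult_mat_nth) auto
    also have "\<dots> = (\<Sum>k<n. f k * P $$ (i, k) * P $$ (j, k))"
      using P that by (intro sum.cong) (auto simp: mat_diag_mult_right[OF P])
    finally show ?thesis .
  qed
  have "scalar_prod (Matrix.vec n z) (mult_mat_vec ?Q (Matrix.vec n z))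
      = (\<Sum>i<n. z i * Matrix.vec_index (mult_mat_vec ?Q (Matrix.vec n z)) i)"
    using Q by (subst scalar_prod_sum[of _ n]) (auto intro!: sum.cong)
  also have "\<dots> = (\<Sum>i<n. z i * (\<Sum>j<n. ?Q $$ (i, j) * z j))"
    using mult_mat_vec_nth[OF Q, of "Matrix.vec n z"] by (intro sum.cong) auto
  also have "\<dots> = (\<Sum>i<n. \<Sum>j<n. \<Sum>k<n. f k * (P $$ (i, k) * z i) * (P $$ (j, k) * z j))"
    by (simp add: nth sum_distrib_left sum_distrib_right mult_ac)
  also have "\<dots> = (\<Sum>i<n. \<Sum>k<n. \<Sum>j<n. f k * (P $$ (i, k) * z i) * (P $$ (j, k) * z j))"
    by (intro sum.cong refl sum.swap)
  also have "\<dots> = (\<Sum>k<n. \<Sum>i<n. \<Sum>j<n. f k * (P $$ (i, k) * z i) * (P $$ (j, k) * z j))"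
    by (rule sum.swap)
  also have "\<dots> = (\<Sum>k<n. f k * (\<Sum>i<n. P $$ (i, k) * z i)\<^sup>2)"
    by (simp add: power2_eq_square sum_product sum_distrib_left mult_ac)
  finally show ?thesis .
qed

text \<open>With \<open>T = R R\<^sup>T\<close>, the squared Frobenius norm of \<open>R\<^sup>T diag(d) R\<close> is the quadratic form
  \<open>\<Sum> d\<^sub>k d\<^sub>l T\<^sub>k\<^sub>l\<^sup>2\<close>, so it suffices to bound the rows of \<open>T\<close>. They satisfy
  \<open>\<Sum>\<^sub>l T\<^sub>k\<^sub>l\<^sup>2 \<le> K T\<^sub>k\<^sub>k\<close>, because the left side is the form of \<open>A = R\<^sup>T R\<close> at the \<open>k\<close>-th row of \<open>R\<close>;
  this also forces \<open>T\<^sub>k\<^sub>k \<le> K\<close>.\<close>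

lemma frobenius_congruence_le:
  fixes R A D :: "nat \<Rightarrow> nat \<Rightarrow> real"
  assumes A: "\<And>i j. i < n \<Longrightarrow> j < n \<Longrightarrow> A i j = (\<Sum>k<n. R k i * R k j)"
    and D: "\<And>i j. i < n \<Longrightarrow> j < n \<Longrightarrow> D i j = (\<Sum>k<n. d k * R k i * R k j)"
    and K: "0 \<le> K" "\<And>x. (\<Sum>i<n. \<Sum>j<n. x i * A i j * x j) \<le> K * (\<Sum>i<n. (x i)\<^sup>2)"
  shows "(\<Sum>i<n. \<Sum>j<n. (D i j)\<^sup>2) \<le> K\<^sup>2 * (\<Sum>k<n. (d k)\<^sup>2)"
proof -
  define T where "T k l = (\<Sum>i<n. R k i * R l i)" for k l
  have Tsym: "T k l = T l k" for k l by (simp add: T_def mult.commute)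
  have row: "(\<Sum>l<n. (T k l)\<^sup>2) \<le> K * T k k" for k
  proof -
    have "(\<Sum>l<n. (T k l)\<^sup>2) = (\<Sum>l<n. \<Sum>i<n. \<Sum>j<n. R k i * (R l i * R l j) * R k j)"
      by (simp add: T_def power2_eq_square sum_product mult_ac)
    also have "\<dots> = (\<Sum>i<n. \<Sum>l<n. \<Sum>j<n. R k i * (R l i * R l j) * R k j)"
      by (rule sum.swap)
    also have "\<dots> = (\<Sum>i<n. \<Sum>j<n. \<Sum>l<n. R k i * (R l i * R l j) * R k j)"
      by (intro sum.cong refl sum.swap)
    also have "\<dots> = (\<Sum>i<n. \<Sum>j<n. R k i * A i j * R k j)"
      by (intro sum.cong refl) (simp add: A sum_distrib_left sum_distrib_right)
    also have "\<dots> \<le> K * (\<Sum>i<n. (R k i)\<^sup>2)" by (rule K(2))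
    finally show ?thesis by (simp add: T_def power2_eq_square)
  qed
  have diag: "T k k \<le> K" if "k < n" for k
  proof (rule ccontr)
    assume "\<not> T k k \<le> K"
    then have "K * T k k < T k k * T k k" using K(1) by (intro mult_strict_right_mono) auto
    moreover have "(T k k)\<^sup>2 \<le> (\<Sum>l<n. (T k l)\<^sup>2)" using that by (intro member_le_sum) auto
    ultimately show False using row[of k] by (simp add: power2_eq_square)
  qed
  have row': "(\<Sum>l<n. (T k l)\<^sup>2) \<le> K\<^sup>2" if "k < n" for k
    using row[of k] mult_left_mono[OF diag[OF that] K(1)] by (simp add: power2_eq_square)
  have "(\<Sum>i<n. \<Sum>j<n. (D i j)\<^sup>2) = (\<Sum>i<n. \<Sum>j<n. \<Sum>k<n. \<Sum>l<n. d k * d l * (R k i * R l i) * (R k j * R l j))"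
    by (intro sum.cong refl) (simp add: D power2_eq_square sum_product mult_ac)
  also have "\<dots> = (\<Sum>i<n. \<Sum>k<n. \<Sum>j<n. \<Sum>l<n. d k * d l * (R k i * R l i) * (R k j * R l j))"
    by (intro sum.cong refl sum.swap)
  also have "\<dots> = (\<Sum>i<n. \<Sum>k<n. \<Sum>l<n. \<Sum>j<n. d k * d l * (R k i * R l i) * (R k j * R l j))"
    by (intro sum.cong refl sum.swap)
  also have "\<dots> = (\<Sum>k<n. \<Sum>i<n. \<Sum>l<n. \<Sum>j<n. d k * d l * (R k i * R l i) * (R k j * R l j))"
    by (rule sum.swap)
  also have "\<dots> = (\<Sum>k<n. \<Sum>l<n. \<Sum>i<n. \<Sum>j<n. d k * d l * (R k i * R l i) * (R k j * R l j))"
    by (intro sum.cong refl sum.swap)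
  also have "\<dots> = (\<Sum>k<n. \<Sum>l<n. d k * d l * (T k l)\<^sup>2)"
    by (simp add: T_def power2_eq_square sum_product sum_distrib_left mult_ac)
  also have "\<dots> \<le> (\<Sum>k<n. \<Sum>l<n. (d k)\<^sup>2 / 2 * (T k l)\<^sup>2 + (d l)\<^sup>2 / 2 * (T l k)\<^sup>2)"
  proof (intro sum_mono)
    fix k l
    have "d k * d l \<le> (d k)\<^sup>2 / 2 + (d l)\<^sup>2 / 2"
      using sum_squares_bound[of "d k" "d l"] by simp
    then have "d k * d l * (T k l)\<^sup>2 \<le> ((d k)\<^sup>2 / 2 + (d l)\<^sup>2 / 2) * (T k l)\<^sup>2"
      by (intro mult_right_mono) auto
    then show "d k * d l * (T k l)\<^sup>2 \<le> (d k)\<^sup>2 / 2 * (T k l)\<^sup>2 + (d l)\<^sup>2 / 2 * (T l k)\<^sup>2"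
      using Tsym[of k l] by (simp add: algebra_simps)
  qed
  also have "\<dots> = (\<Sum>k<n. (d k)\<^sup>2 * (\<Sum>l<n. (T k l)\<^sup>2))"
  proof -
    have "(\<Sum>k<n. \<Sum>l<n. (d l)\<^sup>2 / 2 * (T l k)\<^sup>2) = (\<Sum>k<n. \<Sum>l<n. (d k)\<^sup>2 / 2 * (T k l)\<^sup>2)"
      by (rule sum.swap)
    then show ?thesis
      by (simp only: sum.distrib) (simp add: sum_distrib_left sum.distrib[symmetric] del: sum.distrib)
  qed
  also have "\<dots> \<le> (\<Sum>k<n. (d k)\<^sup>2 * K\<^sup>2)"
    using row' by (intro sum_mono mult_left_mono) auto
  also have "\<dots> = K\<^sup>2 * (\<Sum>k<n. (d k)\<^sup>2)" by (simp add: sum_distrib_left mult.commute)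
  finally show ?thesis .
qed

text \<open>In the coordinates that diagonalize a pair of positive definite matrices, everything that
  the Gaussian likelihood sees of the pair is expressed by the generalized eigenvalues \<open>\<mu>\<close>.\<close>

theorem pencil_coordinates:
  assumes A: "pos_def_mat n A" and B: "pos_def_mat n B"
  obtains P :: "nat \<Rightarrow> nat \<Rightarrow> real" and \<mu> :: "nat \<Rightarrow> real" where
    "\<And>k. k < n \<Longrightarrow> 0 < \<mu> k"
    "\<And>k. k < n \<Longrightarrow> \<exists>i<n. P i k \<noteq> 0"
    "\<And>k l. k < n \<Longrightarrow> l < n \<Longrightarrow> (\<Sum>i<n. \<Sum>j<n. P i k * A $$ (i, j) * P j l) = (if k = l then 1 else 0)"
    "\<And>k. k < n \<Longrightarrow> quadratic_form n B (\<lambda>i. P i k) = \<mu> k"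
    "ln (det_plus B) - ln (det_plus A) = (\<Sum>k<n. ln (\<mu> k))"
    "\<And>z. scalar_prod (Matrix.vec n z) (mult_mat_vec (moore_penrose A) (Matrix.vec n z)) =
       (\<Sum>k<n. (\<Sum>i<n. P i k * z i)\<^sup>2)"
    "\<And>z. scalar_prod (Matrix.vec n z) (mult_mat_vec (moore_penrose B) (Matrix.vec n z)) =
       (\<Sum>k<n. (\<Sum>i<n. P i k * z i)\<^sup>2 / \<mu> k)"
    "\<And>K. 0 \<le> K \<Longrightarrow> (\<And>x. quadratic_form n A x \<le> K * (\<Sum>i<n. (x i)\<^sup>2)) \<Longrightarrow>
       (\<Sum>i<n. \<Sum>j<n. (B $$ (i, j) - A $$ (i, j))\<^sup>2) \<le> K\<^sup>2 * (\<Sum>k<n. (\<mu> k - 1)\<^sup>2)"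
proof -
  have A': "A \<in> carrier_mat n n" "transpose_mat A = A" using A by (auto simp: pos_def_mat_def)
  have B': "B \<in> carrier_mat n n" "transpose_mat B = B" using B by (auto simp: pos_def_mat_def)
  obtain P \<mu> where P: "P \<in> carrier_mat n n" "transpose_mat P * A * P = 1\<^sub>m n"
    "transpose_mat P * B * P = mat_diag n \<mu>"
    using simultaneous_diagonalization[OF A B'] by blast
  let ?D = "mat_diag n \<mu>"
  have D: "?D \<in> carrier_mat n n" by simp
  define R where "R = transpose_mat P * A"
  have R: "R \<in> carrier_mat n n" "R * P = 1\<^sub>m n" using P A' by (auto simp: R_def)
  have PR: "P * R = 1\<^sub>m n" by (rule mat_mult_left_right_inverse[OF R(1) P(1) R(2)])
  have Rt: "transpose_mat R * transpose_mat P = 1\<^sub>m n"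
    using arg_cong[OF PR, of transpose_mat] P(1) R(1) by (simp add: transpose_mult[of _ n n _ n])
  have AR: "transpose_mat R * R = A"
  proof -
    have "transpose_mat R * R = (transpose_mat R * transpose_mat P) * A"
      using P(1) R(1) A' by (simp add: assoc_mult_mat[of _ n n _ n _ n] R_def[symmetric])
    then show ?thesis using Rt A' by simp
  qed
  have BR: "transpose_mat R * ?D * R = B"
  proof -
    have "transpose_mat R * ?D * R = (transpose_mat R * transpose_mat P) * B * (P * R)"
      using P(1) R(1) B'(1) by (simp add: assoc_mult_mat[of _ n n _ n _ n] P(3)[symmetric])
    then show ?thesis using Rt PR B' by simp
  qed
  have nz: "\<exists>i<n. P $$ (i, k) \<noteq> 0" if "k < n" for k
    by (rule right_invertible_column_nonzero[OF R(1) P(1) R(2) that])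
  have mu: "quadratic_form n B (\<lambda>i. P $$ (i, k)) = \<mu> k" if "k < n" for k
    using congruence_diag_nth[OF P(1) B'(1) that] P(3) that by (simp add: mat_diag_def)
  have pos: "0 < \<mu> k" if "k < n" for k
    using B nz[OF that] mu[OF that] by (auto simp: pos_def_mat_def)
  have Aentry: "A $$ (i, j) = (\<Sum>k<n. R $$ (k, i) * R $$ (k, j))" if "i < n" "j < n" for i j
    using mult_mat_nth[of "transpose_mat R" n n R n i j] R(1) that by (simp add: AR)
  have Bentry: "B $$ (i, j) = (\<Sum>k<n. \<mu> k * R $$ (k, i) * R $$ (k, j))" if "i < n" "j < n" for i j
  proof -
    have "B $$ (i, j) = (\<Sum>k<n. \<Sum>l<n. R $$ (k, i) * ?D $$ (k, l) * R $$ (l, j))"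
      using congruence_nth[OF R(1) D that] by (simp add: BR)
    also have "\<dots> = (\<Sum>k<n. \<Sum>l<n. if l = k then \<mu> k * R $$ (k, i) * R $$ (k, j) else 0)"
      by (intro sum.cong) (auto simp: mat_diag_def)
    finally show ?thesis by simp
  qed
  have detP: "(det P)\<^sup>2 * det A = 1" "(det P)\<^sup>2 * det B = (\<Prod>k<n. \<mu> k)"
  proof -
    have "det (transpose_mat P * A * P) = det P * det A * det P"
      using P(1) A'(1) by (simp add: det_mult[of _ n] det_transpose[OF P(1)])
    then show "(det P)\<^sup>2 * det A = 1" using P(2) by (simp add: power2_eq_square mult_ac)
    have "det (transpose_mat P * B * P) = det P * det B * det P"
      using P(1) B'(1) by (simp add: det_mult[of _ n] det_transpose[OF P(1)])
    then show "(det P)\<^sup>2 * det B = (\<Prod>k<n. \<mu> k)" using P(3) det_mat_diag[of n \<mu>]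
      by (simp add: power2_eq_square mult_ac)
  qed
  have logdet: "ln (det_plus B) - ln (det_plus A) = (\<Sum>k<n. ln (\<mu> k))"
  proof -
    have dA: "0 < det A" and dB: "0 < det B" using det_plus_pos_def A B by auto
    have dP: "(det P)\<^sup>2 = 1 / det A" using detP(1) dA by (simp add: field_simps)
    have "(\<Prod>k<n. \<mu> k) = det B / det A" using detP(2) dP by simp
    then have "ln (\<Prod>k<n. \<mu> k) = ln (det B) - ln (det A)" using dA dB by (simp add: ln_div)
    moreover have "ln (\<Prod>k<n. \<mu> k) = (\<Sum>k<n. ln (\<mu> k))"
      using pos by (intro ln_prod) (auto simp: less_imp_neq[symmetric])
    ultimately show ?thesis using det_plus_pos_def A B by simp
  qed
  have invA: "moore_penrose A = P * mat_diag n (\<lambda>_. 1) * transpose_mat P"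
  proof (rule moore_penrose_inverse[OF A'(1)])
    have "transpose_mat P * (A * P) = 1\<^sub>m n" using P A' by simp
    then have "(A * P) * transpose_mat P = 1\<^sub>m n"
      by (rule mat_mult_left_right_inverse[rotated 2]) (use P A' in auto)
    then show "A * (P * mat_diag n (\<lambda>_. 1) * transpose_mat P) = 1\<^sub>m n"
      using P(1) A'(1) by (simp add: mat_diag_one)
  qed (use P in auto)
  have invB: "moore_penrose B = P * mat_diag n (\<lambda>k. 1 / \<mu> k) * transpose_mat P"
  proof (rule moore_penrose_inverse[OF B'(1)])
    let ?E = "mat_diag n (\<lambda>k. 1 / \<mu> k)"
    have DE: "?D * ?E = 1\<^sub>m n" using pos unfolding mat_diag_mult
      by (force simp: mat_diag_def intro!: eq_matI)
    have "(transpose_mat R * F * R) * (P * E * transpose_mat P) = transpose_mat R * (F * ((R * P) * E)) * transpose_mat P"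
      if "F \<in> carrier_mat n n" "E \<in> carrier_mat n n" for F E
      using P(1) R(1) that by (simp add: assoc_mult_mat[of _ n n _ n _ n])
    from this[OF D mat_diag_dim]
    have "B * (P * ?E * transpose_mat P) = transpose_mat R * (?D * ((R * P) * ?E)) * transpose_mat P"
      unfolding BR .
    then show "B * (P * ?E * transpose_mat P) = 1\<^sub>m n"
      unfolding R(2) left_mult_one_mat[OF mat_diag_dim] DE using R(1) Rt by simp
  qed (use P in auto)
  show thesis
  proof (rule that[of \<mu> "\<lambda>i k. P $$ (i, k)"])
    show "(\<Sum>i<n. \<Sum>j<n. P $$ (i, k) * A $$ (i, j) * P $$ (j, l)) = (if k = l then 1 else 0)"
      if "k < n" "l < n" for k l
      using congruence_nth[OF P(1) A'(1) that] that by (simp add: P(2))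
    show "(\<Sum>i<n. \<Sum>j<n. (B $$ (i, j) - A $$ (i, j))\<^sup>2) \<le> K\<^sup>2 * (\<Sum>k<n. (\<mu> k - 1)\<^sup>2)"
      if "0 \<le> K" "\<And>x. quadratic_form n A x \<le> K * (\<Sum>i<n. (x i)\<^sup>2)" for K
    proof (rule frobenius_congruence_le[where A = "\<lambda>i j. A $$ (i, j)" and R = "\<lambda>k i. R $$ (k, i)"])
      show "B $$ (i, j) - A $$ (i, j) = (\<Sum>k<n. (\<mu> k - 1) * R $$ (k, i) * R $$ (k, j))"
        if "i < n" "j < n" for i j
        using that by (simp add: Aentry Bentry sum_subtractf[symmetric] algebra_simps)
      show "(\<Sum>i<n. \<Sum>j<n. x i * A $$ (i, j) * x j) \<le> K * (\<Sum>i<n. (x i)\<^sup>2)" for x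
        using that(2)[of x] by (simp add: quadratic_form_def)
    qed (use that Aentry in auto)
    show "scalar_prod (Matrix.vec n z) (mult_mat_vec (moore_penrose A) (Matrix.vec n z)) =
       (\<Sum>k<n. (\<Sum>i<n. P $$ (i, k) * z i)\<^sup>2)" for z
      unfolding invA quadratic_form_diag_congruence[OF P(1)] by simp
    show "scalar_prod (Matrix.vec n z) (mult_mat_vec (moore_penrose B) (Matrix.vec n z)) =
       (\<Sum>k<n. (\<Sum>i<n. P $$ (i, k) * z i)\<^sup>2 / \<mu> k)" for z
      unfolding invB quadratic_form_diag_congruence[OF P(1)] by simp
  qed (use pos nz mu logdet in auto)
qed

section \<open>Uniform bounds on covariance quadratic forms\<close>

definition near_grid :: "(nat \<Rightarrow> nat^'d) \<Rightarrow> real \<Rightarrow> nat \<Rightarrow> (nat \<Rightarrow> real^'d) \<Rightarrow> bool" where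
  "near_grid v \<tau> n s \<longleftrightarrow> (\<forall>i\<in>{1..n}. \<forall>k. \<bar>s i $ k - real (v i $ k)\<bar> \<le> \<tau>)"

lemma near_grid_diff:
  assumes "near_grid v \<tau> n s" "i \<in> {1..n}" "j \<in> {1..n}"
  shows "\<bar>(s i - s j) $ k - (real (v i $ k) - real (v j $ k))\<bar> \<le> 2 * \<tau>"
proof -
  have "\<bar>s i $ k - real (v i $ k)\<bar> \<le> \<tau>" "\<bar>s j $ k - real (v j $ k)\<bar> \<le> \<tau>"
    using assms by (auto simp: near_grid_def)
  then show ?thesis by simp
qed

text \<open>Distinct points of the grid have distinct difference vectors to a fixed point, so a product
  weight summed over them is dominated by its sum over a full box, which factorizes.\<close>

lemma sum_over_grid_le:
  fixes v :: "nat \<Rightarrow> nat^'d" and w :: "int \<Rightarrow> real"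
  assumes inj: "inj_on v J" and fin: "finite J" and w: "\<And>m. 0 \<le> w m"
    and B: "\<And>M::nat. (\<Sum>m\<in>{- int M..int M}. w m) \<le> B"
  shows "(\<Sum>j\<in>J. \<Prod>k\<in>UNIV. w (int (u $ k) - int (v j $ k))) \<le> B ^ CARD('d)"
proof -
  define \<phi> where "\<phi> j = (\<lambda>k. int (u $ k) - int (v j $ k))" for j
  define M where "M = (\<Sum>j\<in>J. \<Sum>k\<in>UNIV. nat \<bar>\<phi> j k\<bar>)"
  have M: "\<phi> j k \<in> {- int M..int M}" if "j \<in> J" for j k
  proof -
    have "nat \<bar>\<phi> j k\<bar> \<le> (\<Sum>k\<in>UNIV. nat \<bar>\<phi> j k\<bar>)" by (intro member_le_sum) auto
    also have "\<dots> \<le> M" unfolding M_def using that fin by (intro member_le_sum) auto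
    finally show ?thesis by auto
  qed
  have inj': "inj_on \<phi> J"
  proof (rule inj_onI)
    fix i j assume ij: "i \<in> J" "j \<in> J" "\<phi> i = \<phi> j"
    then have "\<And>k. \<phi> i k = \<phi> j k" by simp
    then have "v i = v j" by (simp add: \<phi>_def Finite_Cartesian_Product.vec_eq_iff)
    then show "i = j" using ij inj by (auto dest: inj_onD)
  qed
  have "(\<Sum>j\<in>J. \<Prod>k\<in>UNIV. w (int (u $ k) - int (v j $ k))) = (\<Sum>j\<in>J. \<Prod>k\<in>UNIV. w (\<phi> j k))"
    by (simp add: \<phi>_def)
  also have "\<dots> = (\<Sum>g\<in>\<phi> ` J. \<Prod>k\<in>UNIV. w (g k))"
    by (subst sum.reindex[OF inj']) simp
  also have "\<dots> \<le> (\<Sum>g\<in>PiE (UNIV::'d set) (\<lambda>_. {- int M..int M}). \<Prod>k\<in>UNIV. w (g k))"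
    by (intro sum_mono2) (use M in \<open>auto intro!: finite_PiE prod_nonneg w\<close>)
  also have "\<dots> = (\<Prod>k\<in>(UNIV::'d set). \<Sum>m\<in>{- int M..int M}. w m)"
    by (subst prod_sum_PiE) auto
  also have "\<dots> = (\<Sum>m\<in>{- int M..int M}. w m) ^ CARD('d)" by simp
  also have "\<dots> \<le> B ^ CARD('d)" using B w by (intro power_mono sum_nonneg) auto
  finally show ?thesis .
qed

lemma schur_test:
  fixes G :: "nat \<Rightarrow> nat \<Rightarrow> real"
  assumes sym: "\<And>i j. i < n \<Longrightarrow> j < n \<Longrightarrow> G i j = G j i"
    and row: "\<And>i. i < n \<Longrightarrow> (\<Sum>j<n. \<bar>G i j\<bar>) \<le> m"
  shows "\<bar>\<Sum>i<n. \<Sum>j<n. a i * G i j * a j\<bar> \<le> m * (\<Sum>i<n. (a i)\<^sup>2)"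
proof -
  have "\<bar>\<Sum>i<n. \<Sum>j<n. a i * G i j * a j\<bar> \<le> (\<Sum>i<n. \<Sum>j<n. \<bar>a i * G i j * a j\<bar>)"
    by (rule order_trans[OF sum_abs]) (intro sum_mono sum_abs)
  also have "\<dots> \<le> (\<Sum>i<n. \<Sum>j<n. (a i)\<^sup>2 / 2 * \<bar>G i j\<bar> + (a j)\<^sup>2 / 2 * \<bar>G i j\<bar>)"
  proof (intro sum_mono)
    fix i j
    have "\<bar>a i\<bar> * \<bar>a j\<bar> \<le> (a i)\<^sup>2 / 2 + (a j)\<^sup>2 / 2"
      using sum_squares_bound[of "\<bar>a i\<bar>" "\<bar>a j\<bar>"] by simp
    then have "\<bar>a i\<bar> * \<bar>a j\<bar> * \<bar>G i j\<bar> \<le> ((a i)\<^sup>2 / 2 + (a j)\<^sup>2 / 2) * \<bar>G i j\<bar>"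
      by (intro mult_right_mono) auto
    then show "\<bar>a i * G i j * a j\<bar> \<le> (a i)\<^sup>2 / 2 * \<bar>G i j\<bar> + (a j)\<^sup>2 / 2 * \<bar>G i j\<bar>"
      by (simp add: abs_mult algebra_simps)
  qed
  also have "\<dots> = (\<Sum>i<n. \<Sum>j<n. (a i)\<^sup>2 / 2 * \<bar>G i j\<bar>) + (\<Sum>i<n. \<Sum>j<n. (a j)\<^sup>2 / 2 * \<bar>G i j\<bar>)"
    by (simp add: sum.distrib)
  also have "(\<Sum>i<n. \<Sum>j<n. (a j)\<^sup>2 / 2 * \<bar>G i j\<bar>) = (\<Sum>j<n. \<Sum>i<n. (a j)\<^sup>2 / 2 * \<bar>G i j\<bar>)"
    by (rule sum.swap)
  also have "\<dots> = (\<Sum>i<n. \<Sum>j<n. (a i)\<^sup>2 / 2 * \<bar>G i j\<bar>)"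
    using sym by (intro sum.cong refl) auto
  also have "(\<Sum>i<n. \<Sum>j<n. (a i)\<^sup>2 / 2 * \<bar>G i j\<bar>) + (\<Sum>i<n. \<Sum>j<n. (a i)\<^sup>2 / 2 * \<bar>G i j\<bar>)
      = (\<Sum>i<n. (a i)\<^sup>2 * (\<Sum>j<n. \<bar>G i j\<bar>))"
    by (simp add: sum_distrib_left sum.distrib[symmetric] mult.commute)
  also have "\<dots> \<le> (\<Sum>i<n. (a i)\<^sup>2 * m)" using row by (intro sum_mono mult_left_mono) auto
  also have "\<dots> = m * (\<Sum>i<n. (a i)\<^sup>2)" by (simp add: sum_distrib_left mult.commute)
  finally show ?thesis .
qed

lemma sum_Suc_index: "(\<Sum>j<n. f (Suc j)) = (\<Sum>j\<in>{1..n}. f j)"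
  by (simp add: sum.atLeast1_atMost_eq)

text \<open>Only a bounded number of locations lie within distance \<open>C\<close> of a given one, which bounds the
  row sums of a matrix built from a compactly supported function.\<close>

lemma compact_support_form_bound:
  fixes v :: "nat \<Rightarrow> nat^'d"
  assumes inj: "inj_on v {1..}" and \<tau>: "\<tau> \<le> 1 / 2"
  shows "\<exists>m>0. \<forall>(h :: real^'d \<Rightarrow> real) (H :: real) n s a. near_grid v \<tau> n s \<longrightarrow> (\<forall>x. h (- x) = h x) \<longrightarrow> (\<forall>x. \<bar>h x\<bar> \<le> H) \<longrightarrow>
    (\<forall>x. C < norm x \<longrightarrow> h x = 0) \<longrightarrow>
    \<bar>\<Sum>i<n. \<Sum>j<n. a i * h (s (Suc i) - s (Suc j)) * a j\<bar> \<le> m * H * (\<Sum>i<n. (a i)\<^sup>2)"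
proof -
  define N where "N = nat \<lceil>C + 1\<rceil>"
  define w :: "int \<Rightarrow> real" where "w m = (if \<bar>m\<bar> \<le> int N then 1 else 0)" for m
  define B where "B = real (2 * N + 1)"
  have w: "(\<Sum>m\<in>{- int M..int M}. w m) \<le> B" for M
  proof -
    have "(\<Sum>m\<in>{- int M..int M}. w m) = real (card {m\<in>{- int M..int M}. \<bar>m\<bar> \<le> int N})"
      by (simp add: w_def sum.If_cases Int_def)
    also have "\<dots> \<le> real (card {- int N..int N})"
      by (intro of_nat_mono card_mono) auto
    finally show ?thesis by (simp add: B_def)
  qed
  show ?thesis
  proof (intro exI[of _ "B ^ CARD('d)"] conjI allI impI)
    show "0 < B ^ CARD('d)" by (simp add: B_def)
    fix h :: "real^'d \<Rightarrow> real" and H :: real and n and s :: "nat \<Rightarrow> real^'d" and a :: "nat \<Rightarrow> real"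
    assume ng: "near_grid v \<tau> n s" and even: "\<forall>x. h (- x) = h x" and H: "\<forall>x. \<bar>h x\<bar> \<le> H"
      and C: "\<forall>x. C < norm x \<longrightarrow> h x = 0"
    have H0: "0 \<le> H" using H[rule_format, of 0] by linarith
    show "\<bar>\<Sum>i<n. \<Sum>j<n. a i * h (s (Suc i) - s (Suc j)) * a j\<bar> \<le> B ^ CARD('d) * H * (\<Sum>i<n. (a i)\<^sup>2)"
    proof (rule schur_test)
      fix i assume i: "i < n"
      have "(\<Sum>j<n. \<bar>h (s (Suc i) - s (Suc j))\<bar>) = (\<Sum>j\<in>{1..n}. \<bar>h (s (Suc i) - s j)\<bar>)"
        by (rule sum_Suc_index)
      also have "\<dots> \<le> (\<Sum>j\<in>{1..n}. H * (\<Prod>k\<in>UNIV. w (int (v (Suc i) $ k) - int (v j $ k))))"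
      proof (intro sum_mono)
        fix j assume j: "j \<in> {1..n}"
        show "\<bar>h (s (Suc i) - s j)\<bar> \<le> H * (\<Prod>k\<in>UNIV. w (int (v (Suc i) $ k) - int (v j $ k)))"
        proof (cases "norm (s (Suc i) - s j) \<le> C")
          case True
          have "w (int (v (Suc i) $ k) - int (v j $ k)) = 1" for k
          proof -
            have "\<bar>(s (Suc i) - s j) $ k\<bar> \<le> C"
              using True component_le_norm_cart[of "s (Suc i) - s j" k] by simp
            moreover have "\<bar>(s (Suc i) - s j) $ k - (real (v (Suc i) $ k) - real (v j $ k))\<bar> \<le> 2 * \<tau>"
              using i j by (intro near_grid_diff[OF ng]) auto
            ultimately have "\<bar>real (v (Suc i) $ k) - real (v j $ k)\<bar> \<le> C + 1" using \<tau> by linarith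
            then have "real_of_int \<bar>int (v (Suc i) $ k) - int (v j $ k)\<bar> \<le> C + 1" by simp
            then have "\<bar>int (v (Suc i) $ k) - int (v j $ k)\<bar> \<le> int N"
              unfolding N_def by linarith
            then show ?thesis by (simp add: w_def)
          qed
          then show ?thesis using H by simp
        next
          case False
          then have "h (s (Suc i) - s j) = 0" using C by simp
          moreover have "0 \<le> H * (\<Prod>k\<in>UNIV. w (int (v (Suc i) $ k) - int (v j $ k)))"
            using H0 by (intro mult_nonneg_nonneg prod_nonneg) (auto simp: w_def)
          ultimately show ?thesis by simp
        qed
      qed
      also have "\<dots> = H * (\<Sum>j\<in>{1..n}. \<Prod>k\<in>UNIV. w (int (v (Suc i) $ k) - int (v j $ k)))"
        by (simp add: sum_distrib_left)
      also have "\<dots> \<le> H * B ^ CARD('d)"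
        using H0 w by (intro mult_left_mono sum_over_grid_le inj_on_subset[OF inj]) (auto simp: w_def)
      finally show "(\<Sum>j<n. \<bar>h (s (Suc i) - s (Suc j))\<bar>) \<le> B ^ CARD('d) * H" by (simp add: mult.commute)
    next
      fix i j show "h (s (Suc i) - s (Suc j)) = h (s (Suc j) - s (Suc i))"
        using even[rule_format, of "s (Suc i) - s (Suc j)"] by simp
    qed
  qed
qed

section \<open>Fourier integrals\<close>

definition fourier_pair :: "(real^'d \<Rightarrow> real) \<Rightarrow> (real^'d \<Rightarrow> real) \<Rightarrow> bool" where
  "fourier_pair h g \<longleftrightarrow> (\<forall>s. has_bochner_integral lborel
     (\<lambda>f. complex_of_real (h f) * exp (\<i> * complex_of_real (f \<bullet> s))) (complex_of_real (g s)))"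

text \<open>The form is the integral of \<open>h\<close> against \<open>\<bar>\<Sum> a\<^sub>i exp (i f s\<^sub>i)\<bar>\<^sup>2\<close>, the easy direction of Bochner's
  theorem. It turns pointwise comparisons of spectral densities into comparisons of forms.\<close>

lemma fourier_pair_quadratic_form:
  fixes s :: "nat \<Rightarrow> real^'d"
  assumes "fourier_pair h g"
  shows "has_bochner_integral lborel
    (\<lambda>f. h f * (cmod (\<Sum>i<n. complex_of_real (a i) * exp (\<i> * complex_of_real (f \<bullet> s i))))\<^sup>2)
    (\<Sum>i<n. \<Sum>j<n. a i * g (s i - s j) * a j)"
proof -
  let ?e = "\<lambda>f x. exp (\<i> * complex_of_real (f \<bullet> x))"
  let ?S = "\<lambda>f. \<Sum>i<n. complex_of_real (a i) * ?e f (s i)"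
  have b: "has_bochner_integral lborel (\<lambda>f. complex_of_real (h f) * ?e f x) (complex_of_real (g x))" for x
    using assms by (simp add: fourier_pair_def)
  have eq: "complex_of_real (h f * (cmod (?S f))\<^sup>2) =
     (\<Sum>i<n. \<Sum>j<n. complex_of_real (a i * a j) * (complex_of_real (h f) * ?e f (s i - s j)))" for f
  proof -
    have "complex_of_real ((cmod (?S f))\<^sup>2) = ?S f * cnj (?S f)"
      by (simp only: complex_norm_square)
    also have "cnj (?S f) = (\<Sum>j<n. complex_of_real (a j) * exp (- (\<i> * complex_of_real (f \<bullet> s j))))"
      by (simp add: exp_cnj)
    also have "?S f * \<dots> = (\<Sum>i<n. \<Sum>j<n. complex_of_real (a i * a j) * (?e f (s i) * exp (- (\<i> * complex_of_real (f \<bullet> s j)))))"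
      by (simp add: sum_product mult_ac)
    also have "\<dots> = (\<Sum>i<n. \<Sum>j<n. complex_of_real (a i * a j) * ?e f (s i - s j))"
      by (simp add: exp_add[symmetric] inner_diff_right algebra_simps)
    finally show ?thesis by (simp add: sum_distrib_left mult_ac)
  qed
  have "has_bochner_integral lborel (\<lambda>f. complex_of_real (h f * (cmod (?S f))\<^sup>2))
      (\<Sum>i<n. \<Sum>j<n. complex_of_real (a i * a j) * complex_of_real (g (s i - s j)))"
    unfolding eq by (intro has_bochner_integral_sum has_bochner_integral_mult_right b)
  from has_bochner_integral_bounded_linear[OF bounded_linear_Re this]
  show ?thesis by (simp add: mult_ac)
qed

lemma fourier_pair_mono_quadratic_form:
  fixes s :: "nat \<Rightarrow> real^'d"
  assumes "fourier_pair h g" "fourier_pair h' g'" "\<And>f. \<delta> * h' f \<le> h f"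
  shows "\<delta> * (\<Sum>i<n. \<Sum>j<n. a i * g' (s i - s j) * a j) \<le> (\<Sum>i<n. \<Sum>j<n. a i * g (s i - s j) * a j)"
proof -
  let ?q = "\<lambda>f. (cmod (\<Sum>i<n. complex_of_real (a i) * exp (\<i> * complex_of_real (f \<bullet> s i))))\<^sup>2"
  have 1: "has_bochner_integral lborel (\<lambda>f. h f * ?q f) (\<Sum>i<n. \<Sum>j<n. a i * g (s i - s j) * a j)"
    by (rule fourier_pair_quadratic_form[OF assms(1)])
  have 2: "has_bochner_integral lborel (\<lambda>f. \<delta> * (h' f * ?q f)) (\<delta> * (\<Sum>i<n. \<Sum>j<n. a i * g' (s i - s j) * a j))"
    by (intro has_bochner_integral_mult_right fourier_pair_quadratic_form[OF assms(2)])
  have "(\<integral>f. \<delta> * (h' f * ?q f) \<partial>lborel) \<le> (\<integral>f. h f * ?q f \<partial>lborel)"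
  proof (rule integral_mono)
    fix f
    show "\<delta> * (h' f * ?q f) \<le> h f * ?q f"
      using mult_right_mono[OF assms(3)[of f], of "?q f"] by (simp add: mult_ac)
  qed (use 1 2 in \<open>auto simp: has_bochner_integral_iff\<close>)
  then show ?thesis
    unfolding has_bochner_integral_integral_eq[OF 1] has_bochner_integral_integral_eq[OF 2] .
qed

lemma fourier_pair_integrable:
  assumes "fourier_pair h g"
  shows "integrable lborel h" "(\<integral>f. h f \<partial>lborel) = g 0"
proof -
  have "has_bochner_integral lborel (\<lambda>f. complex_of_real (h f)) (complex_of_real (g 0))"
    using assms[unfolded fourier_pair_def, rule_format, of 0] by simp
  from has_bochner_integral_bounded_linear[OF bounded_linear_Re this]
  show "integrable lborel h" "(\<integral>f. h f \<partial>lborel) = g 0" by (auto simp: has_bochner_integral_iff)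
qed

lemma fourier_pair_diff_le:
  assumes 1: "fourier_pair h g" and 2: "fourier_pair h' g'"
  shows "\<bar>g s - g' s\<bar> \<le> (\<integral>f. \<bar>h f - h' f\<bar> \<partial>lborel)"
proof -
  let ?e = "\<lambda>f. exp (\<i> * complex_of_real (f \<bullet> s))"
  have "has_bochner_integral lborel (\<lambda>f. complex_of_real (h f) * ?e f - complex_of_real (h' f) * ?e f)
      (complex_of_real (g s) - complex_of_real (g' s))"
    using 1 2 by (intro has_bochner_integral_diff) (auto simp: fourier_pair_def)
  then have "complex_of_real (g s - g' s) = (\<integral>f. complex_of_real (h f) * ?e f - complex_of_real (h' f) * ?e f \<partial>lborel)"
    by (simp add: has_bochner_integral_iff)
  then have "\<bar>g s - g' s\<bar> = cmod (\<integral>f. complex_of_real (h f) * ?e f - complex_of_real (h' f) * ?e f \<partial>lborel)"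
    by (metis norm_of_real)
  also have "\<dots> \<le> (\<integral>f. cmod (complex_of_real (h f) * ?e f - complex_of_real (h' f) * ?e f) \<partial>lborel)"
    by (rule integral_norm_bound)
  also have "\<dots> = (\<integral>f. \<bar>h f - h' f\<bar> \<partial>lborel)"
  proof (intro Bochner_Integration.integral_cong refl)
    fix f
    have "complex_of_real (h f) * ?e f - complex_of_real (h' f) * ?e f = complex_of_real (h f - h' f) * ?e f"
      by (simp add: algebra_simps)
    then show "cmod (complex_of_real (h f) * ?e f - complex_of_real (h' f) * ?e f) = \<bar>h f - h' f\<bar>"
      by (simp only: norm_mult norm_of_real norm_exp_i_times mult_1_right)
  qed
  finally show ?thesis .
qed

definition tent :: "real \<Rightarrow> real \<Rightarrow> real" where
  "tent b x = max 0 (1 - \<bar>x\<bar> / b)"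

text \<open>The Fourier integral of the tent function (the Fejer kernel, up to scaling).\<close>

definition fejer :: "real \<Rightarrow> real \<Rightarrow> real" where
  "fejer b t = (if t = 0 then b else 2 * (1 - cos (b * t)) / (b * t\<^sup>2))"

lemma fejer_bounds:
  assumes "0 < b"
  shows "0 \<le> fejer b t" "fejer b t \<le> b" "t \<noteq> 0 \<Longrightarrow> fejer b t \<le> 4 / (b * t\<^sup>2)"
proof -
  show "0 \<le> fejer b t" using assms by (auto simp: fejer_def)
  show "fejer b t \<le> b"
  proof (cases "t = 0")
    case False
    have "1 - cos (b * t) = 2 * (sin (b * t / 2))\<^sup>2"
      using cos_double_sin[of "b * t / 2"] by simp
    also have "\<dots> \<le> 2 * (b * t / 2)\<^sup>2"
      using abs_sin_x_le_abs_x[of "b * t / 2"] unfolding abs_le_square_iff by simp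
    finally have "2 * (1 - cos (b * t)) \<le> b * (b * t\<^sup>2)" by (simp add: power2_eq_square)
    then show ?thesis using False assms by (simp add: fejer_def divide_le_eq)
  qed (simp add: fejer_def)
  show "fejer b t \<le> 4 / (b * t\<^sup>2)" if "t \<noteq> 0"
  proof -
    have "1 - cos (b * t) \<le> 2" using cos_ge_minus_one[of "b * t"] by linarith
    then have "2 * (1 - cos (b * t)) \<le> 2 * 2" by (rule mult_left_mono) simp
    then have "2 * (1 - cos (b * t)) \<le> 4" by simp
    then show ?thesis using that assms unfolding fejer_def by (simp add: divide_right_mono)
  qed
qed

text \<open>On each side of 0 the integrand is an affine function times an exponential, which has an elementary
  primitive.\<close>

lemma tent_fourier:
  assumes b: "0 < b"
  shows "has_bochner_integral lborel
    (\<lambda>x. complex_of_real (tent b x) * exp (\<i> * complex_of_real (x * t))) (complex_of_real (fejer b t))"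
proof -
  let ?e = "\<lambda>x. exp (\<i> * complex_of_real (x * t))"
  have half: "has_bochner_integral lborel
      (\<lambda>x. indicator {l..u} x *\<^sub>R ((1 + complex_of_real (\<sigma> * x / b)) * ?e x)) (F u - F l)"
    if "l \<le> u" "\<And>x. (F has_vector_derivative (1 + complex_of_real (\<sigma> * x / b)) * ?e x) (at x)"
    for l u \<sigma> F
  proof (rule has_bochner_integral_FTC_Icc)
    show "continuous_on {l..u} (\<lambda>x. (1 + complex_of_real (\<sigma> * x / b)) * ?e x)"
      using b by (intro continuous_intros) auto
  qed (rule that(1), rule has_vector_derivative_at_within[OF that(2)])
  define c where "c = (\<lambda>\<sigma>::real. complex_of_real (\<sigma> / b))"
  define F where "F \<sigma> x = (if t = 0 then complex_of_real (x + \<sigma> * x\<^sup>2 / (2 * b)) else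
     ((1 + complex_of_real (\<sigma> * x / b)) / (\<i> * of_real t) - c \<sigma> / (\<i> * of_real t)\<^sup>2) * ?e x)" for \<sigma> x
  have F: "(F \<sigma> has_vector_derivative (1 + complex_of_real (\<sigma> * x / b)) * ?e x) (at x)" for \<sigma> x
  proof (cases "t = 0")
    case True
    have "((\<lambda>x. x + \<sigma> * x\<^sup>2 / (2 * b)) has_real_derivative (1 + \<sigma> * x / b)) (at x)"
      using b by (auto intro!: derivative_eq_intros simp: field_simps)
    then have "((\<lambda>x. complex_of_real (x + \<sigma> * x\<^sup>2 / (2 * b))) has_vector_derivative complex_of_real (1 + \<sigma> * x / b)) (at x)"
      by (intro has_vector_derivative_of_real)
        (simp add: has_real_derivative_iff_has_vector_derivative)
    then show ?thesis using True by (simp add: F_def[abs_def])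
  next
    case False
    define w where "w = \<i> * complex_of_real t"
    have w: "w \<noteq> 0" using False by (simp add: w_def)
    let ?G = "\<lambda>z. ((1 + c \<sigma> * z) / w - c \<sigma> / w\<^sup>2) * exp (w * z)"
    have "(?G has_field_derivative (1 + c \<sigma> * complex_of_real x) * exp (w * complex_of_real x)) (at (complex_of_real x))"
      using w by (auto intro!: derivative_eq_intros simp: field_simps power2_eq_square)
    from field_vector_diff_chain_at[of complex_of_real 1 x ?G, OF _ this]
      has_vector_derivative_of_real[OF DERIV_ident[of "at x"], where 'a = complex]
    have "((?G \<circ> complex_of_real) has_vector_derivative (1 + c \<sigma> * complex_of_real x) * exp (w * complex_of_real x)) (at x)"
      by simp
    moreover have "?G \<circ> complex_of_real = F \<sigma>"
      using False by (auto simp: F_def w_def c_def fun_eq_iff mult_ac)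
    ultimately show ?thesis by (simp add: w_def c_def mult_ac)
  qed
  have "has_bochner_integral lborel
      (\<lambda>x. indicator {-b..0} x *\<^sub>R ((1 + complex_of_real (1 * x / b)) * ?e x) +
           indicator {0..b} x *\<^sub>R ((1 + complex_of_real (-1 * x / b)) * ?e x))
      ((F 1 0 - F 1 (-b)) + (F (-1) b - F (-1) 0))"
    using b by (intro has_bochner_integral_add half F) auto
  also have "(F 1 0 - F 1 (-b)) + (F (-1) b - F (-1) 0) = complex_of_real (fejer b t)"
  proof (cases "t = 0")
    case True
    then show ?thesis using b by (simp add: F_def fejer_def power2_eq_square)
  next
    case False
    have "(F 1 0 - F 1 (-b)) + (F (-1) b - F (-1) 0)
       = (exp (\<i> * complex_of_real (b * t)) + exp (- (\<i> * complex_of_real (b * t))) - 2) * (- 1 / (complex_of_real b * (complex_of_real t)\<^sup>2))"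
      using False b by (simp add: F_def c_def field_simps power2_eq_square)
    also have "exp (\<i> * complex_of_real (b * t)) + exp (- (\<i> * complex_of_real (b * t))) = complex_of_real (2 * cos (b * t))"
      by (simp add: cos_exp_eq flip: cos_of_real)
    finally show ?thesis using False b by (simp add: fejer_def field_simps)
  qed
  finally have *: "has_bochner_integral lborel
      (\<lambda>x. indicator {-b..0} x *\<^sub>R ((1 + complex_of_real (1 * x / b)) * ?e x) +
           indicator {0..b} x *\<^sub>R ((1 + complex_of_real (-1 * x / b)) * ?e x)) (complex_of_real (fejer b t))" .
  show ?thesis
  proof (subst has_bochner_integral_cong_AE)
    show "AE x in lborel. complex_of_real (tent b x) * ?e x =
       indicator {-b..0} x *\<^sub>R ((1 + complex_of_real (1 * x / b)) * ?e x) +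
       indicator {0..b} x *\<^sub>R ((1 + complex_of_real (-1 * x / b)) * ?e x)"
      using AE_lborel_singleton[of "0::real"]
    proof eventually_elim
      case (elim x)
      have "b < \<bar>x\<bar> \<Longrightarrow> tent b x = 0" "\<bar>x\<bar> \<le> b \<Longrightarrow> tent b x = 1 - \<bar>x\<bar> / b"
        using b by (auto simp: tent_def max_def field_simps)
      then show ?case using elim b by (auto simp: indicator_def abs_if split: if_splits)
    qed
  qed (use * in \<open>auto simp: tent_def[abs_def]\<close>)
qed

lemma has_bochner_integral_lborel_prod:
  fixes h :: "'a::euclidean_space \<Rightarrow> real \<Rightarrow> complex"
  assumes h: "\<And>b. b \<in> Basis \<Longrightarrow> has_bochner_integral lborel (h b) (I b)"
  shows "has_bochner_integral lborel (\<lambda>x. \<Prod>b\<in>Basis. h b (x \<bullet> b)) (\<Prod>b\<in>Basis. I b)"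
proof -
  interpret product_sigma_finite "\<lambda>_::'a. lborel :: real measure" by standard
  have int: "integrable lborel (h b)" and val: "integral\<^sup>L lborel (h b) = I b" if "b \<in> Basis" for b
    using h[OF that] by (auto simp: has_bochner_integral_iff)
  have [measurable]: "h b \<in> borel_measurable borel" if "b \<in> Basis" for b
    using int[OF that] by auto
  let ?T = "\<lambda>f. \<Sum>b\<in>Basis. f b *\<^sub>R b"
  have coord: "?T f \<bullet> b = f b" if "b \<in> Basis" for f b
    using that by simp
  have "has_bochner_integral (distr (Pi\<^sub>M Basis (\<lambda>_. lborel)) borel ?T)
     (\<lambda>x. \<Prod>b\<in>Basis. h b (x \<bullet> b)) (\<Prod>b\<in>Basis. I b)"
  proof (rule has_bochner_integral_distr)
    show "has_bochner_integral (Pi\<^sub>M Basis (\<lambda>_. lborel)) (\<lambda>f. \<Prod>b\<in>Basis. h b (?T f \<bullet> b)) (\<Prod>b\<in>Basis. I b)"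
      using product_integrable_prod[of Basis h] product_integral_prod[of Basis h] int val
      by (simp add: has_bochner_integral_iff coord cong: prod.cong)
  qed measurable
  then show ?thesis unfolding lborel_eq[symmetric] .
qed

text \<open>Both the product of tents and the character \<open>exp (i f s)\<close> factorize over the coordinates.\<close>

lemma tent_product_fourier_pair:
  assumes "0 < b"
  shows "fourier_pair (\<lambda>f :: real^'d. \<Prod>k\<in>UNIV. tent b (f $ k)) (\<lambda>s. \<Prod>k\<in>UNIV. fejer b (s $ k))"
  unfolding fourier_pair_def
proof
  fix s :: "real^'d"
  have Basis: "(\<Prod>b\<in>Basis. \<phi> b) = (\<Prod>k\<in>UNIV. \<phi> (axis k 1))" for \<phi> :: "real^'d \<Rightarrow> complex"
  proof -
    have B: "(Basis :: (real^'d) set) = range (\<lambda>k. axis k 1)" by (auto simp: Basis_vec_def)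
    have I: "inj (\<lambda>k::'d. axis k (1::real))" by (auto simp: inj_def axis_eq_axis)
    show ?thesis unfolding B prod.reindex[OF I] comp_def ..
  qed
  have "has_bochner_integral lborel
    (\<lambda>f. \<Prod>b\<in>Basis. complex_of_real (tent b' (f \<bullet> b)) * exp (\<i> * complex_of_real ((f \<bullet> b) * (s \<bullet> b))))
    (\<Prod>b\<in>Basis. complex_of_real (fejer b' (s \<bullet> b)))" if "b' = b" for b'
    using has_bochner_integral_lborel_prod[of
       "\<lambda>b x. complex_of_real (tent b' x) * exp (\<i> * complex_of_real (x * (s \<bullet> b)))"
       "\<lambda>b. complex_of_real (fejer b' (s \<bullet> b))"] tent_fourier[of b'] that assms by simp
  from this[OF refl] have "has_bochner_integral lborel
    (\<lambda>f. \<Prod>k\<in>UNIV. complex_of_real (tent b (f $ k)) * exp (\<i> * complex_of_real ((f $ k) * (s $ k))))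
    (\<Prod>k\<in>UNIV. complex_of_real (fejer b (s $ k)))"
    by (simp add: Basis inner_axis)
  moreover have "(\<Prod>k\<in>UNIV. complex_of_real (tent b (f $ k)) * exp (\<i> * complex_of_real ((f $ k) * (s $ k))))
     = complex_of_real (\<Prod>k\<in>UNIV. tent b (f $ k)) * exp (\<i> * complex_of_real (f \<bullet> s))" for f
    by (simp add: prod.distrib exp_sum[symmetric] inner_vec_def sum_distrib_left)
  ultimately show "has_bochner_integral lborel (\<lambda>f. complex_of_real (\<Prod>k\<in>UNIV. tent b (f $ k)) *
      exp (\<i> * complex_of_real (f \<bullet> s))) (complex_of_real (\<Prod>k\<in>UNIV. fejer b (s $ k)))"
    by simp
qed

section \<open>A uniform lower bound for covariance matrices\<close>

text \<open>A Fejer kernel with a wide frequency window is so concentrated that its matrix over a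
  perturbed grid is diagonally dominant.\<close>

lemma fejer_form_lower_bound:
  fixes v :: "nat \<Rightarrow> nat^'d"
  assumes inj: "inj_on v {1..}" and \<tau>: "0 \<le> \<tau>" "\<tau> < 1 / 2"
  shows "\<exists>b>0. \<forall>n (s :: nat \<Rightarrow> real^'d) a. near_grid v \<tau> n s \<longrightarrow>
    b ^ CARD('d) / 2 * (\<Sum>i<n. (a i)\<^sup>2) \<le>
    (\<Sum>i<n. \<Sum>j<n. a i * (\<Prod>k\<in>UNIV. fejer b ((s (Suc i) - s (Suc j)) $ k)) * a j)"
proof -
  \<comment> \<open>The weights of all points of a full row, relative to the diagonal, sum to at most \<open>\<rho>\<^sup>d = 3 / 2\<close>;
    the diagonal accounts for 1, which leaves 1 / 2 for the rest.\<close>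
  define \<rho> where "\<rho> = root CARD('d) (3 / 2)"
  have \<rho>: "1 < \<rho>" "\<rho> ^ CARD('d) = 3 / 2" by (auto simp: \<rho>_def)
  define \<eta> where "\<eta> = \<rho> / 4 - 1 / 4"
  have \<eta>: "0 < \<eta>" "1 + 4 * \<eta> = \<rho>"
  proof -
    show "0 < \<eta>" using \<rho>(1) by (simp add: \<eta>_def)
    have "4 * \<eta> = \<rho> - 1" by (simp add: \<eta>_def right_diff_distrib)
    then show "1 + 4 * \<eta> = \<rho>" by linarith
  qed
  \<comment> \<open>The window width for which the decay \<open>4 / (b t\<^sup>2)\<close> at \<open>\<bar>t\<bar> \<ge> (1 - 2 \<tau>) \<bar>m\<bar>\<close> is exactly \<open>b \<eta> / m\<^sup>2\<close>.\<close>
  define b where "b = 2 / ((1 - 2 * \<tau>) * sqrt \<eta>)"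
  have b: "0 < b" using \<eta> \<tau> by (simp add: b_def)
  have b2: "4 / (b * (1 - 2 * \<tau>)\<^sup>2) = b * \<eta>"
  proof -
    define q r where "q = 1 - 2 * \<tau>" and "r = sqrt \<eta>"
    have "0 < q" "0 < r" "\<eta> = r * r" "b = 2 / (q * r)"
      using \<eta>(1) \<tau> by (auto simp: q_def r_def b_def)
    then have "b * b * q\<^sup>2 * \<eta> = 4" by (simp add: power2_eq_square)
    then have "b * b * (1 - 2 * \<tau>)\<^sup>2 * \<eta> = 4" by (simp only: q_def)
    then show ?thesis using b \<tau> by (simp add: field_simps)
  qed
  define w :: "int \<Rightarrow> real" where "w m = (if m = 0 then 1 else \<eta> / (real_of_int m)\<^sup>2)" for m
  have w0: "0 \<le> w m" for m using \<eta> by (simp add: w_def)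
  have w_even: "w (- m) = w m" for m by (simp add: w_def)
  \<comment> \<open>A telescoping majorant of \<open>\<Sum> 1 / m\<^sup>2\<close>, strengthened by the remainder to make the induction work.\<close>
  have wsum1: "(\<Sum>m\<in>{- int (Suc M)..int (Suc M)}. w m) \<le> 1 + 4 * \<eta> - 2 * \<eta> / real (Suc M)" for M
  proof (induction M)
    case 0
    have "{- int (Suc 0)..int (Suc 0)} = {-1, 0, 1}" by auto
    then show ?case by (simp add: w_def)
  next
    case (Suc M)
    let ?N = "real (Suc M)"
    have "{- int (Suc (Suc M))..int (Suc (Suc M))} =
      insert (- int (Suc (Suc M))) (insert (int (Suc (Suc M))) {- int (Suc M)..int (Suc M)})" by auto
    then have "(\<Sum>m\<in>{- int (Suc (Suc M))..int (Suc (Suc M))}. w m)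
       = w (- int (Suc (Suc M))) + (w (int (Suc (Suc M))) + (\<Sum>m\<in>{- int (Suc M)..int (Suc M)}. w m))"
      by simp
    also have "w (- int (Suc (Suc M))) = w (int (Suc (Suc M)))" by (rule w_even)
    also have "w (int (Suc (Suc M))) = \<eta> / (?N + 1)\<^sup>2" by (simp add: w_def add_ac)
    finally have "(\<Sum>m\<in>{- int (Suc (Suc M))..int (Suc (Suc M))}. w m)
       = 2 * \<eta> / (?N + 1)\<^sup>2 + (\<Sum>m\<in>{- int (Suc M)..int (Suc M)}. w m)"
      by simp
    also have "\<dots> \<le> 2 * \<eta> / (?N + 1)\<^sup>2 + (1 + 4 * \<eta> - 2 * \<eta> / ?N)"
      using Suc.IH by simp
    also have "\<dots> \<le> 1 + 4 * \<eta> - 2 * \<eta> / (?N + 1)"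
    proof -
      have "1 / (?N + 1)\<^sup>2 \<le> 1 / ?N - 1 / (?N + 1)"
      proof -
        have N: "0 < ?N" by simp
        then have "1 / ?N - 1 / (?N + 1) = 1 / (?N * (?N + 1))" by (simp add: diff_divide_eq_iff divide_diff_eq_iff)
        moreover have "1 / (?N + 1)\<^sup>2 \<le> 1 / (?N * (?N + 1))"
          unfolding power2_eq_square using N by (intro divide_left_mono mult_right_mono mult_pos_pos) auto
        ultimately show ?thesis by simp
      qed
      then have "2 * \<eta> * (1 / (?N + 1)\<^sup>2) \<le> 2 * \<eta> * (1 / ?N - 1 / (?N + 1))"
        using \<eta> by (intro mult_left_mono) auto
      then show ?thesis by (simp add: right_diff_distrib)
    qed
    finally show ?case by (simp add: add.commute)
  qed
  have wsum: "(\<Sum>m\<in>{- int M..int M}. w m) \<le> \<rho>" for M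
  proof (cases M)
    case 0
    then show ?thesis using \<rho> by (simp add: w_def)
  next
    case (Suc N)
    have "0 \<le> 2 * \<eta> / real (Suc N)" using \<eta> by simp
    then have "(\<Sum>m\<in>{- int (Suc N)..int (Suc N)}. w m) \<le> \<rho>"
      using wsum1[of N] unfolding \<eta>(2) by linarith
    then show ?thesis by (simp only: Suc)
  qed
  have fw: "fejer b t \<le> b * w m" if t: "\<bar>t - real_of_int m\<bar> \<le> 2 * \<tau>" for t m
  proof (cases "m = 0")
    case True
    then show ?thesis using fejer_bounds[OF b] by (simp add: w_def)
  next
    case False
    then have m: "1 \<le> \<bar>real_of_int m\<bar>" by linarith
    have "2 * \<tau> * 1 \<le> 2 * \<tau> * \<bar>real_of_int m\<bar>" using m \<tau> by (intro mult_left_mono) auto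
    then have le: "(1 - 2 * \<tau>) * \<bar>real_of_int m\<bar> \<le> \<bar>t\<bar>" using t by (simp add: algebra_simps)
    moreover have pos: "0 < (1 - 2 * \<tau>) * \<bar>real_of_int m\<bar>" using m \<tau> by simp
    ultimately have t0: "t \<noteq> 0" by auto
    have "((1 - 2 * \<tau>) * \<bar>real_of_int m\<bar>)\<^sup>2 \<le> t\<^sup>2"
      using le pos by (metis abs_le_square_iff abs_of_pos)
    then have sq: "(1 - 2 * \<tau>)\<^sup>2 * (real_of_int m)\<^sup>2 \<le> t\<^sup>2" by (simp add: power_mult_distrib)
    have "fejer b t \<le> 4 / (b * t\<^sup>2)" by (rule fejer_bounds(3)[OF b t0])
    also have "\<dots> \<le> 4 / (b * ((1 - 2 * \<tau>)\<^sup>2 * (real_of_int m)\<^sup>2))"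
      using sq b \<tau> False t0 by (intro divide_left_mono mult_left_mono) (auto intro!: mult_pos_pos)
    also have "\<dots> = 4 / (b * (1 - 2 * \<tau>)\<^sup>2) / (real_of_int m)\<^sup>2" by simp
    also have "\<dots> = b * w m" unfolding b2 using False by (simp add: w_def)
    finally show ?thesis .
  qed
  show ?thesis
  proof (intro exI[of _ b] conjI allI impI)
    show "0 < b" by (rule b)
    fix n s and a :: "nat \<Rightarrow> real"
    assume ng: "near_grid v \<tau> n s"
    define g where "g i j = (\<Prod>k\<in>UNIV. fejer b ((s (Suc i) - s (Suc j)) $ k))" for i j
    define G where "G i j = (if i = j then 0 else g i j)" for i j
    define D where "D = b ^ CARD('d)"
    have D: "0 < D" using b by (simp add: D_def)
    define W where "W i j = (\<Prod>k\<in>UNIV. w (int (v i $ k) - int (v j $ k)))" for i j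
    have gW: "g i j \<le> D * W (Suc i) (Suc j)" and g0: "0 \<le> g i j" if "i < n" "j < n" for i j
    proof -
      have "g i j \<le> (\<Prod>k\<in>UNIV. b * w (int (v (Suc i) $ k) - int (v (Suc j) $ k)))"
        unfolding g_def
      proof (intro prod_mono conjI fejer_bounds(1)[OF b] fw)
        fix k
        show "\<bar>(s (Suc i) - s (Suc j)) $ k - real_of_int (int (v (Suc i) $ k) - int (v (Suc j) $ k))\<bar> \<le> 2 * \<tau>"
          using near_grid_diff[OF ng, of "Suc i" "Suc j" k] that by simp
      qed
      also have "\<dots> = D * W (Suc i) (Suc j)" by (simp add: prod.distrib D_def W_def)
      finally show "g i j \<le> D * W (Suc i) (Suc j)" .
      show "0 \<le> g i j" unfolding g_def by (intro prod_nonneg fejer_bounds(1)[OF b] ballI)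
    qed
    have diag: "g i i = D" "W i i = 1" for i by (simp_all add: g_def D_def W_def w_def fejer_def)
    have "\<bar>\<Sum>i<n. \<Sum>j<n. a i * G i j * a j\<bar> \<le> D / 2 * (\<Sum>i<n. (a i)\<^sup>2)"
    proof (rule schur_test)
      fix i j
      have "fejer b ((s (Suc i) - s (Suc j)) $ k) = fejer b ((s (Suc j) - s (Suc i)) $ k)" for k
      proof -
        have "fejer b (- t) = fejer b t" for t by (simp add: fejer_def)
        from this[of "(s (Suc i) - s (Suc j)) $ k"] show ?thesis by simp
      qed
      then show "G i j = G j i" by (simp add: G_def g_def)
    next
      fix i assume i: "i < n"
      have "(\<Sum>j<n. \<bar>G i j\<bar>) \<le> (\<Sum>j<n. D * W (Suc i) (Suc j) - (if j = i then D else 0))"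
        using gW g0 i diag by (intro sum_mono) (auto simp: G_def)
      also have "\<dots> = D * (\<Sum>j<n. W (Suc i) (Suc j)) - D"
        using i by (simp add: sum_subtractf sum_distrib_left)
      also have "(\<Sum>j<n. W (Suc i) (Suc j)) = (\<Sum>j\<in>{1..n}. W (Suc i) j)" by (rule sum_Suc_index)
      also have "\<dots> \<le> \<rho> ^ CARD('d)" unfolding W_def
        by (intro sum_over_grid_le inj_on_subset[OF inj] w0 wsum) auto
      finally show "(\<Sum>j<n. \<bar>G i j\<bar>) \<le> D / 2" using D \<rho>(2) by simp
    qed
    moreover have "(\<Sum>i<n. \<Sum>j<n. a i * g i j * a j)
        = D * (\<Sum>i<n. (a i)\<^sup>2) + (\<Sum>i<n. \<Sum>j<n. a i * G i j * a j)"
    proof -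
      have "(\<Sum>i<n. \<Sum>j<n. a i * g i j * a j)
          = (\<Sum>i<n. \<Sum>j<n. (if j = i then D * (a i)\<^sup>2 else 0) + a i * G i j * a j)"
        by (intro sum.cong refl) (auto simp: G_def diag power2_eq_square)
      then show ?thesis by (simp add: sum.distrib sum_distrib_left)
    qed
    ultimately have "D / 2 * (\<Sum>i<n. (a i)\<^sup>2) \<le> (\<Sum>i<n. \<Sum>j<n. a i * g i j * a j)"
      by (simp add: abs_le_iff field_simps)
    then show "b ^ CARD('d) / 2 * (\<Sum>i<n. (a i)\<^sup>2) \<le>
      (\<Sum>i<n. \<Sum>j<n. a i * (\<Prod>k\<in>UNIV. fejer b ((s (Suc i) - s (Suc j)) $ k)) * a j)"
      by (simp add: D_def g_def)
  qed
qed

text \<open>On a compact frequency window the spectral densities have a common positive lower bound.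
  Minorizing them by a multiple of a product of tents reduces the claim to the Fejer kernel.\<close>

theorem covariance_form_lower_bound:
  fixes v :: "nat \<Rightarrow> nat^'d" and c chat :: "real^'p \<Rightarrow> real^'d \<Rightarrow> real"
  assumes inj: "inj_on v {1..}" and \<tau>: "0 \<le> \<tau>" "\<tau> < 1 / 2" and \<Theta>: "compact \<Theta>"
    and cont: "continuous_on (\<Theta> \<times> UNIV) (\<lambda>(\<theta>, f). chat \<theta> f)"
    and pos: "\<And>\<theta> f. \<theta> \<in> \<Theta> \<Longrightarrow> 0 < chat \<theta> f"
    and fp: "\<And>\<theta>. \<theta> \<in> \<Theta> \<Longrightarrow> fourier_pair (chat \<theta>) (c \<theta>)"
  shows "\<exists>\<delta>>0. \<forall>\<theta>\<in>\<Theta>. \<forall>n s a. near_grid v \<tau> n s \<longrightarrow>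
    \<delta> * (\<Sum>i<n. (a i)\<^sup>2) \<le> (\<Sum>i<n. \<Sum>j<n. a i * c \<theta> (s (Suc i) - s (Suc j)) * a j)"
proof (cases "\<Theta> = {}")
  case True
  then show ?thesis by (intro exI[of _ 1]) auto
next
  case False
  obtain b where b: "0 < b" and low: "\<And>n (s :: nat \<Rightarrow> real^'d) a. near_grid v \<tau> n s \<Longrightarrow>
    b ^ CARD('d) / 2 * (\<Sum>i<n. (a i)\<^sup>2) \<le>
    (\<Sum>i<n. \<Sum>j<n. a i * (\<Prod>k\<in>UNIV. fejer b ((s (Suc i) - s (Suc j)) $ k)) * a j)"
    using fejer_form_lower_bound[OF inj \<tau>] by blast
  define K where "K = (cbox (\<chi> k. - b) (\<chi> k. b) :: (real^'d) set)"
  have K: "f \<in> K \<longleftrightarrow> (\<forall>k. \<bar>f $ k\<bar> \<le> b)" for f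
    by (simp add: K_def mem_box_cart abs_le_iff) (metis minus_le_iff)
  have "0 \<in> K" using b by (simp add: K)
  have "compact (\<Theta> \<times> K)" using \<Theta> by (intro compact_Times) (auto simp: K_def)
  moreover have "\<Theta> \<times> K \<noteq> {}" using False \<open>0 \<in> K\<close> by auto
  moreover have "continuous_on (\<Theta> \<times> K) (\<lambda>(\<theta>, f). chat \<theta> f)"
    by (rule continuous_on_subset[OF cont]) auto
  ultimately obtain p where p: "p \<in> \<Theta> \<times> K"
    "\<forall>q\<in>\<Theta> \<times> K. (case p of (\<theta>, f) \<Rightarrow> chat \<theta> f) \<le> (case q of (\<theta>, f) \<Rightarrow> chat \<theta> f)"
    using continuous_attains_inf by blast
  define \<delta> where "\<delta> = chat (fst p) (snd p)"
  have \<delta>: "0 < \<delta>" "\<And>\<theta> f. \<theta> \<in> \<Theta> \<Longrightarrow> f \<in> K \<Longrightarrow> \<delta> \<le> chat \<theta> f"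
    using p pos by (auto simp: \<delta>_def case_prod_beta)
  have minor: "\<delta> * (\<Prod>k\<in>UNIV. tent b (f $ k)) \<le> chat \<theta> f" if "\<theta> \<in> \<Theta>" for \<theta> f
  proof (cases "f \<in> K")
    case True
    have "(\<Prod>k\<in>UNIV. tent b (f $ k)) \<le> 1"
      using b by (intro prod_le_1) (auto simp: tent_def)
    then have "\<delta> * (\<Prod>k\<in>UNIV. tent b (f $ k)) \<le> \<delta>" using \<delta>(1) by (simp add: mult_left_le)
    then show ?thesis using \<delta>(2)[OF that True] by linarith
  next
    case False
    then obtain k where "b < \<bar>f $ k\<bar>" by (auto simp: K not_le)
    then have "tent b (f $ k) = 0" using b by (simp add: tent_def max_def field_simps)
    then have zero: "(\<Prod>k\<in>UNIV. tent b (f $ k)) = 0" by (intro prod_zero) auto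
    show ?thesis unfolding zero using pos[OF that, of f] by simp
  qed
  show ?thesis
  proof (intro exI[of _ "\<delta> * (b ^ CARD('d) / 2)"] conjI ballI allI impI)
    show "0 < \<delta> * (b ^ CARD('d) / 2)" using \<delta> b by simp
    fix \<theta> n s and a :: "nat \<Rightarrow> real"
    assume \<theta>: "\<theta> \<in> \<Theta>" and ng: "near_grid v \<tau> n s"
    have "\<delta> * (b ^ CARD('d) / 2) * (\<Sum>i<n. (a i)\<^sup>2) \<le>
      \<delta> * (\<Sum>i<n. \<Sum>j<n. a i * (\<Prod>k\<in>UNIV. fejer b ((s (Suc i) - s (Suc j)) $ k)) * a j)"
      using mult_left_mono[OF low[OF ng, of a], of \<delta>] \<delta>(1) by (simp add: mult.assoc)
    also have "\<dots> \<le> (\<Sum>i<n. \<Sum>j<n. a i * c \<theta> (s (Suc i) - s (Suc j)) * a j)"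
      by (rule fourier_pair_mono_quadratic_form[OF fp[OF \<theta>] tent_product_fourier_pair[OF b] minor[OF \<theta>],
            where s = "\<lambda>i. s (Suc i)"])
    finally show "\<delta> * (b ^ CARD('d) / 2) * (\<Sum>i<n. (a i)\<^sup>2) \<le>
      (\<Sum>i<n. \<Sum>j<n. a i * c \<theta> (s (Suc i) - s (Suc j)) * a j)" .
  qed
qed

section \<open>Uniform continuity in the parameter\<close>

text \<open>Continuous partial derivatives are bounded near the point, so the mean value theorem, applied along
  one coordinate axis after the other, gives a local Lipschitz bound.\<close>

lemma continuous_partials_imp_isCont:
  fixes F :: "real^'p \<Rightarrow> real"
  assumes U: "open U" "\<theta> \<in> U"
    and deriv: "\<And>i \<theta>. \<theta> \<in> U \<Longrightarrow> ((\<lambda>t. F (\<theta> + t *\<^sub>R axis i 1)) has_real_derivative G i \<theta>) (at 0)"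
    and cont: "\<And>i. continuous_on U (G i)"
  shows "isCont F \<theta>"
proof -
  obtain r where r: "0 < r" "cball \<theta> r \<subseteq> U" using U open_contains_cball by blast
  have "\<exists>B. \<forall>y\<in>cball \<theta> r. \<bar>G i y\<bar> \<le> B" for i
  proof -
    have "bounded (G i ` cball \<theta> r)"
      by (intro compact_imp_bounded compact_continuous_image continuous_on_subset[OF cont r(2)]) auto
    then show ?thesis by (auto simp: bounded_iff)
  qed
  then obtain B' where B': "\<And>i y. y \<in> cball \<theta> r \<Longrightarrow> \<bar>G i y\<bar> \<le> B' i" by metis
  define B where "B = (\<Sum>i\<in>UNIV. \<bar>B' i\<bar>)"
  have B: "\<bar>G i y\<bar> \<le> B" if "y \<in> cball \<theta> r" for i y
  proof -
    have "\<bar>G i y\<bar> \<le> \<bar>B' i\<bar>" using B'[OF that, of i] by linarith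
    also have "\<dots> \<le> B" unfolding B_def by (intro member_le_sum) auto
    finally show ?thesis .
  qed
  \<comment> \<open>Change the coordinates one at a time, staying in the ball.\<close>
  have bound: "\<bar>F y - F \<theta>\<bar> \<le> B * (\<Sum>k\<in>UNIV. \<bar>y $ k - \<theta> $ k\<bar>)" if y: "y \<in> cball \<theta> r" for y
  proof -
    define Y where "Y J = (\<chi> k. if k \<in> J then y $ k else \<theta> $ k)" for J
    have "\<bar>F (Y J) - F \<theta>\<bar> \<le> B * (\<Sum>k\<in>J. \<bar>y $ k - \<theta> $ k\<bar>)" if "finite J" for J
      using that
    proof (induction J rule: finite_induct)
      case empty
      have "Y {} = \<theta>" by (simp add: Y_def Finite_Cartesian_Product.vec_eq_iff)
      then show ?case by simp
    next
      case (insert i J)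
      define h where "h = y $ i - \<theta> $ i"
      define S where "S = {- \<bar>h\<bar>..\<bar>h\<bar>}"
      let ?p = "\<lambda>t. Y J + t *\<^sub>R axis i 1"
      have inball: "?p t \<in> cball \<theta> r" if "t \<in> S" for t
      proof -
        have "norm (?p t - \<theta>) \<le> norm (y - \<theta>)"
          using that insert.hyps
          by (intro norm_le_componentwise_cart) (auto simp: Y_def S_def h_def axis_def)
        then show ?thesis using y by (simp add: dist_norm norm_minus_commute)
      qed
      have der: "((\<lambda>t. F (?p t)) has_real_derivative G i (?p t)) (at t)" if "t \<in> S" for t
      proof -
        have "((\<lambda>u. F (?p t + u *\<^sub>R axis i 1)) has_real_derivative G i (?p t)) (at 0)"
          by (rule deriv) (use inball[OF that] r in auto)
        moreover have "(\<lambda>u. F (?p t + u *\<^sub>R axis i 1)) = (\<lambda>u. F (?p (u + t)))"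
          by (simp add: algebra_simps)
        ultimately have "((\<lambda>u. F (?p (u + t))) has_real_derivative G i (?p t)) (at 0)" by simp
        then show ?thesis using DERIV_shift[of "\<lambda>t. F (?p t)" "G i (?p t)" 0 t] by simp
      qed
      have "norm (F (?p h) - F (?p 0)) \<le> B * norm (h - 0)"
      proof (rule field_differentiable_bound)
        show "convex S" by (simp add: S_def)
        show "((\<lambda>t. F (?p t)) has_real_derivative G i (?p t)) (at t within S)" if "t \<in> S" for t
          by (rule has_field_derivative_at_within[OF der[OF that]])
        show "norm (G i (?p t)) \<le> B" if "t \<in> S" for t using B[OF inball[OF that]] by simp
      qed (auto simp: S_def)
      moreover have "?p h = Y (insert i J)"
        using insert.hyps by (auto simp: Y_def h_def axis_def Finite_Cartesian_Product.vec_eq_iff)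
      ultimately have "\<bar>F (Y (insert i J)) - F (Y J)\<bar> \<le> B * \<bar>h\<bar>" by simp
      then show ?case using insert by (simp add: h_def distrib_left)
    qed
    from this[of UNIV] show ?thesis by (simp add: Y_def)
  qed
  have "((\<lambda>y. F y - F \<theta>) \<longlongrightarrow> 0) (at \<theta>)"
  proof (rule Lim_null_comparison)
    show "\<forall>\<^sub>F y in at \<theta>. norm (F y - F \<theta>) \<le> B * (\<Sum>k\<in>UNIV. \<bar>y $ k - \<theta> $ k\<bar>)"
      unfolding eventually_at using r(1) bound by (intro exI[of _ r]) (auto simp: dist_commute)
    have "((\<lambda>y. B * (\<Sum>k\<in>UNIV. \<bar>y $ k - \<theta> $ k\<bar>)) \<longlongrightarrow> B * (\<Sum>k\<in>UNIV. \<bar>\<theta> $ k - \<theta> $ k\<bar>)) (at \<theta>)"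
      by (intro tendsto_intros)
    then show "((\<lambda>y. B * (\<Sum>k\<in>UNIV. \<bar>y $ k - \<theta> $ k\<bar>)) \<longlongrightarrow> 0) (at \<theta>)" by simp
  qed
  then show ?thesis by (simp add: isCont_def LIM_zero_iff)
qed

text \<open>The total masses \<open>c \<theta> 0\<close> of the spectral densities are continuous in \<open>\<theta>\<close>, so pointwise
  convergence of the densities is convergence in mean (Scheffe), which dominates the uniform
  distance of the covariance functions.\<close>

theorem covariance_uniformly_continuous:
  fixes c chat :: "real^'p \<Rightarrow> real^'d \<Rightarrow> real"
  assumes cont: "continuous_on (\<Theta> \<times> UNIV) (\<lambda>(\<theta>, f). chat \<theta> f)"
    and pos: "\<And>\<theta> f. \<theta> \<in> \<Theta> \<Longrightarrow> 0 < chat \<theta> f"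
    and fp: "\<And>\<theta>. \<theta> \<in> \<Theta> \<Longrightarrow> fourier_pair (chat \<theta>) (c \<theta>)"
    and partials: "continuous_partials_on \<Theta> (\<lambda>\<theta>. c \<theta> 0) D"
    and \<theta>: "\<theta> \<in> \<Theta>" and \<eta>: "0 < \<eta>"
  shows "\<exists>r>0. \<forall>\<theta>'\<in>\<Theta>. dist \<theta>' \<theta> < r \<longrightarrow> (\<forall>s. \<bar>c \<theta>' s - c \<theta> s\<bar> \<le> \<eta>)"
proof (rule ccontr)
  assume "\<not> ?thesis"
  then have "\<forall>n. \<exists>\<theta>'\<in>\<Theta>. dist \<theta>' \<theta> < inverse (real (Suc n)) \<and> (\<exists>s. \<eta> < \<bar>c \<theta>' s - c \<theta> s\<bar>)"
    by (meson inverse_positive_iff_positive not_le of_nat_0_less_iff zero_less_Suc)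
  then obtain t where t: "\<And>n. t n \<in> \<Theta>" "\<And>n. dist (t n) \<theta> < inverse (real (Suc n))"
    "\<And>n. \<exists>s. \<eta> < \<bar>c (t n) s - c \<theta> s\<bar>" by metis
  have lim: "t \<longlonglongrightarrow> \<theta>"
    by (rule tendsto_dist_iff[THEN iffD2],
        rule tendsto_sandwich[OF _ _ tendsto_const LIMSEQ_inverse_real_of_nat])
       (use t(2) in \<open>auto intro!: always_eventually less_imp_le\<close>)
  have lim0: "(\<lambda>n. c (t n) 0) \<longlonglongrightarrow> c \<theta> 0"
  proof -
    obtain U F G where U: "open U" "\<Theta> \<subseteq> U" "\<forall>\<theta>\<in>\<Theta>. F \<theta> = c \<theta> 0"
      "\<forall>i. \<forall>\<theta>\<in>U. ((\<lambda>t. F (\<theta> + t *\<^sub>R axis i 1)) has_real_derivative G i \<theta>) (at 0)"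
      "\<forall>i. continuous_on U (G i)"
      using partials unfolding continuous_partials_on_def by blast
    have "isCont F \<theta>"
      using U \<theta> by (intro continuous_partials_imp_isCont[of U \<theta> F G]) auto
    from isCont_tendsto_compose[OF this lim] show ?thesis using U(3) t(1) \<theta> by simp
  qed
  have pt: "(\<lambda>n. chat (t n) f) \<longlonglongrightarrow> chat \<theta> f" for f
  proof -
    have "(\<lambda>n. (\<lambda>(\<theta>, f). chat \<theta> f) (t n, f)) \<longlonglongrightarrow> (\<lambda>(\<theta>, f). chat \<theta> f) (\<theta>, f)"
      by (rule continuous_on_tendsto_compose[OF cont])
         (use lim t(1) \<theta> in \<open>auto intro!: tendsto_intros\<close>)
    then show ?thesis by simp
  qed
  note int = fourier_pair_integrable[OF fp]
  have mass: "(\<integral>\<^sup>+ f. ennreal (norm (chat \<theta>' f)) \<partial>lborel) = ennreal (c \<theta>' 0)" if "\<theta>' \<in> \<Theta>" for \<theta>'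
    using int[OF that] pos[OF that] by (subst nn_integral_eq_integral) (auto simp: less_imp_le)
  have "(\<lambda>n. \<integral>\<^sup>+ f. ennreal (norm (chat (t n) f - chat \<theta> f)) \<partial>lborel) \<longlonglongrightarrow> 0"
  proof (rule Scheffe_lemma1)
    have "(\<lambda>n. ennreal (c (t n) 0)) \<longlonglongrightarrow> ennreal (c \<theta> 0)" using lim0 by (rule tendsto_ennrealI)
    then have "limsup (\<lambda>n. ennreal (c (t n) 0)) = ennreal (c \<theta> 0)" by (intro lim_imp_Limsup) auto
    then show "limsup (\<lambda>n. \<integral>\<^sup>+ f. ennreal (norm (chat (t n) f)) \<partial>lborel) \<le> (\<integral>\<^sup>+ f. ennreal (norm (chat \<theta> f)) \<partial>lborel)"
      using mass t(1) \<theta> by simp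
  qed (use int t(1) \<theta> pt in auto)
  then have "\<forall>\<^sub>F n in sequentially. (\<integral>\<^sup>+ f. ennreal (norm (chat (t n) f - chat \<theta> f)) \<partial>lborel) < ennreal \<eta>"
    using \<eta> by (intro order_tendstoD(2)) auto
  then obtain n where n: "(\<integral>\<^sup>+ f. ennreal (norm (chat (t n) f - chat \<theta> f)) \<partial>lborel) < ennreal \<eta>"
    by (auto simp: eventually_sequentially)
  obtain s where s: "\<eta> < \<bar>c (t n) s - c \<theta> s\<bar>" using t(3) by blast
  have "(\<integral>\<^sup>+ f. ennreal (norm (chat (t n) f - chat \<theta> f)) \<partial>lborel) = ennreal (\<integral>f. \<bar>chat (t n) f - chat \<theta> f\<bar> \<partial>lborel)"
    using int t(1) \<theta> by (subst nn_integral_eq_integral) auto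
  with n have "(\<integral>f. \<bar>chat (t n) f - chat \<theta> f\<bar> \<partial>lborel) < \<eta>"
    using \<eta> by (simp add: ennreal_less_iff)
  then show False
    using fourier_pair_diff_le[OF fp[OF t(1)] fp[OF \<theta>], of n s] s by linarith
qed

section \<open>Squares of uncorrelated Gaussian variables\<close>

lemma (in prob_space) centered_gaussian_moments:
  assumes g: "gaussian_rv M Y" and mean: "(\<integral>\<omega>. Y \<omega> \<partial>M) = 0"
  shows "Y \<in> borel_measurable M" "integrable M (\<lambda>\<omega>. Y \<omega> ^ 2)" "integrable M (\<lambda>\<omega>. Y \<omega> ^ 4)"
    "(\<integral>\<omega>. Y \<omega> ^ 4 \<partial>M) = 3 * (\<integral>\<omega>. Y \<omega> ^ 2 \<partial>M)\<^sup>2"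
proof -
  show meas: "Y \<in> borel_measurable M" using g by (simp add: gaussian_rv_def)
  from g obtain \<mu> \<sigma> where cases:
    "(\<sigma> = 0 \<and> (AE \<omega> in M. Y \<omega> = \<mu>)) \<or>
     (0 < \<sigma> \<and> distributed M lborel Y (\<lambda>x. ennreal (normal_density \<mu> \<sigma> x)))"
    by (auto simp: gaussian_rv_def)
  have "integrable M (\<lambda>\<omega>. Y \<omega> ^ 2) \<and> integrable M (\<lambda>\<omega>. Y \<omega> ^ 4) \<and>
    (\<integral>\<omega>. Y \<omega> ^ 4 \<partial>M) = 3 * (\<integral>\<omega>. Y \<omega> ^ 2 \<partial>M)\<^sup>2"
    using cases
  proof
    assume "\<sigma> = 0 \<and> (AE \<omega> in M. Y \<omega> = \<mu>)"
    then have ae: "AE \<omega> in M. Y \<omega> = \<mu>" by simp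
    then have "(\<integral>\<omega>. Y \<omega> \<partial>M) = (\<integral>\<omega>. \<mu> \<partial>M)"
      using meas by (intro integral_cong_AE) auto
    then have "\<mu> = 0" using mean prob_space by simp
    with ae have 2: "AE \<omega> in M. Y \<omega> ^ 2 = 0" and 4: "AE \<omega> in M. Y \<omega> ^ 4 = 0" by auto
    have "integrable M (\<lambda>\<omega>. Y \<omega> ^ 2)" "integrable M (\<lambda>\<omega>. Y \<omega> ^ 4)"
      using integrable_cong_AE[of "\<lambda>\<omega>. Y \<omega> ^ 2" M "\<lambda>_. 0"]
        integrable_cong_AE[of "\<lambda>\<omega>. Y \<omega> ^ 4" M "\<lambda>_. 0"] 2 4 meas by auto
    moreover have "(\<integral>\<omega>. Y \<omega> ^ 2 \<partial>M) = 0" "(\<integral>\<omega>. Y \<omega> ^ 4 \<partial>M) = 0"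
      using 2 4 by (auto intro!: integral_eq_zero_AE)
    ultimately show ?thesis by simp
  next
    assume "0 < \<sigma> \<and> distributed M lborel Y (\<lambda>x. ennreal (normal_density \<mu> \<sigma> x))"
    then have s: "0 < \<sigma>" and d: "distributed M lborel Y (\<lambda>x. ennreal (normal_density \<mu> \<sigma> x))" by auto
    interpret normal: prob_space "density lborel (\<lambda>x. ennreal (normal_density \<mu> \<sigma> x))"
      using prob_space_normal_density[OF s] .
    have int: "(\<integral>\<omega>. f (Y \<omega>) \<partial>M) = (\<integral>x. normal_density \<mu> \<sigma> x * f x \<partial>lborel)"
      if "f \<in> borel_measurable borel" for f :: "real \<Rightarrow> real"
      using distributed_integral[OF d, of f] that by simp
    have mu: "\<mu> = 0"
      using int[of "\<lambda>x. x"] mean integral_normal_moment_nz_1[OF s, of \<mu>] by simp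
    have e: "has_bochner_integral lborel (\<lambda>x. normal_density \<mu> \<sigma> x * x ^ 2) (\<sigma>\<^sup>2)"
      "has_bochner_integral lborel (\<lambda>x. normal_density \<mu> \<sigma> x * x ^ 4) (3 * \<sigma> ^ 4)"
      using normal_moment_even[OF s, of \<mu> 1] normal_moment_even[OF s, of \<mu> 2] mu s
      by (auto simp: fact_numeral power2_eq_square power4_eq_xxxx field_simps)
    have "integrable M (\<lambda>\<omega>. Y \<omega> ^ 2)" "integrable M (\<lambda>\<omega>. Y \<omega> ^ 4)"
      using distributed_integrable[OF d, of "\<lambda>x. x ^ 2"] distributed_integrable[OF d, of "\<lambda>x. x ^ 4"]
        e[THEN integrable.intros] by auto
    moreover have "(\<integral>\<omega>. Y \<omega> ^ 2 \<partial>M) = \<sigma>\<^sup>2" "(\<integral>\<omega>. Y \<omega> ^ 4 \<partial>M) = 3 * \<sigma> ^ 4"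
      using e[THEN has_bochner_integral_integral_eq] int[of "\<lambda>x. x ^ 2"] int[of "\<lambda>x. x ^ 4"] by auto
    ultimately show ?thesis by (simp add: power2_eq_square power4_eq_xxxx)
  qed
  then show "integrable M (\<lambda>\<omega>. Y \<omega> ^ 2)" "integrable M (\<lambda>\<omega>. Y \<omega> ^ 4)"
    "(\<integral>\<omega>. Y \<omega> ^ 4 \<partial>M) = 3 * (\<integral>\<omega>. Y \<omega> ^ 2 \<partial>M)\<^sup>2" by auto
qed

lemma (in prob_space) integrable_mult_of_squares:
  fixes Y W :: "'a \<Rightarrow> real"
  assumes "Y \<in> borel_measurable M" "W \<in> borel_measurable M"
    "integrable M (\<lambda>\<omega>. Y \<omega> ^ 2)" "integrable M (\<lambda>\<omega>. W \<omega> ^ 2)"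
  shows "integrable M (\<lambda>\<omega>. Y \<omega> * W \<omega>)"
proof (rule Bochner_Integration.integrable_bound[of M "\<lambda>\<omega>. Y \<omega> ^ 2 + W \<omega> ^ 2"])
  show "AE \<omega> in M. norm (Y \<omega> * W \<omega>) \<le> norm (Y \<omega> ^ 2 + W \<omega> ^ 2)"
  proof (rule AE_I2)
    fix \<omega>
    have "2 * \<bar>Y \<omega>\<bar> * \<bar>W \<omega>\<bar> \<le> Y \<omega> ^ 2 + W \<omega> ^ 2"
      using sum_squares_bound[of "\<bar>Y \<omega>\<bar>" "\<bar>W \<omega>\<bar>"] by simp
    moreover have "0 \<le> \<bar>Y \<omega>\<bar> * \<bar>W \<omega>\<bar>" by simp
    ultimately show "norm (Y \<omega> * W \<omega>) \<le> norm (Y \<omega> ^ 2 + W \<omega> ^ 2)"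
      unfolding real_norm_def abs_mult by linarith
  qed
qed (use assms in auto)

text \<open>The fourth moments of \<open>Y + W\<close> and \<open>Y - W\<close> determine the mixed moment, because
  \<open>(Y + W)\<^sup>4 + (Y - W)\<^sup>4 = 2 Y\<^sup>4 + 12 Y\<^sup>2 W\<^sup>2 + 2 W\<^sup>4\<close>.\<close>

lemma (in prob_space) uncorrelated_gaussian_squares:
  assumes g: "gaussian_rv M Y" "gaussian_rv M W" "gaussian_rv M (\<lambda>\<omega>. Y \<omega> + W \<omega>)"
    "gaussian_rv M (\<lambda>\<omega>. Y \<omega> - W \<omega>)"
    and mean: "(\<integral>\<omega>. Y \<omega> \<partial>M) = 0" "(\<integral>\<omega>. W \<omega> \<partial>M) = 0"
    and int: "integrable M Y" "integrable M W"
    and var: "(\<integral>\<omega>. Y \<omega> ^ 2 \<partial>M) = 1" "(\<integral>\<omega>. W \<omega> ^ 2 \<partial>M) = 1" "(\<integral>\<omega>. Y \<omega> * W \<omega> \<partial>M) = 0"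
  shows "(\<integral>\<omega>. Y \<omega> ^ 2 * W \<omega> ^ 2 \<partial>M) = 1"
proof -
  note mY = centered_gaussian_moments[OF g(1) mean(1)] and mW = centered_gaussian_moments[OF g(2) mean(2)]
  have m0: "(\<integral>\<omega>. Y \<omega> + W \<omega> \<partial>M) = 0" "(\<integral>\<omega>. Y \<omega> - W \<omega> \<partial>M) = 0" using mean int by auto
  note mP = centered_gaussian_moments[OF g(3) m0(1)] and mD = centered_gaussian_moments[OF g(4) m0(2)]
  have YW: "integrable M (\<lambda>\<omega>. Y \<omega> * W \<omega>)" by (rule integrable_mult_of_squares) (use mY mW in auto)
  have Y2W2: "integrable M (\<lambda>\<omega>. Y \<omega> ^ 2 * W \<omega> ^ 2)"
    by (rule integrable_mult_of_squares) (use mY mW in \<open>auto simp flip: power_mult\<close>)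
  have "(\<integral>\<omega>. (Y \<omega> + W \<omega>) ^ 2 \<partial>M) = (\<integral>\<omega>. Y \<omega> ^ 2 + W \<omega> ^ 2 + 2 * (Y \<omega> * W \<omega>) \<partial>M)"
    by (simp add: power2_eq_square algebra_simps)
  also have "\<dots> = 2" using var mY mW YW by simp
  finally have p2: "(\<integral>\<omega>. (Y \<omega> + W \<omega>) ^ 2 \<partial>M) = 2" .
  have "(\<integral>\<omega>. (Y \<omega> - W \<omega>) ^ 2 \<partial>M) = (\<integral>\<omega>. Y \<omega> ^ 2 + W \<omega> ^ 2 - 2 * (Y \<omega> * W \<omega>) \<partial>M)"
    by (simp add: power2_eq_square algebra_simps)
  also have "\<dots> = 2" using var mY mW YW by simp
  finally have d2: "(\<integral>\<omega>. (Y \<omega> - W \<omega>) ^ 2 \<partial>M) = 2" .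
  have "(\<integral>\<omega>. (Y \<omega> + W \<omega>) ^ 4 + (Y \<omega> - W \<omega>) ^ 4 \<partial>M)
      = (\<integral>\<omega>. 2 * Y \<omega> ^ 4 + 12 * (Y \<omega> ^ 2 * W \<omega> ^ 2) + 2 * W \<omega> ^ 4 \<partial>M)"
    by (intro Bochner_Integration.integral_cong refl)
      (simp add: power2_eq_square power4_eq_xxxx algebra_simps)
  moreover have "(\<integral>\<omega>. (Y \<omega> + W \<omega>) ^ 4 + (Y \<omega> - W \<omega>) ^ 4 \<partial>M) = 24"
    using mP mD p2 d2 by simp
  moreover have "(\<integral>\<omega>. 2 * Y \<omega> ^ 4 + 12 * (Y \<omega> ^ 2 * W \<omega> ^ 2) + 2 * W \<omega> ^ 4 \<partial>M)
      = 6 + 12 * (\<integral>\<omega>. Y \<omega> ^ 2 * W \<omega> ^ 2 \<partial>M) + 6"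
    using mY mW Y2W2 var by simp
  ultimately show ?thesis by simp
qed

text \<open>The centred squares \<open>Y\<^sub>k\<^sup>2 - 1\<close> have variance 2 and are uncorrelated, which is all that Chebyshev's
  inequality needs.\<close>

lemma (in prob_space) gaussian_squares_deviation:
  fixes Y :: "nat \<Rightarrow> 'a \<Rightarrow> real"
  assumes g: "\<And>k. k < n \<Longrightarrow> gaussian_rv M (Y k)"
    "\<And>k l. k < n \<Longrightarrow> l < n \<Longrightarrow> gaussian_rv M (\<lambda>\<omega>. Y k \<omega> + Y l \<omega>)"
    "\<And>k l. k < n \<Longrightarrow> l < n \<Longrightarrow> gaussian_rv M (\<lambda>\<omega>. Y k \<omega> - Y l \<omega>)"
    and mean: "\<And>k. k < n \<Longrightarrow> (\<integral>\<omega>. Y k \<omega> \<partial>M) = 0" "\<And>k. k < n \<Longrightarrow> integrable M (Y k)"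
    and cov: "\<And>k l. k < n \<Longrightarrow> l < n \<Longrightarrow> (\<integral>\<omega>. Y k \<omega> * Y l \<omega> \<partial>M) = (if k = l then 1 else 0)"
    and t: "0 < t"
  shows "prob {\<omega>\<in>space M. t \<le> \<bar>\<Sum>k<n. a k * (Y k \<omega> ^ 2 - 1)\<bar>} \<le> 2 * (\<Sum>k<n. (a k)\<^sup>2) / t\<^sup>2"
proof -
  define V where "V k \<omega> = Y k \<omega> ^ 2 - 1" for k \<omega>
  define T where "T \<omega> = (\<Sum>k<n. a k * V k \<omega>)" for \<omega>
  note m = centered_gaussian_moments[OF g(1) mean(1)]
  have var: "(\<integral>\<omega>. Y k \<omega> ^ 2 \<partial>M) = 1" if "k < n" for k
    using cov[OF that that] by (simp add: power2_eq_square)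
  have Y2Y2: "integrable M (\<lambda>\<omega>. Y k \<omega> ^ 2 * Y l \<omega> ^ 2)" if "k < n" "l < n" for k l
    by (rule integrable_mult_of_squares) (use m that in \<open>auto simp flip: power_mult\<close>)
  have VV: "integrable M (\<lambda>\<omega>. V k \<omega> * V l \<omega>)" and
    EVV: "(\<integral>\<omega>. V k \<omega> * V l \<omega> \<partial>M) = (if k = l then 2 else 0)" if kl: "k < n" "l < n" for k l
  proof -
    have eq: "V k \<omega> * V l \<omega> = Y k \<omega> ^ 2 * Y l \<omega> ^ 2 - Y k \<omega> ^ 2 - Y l \<omega> ^ 2 + 1" for \<omega>
      by (simp add: V_def algebra_simps)
    show "integrable M (\<lambda>\<omega>. V k \<omega> * V l \<omega>)" unfolding eq using m kl Y2Y2[OF kl] by auto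
    have "(\<integral>\<omega>. V k \<omega> * V l \<omega> \<partial>M) = (\<integral>\<omega>. Y k \<omega> ^ 2 * Y l \<omega> ^ 2 \<partial>M) - 1"
      unfolding eq using m kl Y2Y2[OF kl] var by (simp add: prob_space)
    moreover have "(\<integral>\<omega>. Y k \<omega> ^ 2 * Y l \<omega> ^ 2 \<partial>M) = (if k = l then 3 else 1)"
    proof (cases "k = l")
      case True
      then have "(\<integral>\<omega>. Y k \<omega> ^ 2 * Y l \<omega> ^ 2 \<partial>M) = (\<integral>\<omega>. Y k \<omega> ^ 4 \<partial>M)"
        by (simp flip: power_add)
      then show ?thesis using True m(4)[OF kl(1,1)] var[OF kl(1)] by simp
    next
      case False
      then show ?thesis using uncorrelated_gaussian_squares[of "Y k" "Y l"] g mean var cov kl by auto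
    qed
    ultimately show "(\<integral>\<omega>. V k \<omega> * V l \<omega> \<partial>M) = (if k = l then 2 else 0)" by simp
  qed
  have T2: "(T \<omega>)\<^sup>2 = (\<Sum>k<n. \<Sum>l<n. a k * a l * (V k \<omega> * V l \<omega>))" for \<omega>
    by (simp add: T_def power2_eq_square sum_product mult_ac)
  have intT: "integrable M (\<lambda>\<omega>. (T \<omega>)\<^sup>2)" unfolding T2
    by (intro Bochner_Integration.integrable_sum integrable_mult_right VV) auto
  have "(\<integral>\<omega>. (T \<omega>)\<^sup>2 \<partial>M) = (\<Sum>k<n. \<integral>\<omega>. (\<Sum>l<n. a k * a l * (V k \<omega> * V l \<omega>)) \<partial>M)"
    unfolding T2
    by (intro Bochner_Integration.integral_sum Bochner_Integration.integrable_sum integrable_mult_right VV) auto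
  also have "\<dots> = (\<Sum>k<n. \<Sum>l<n. \<integral>\<omega>. a k * a l * (V k \<omega> * V l \<omega>) \<partial>M)"
    by (intro sum.cong refl Bochner_Integration.integral_sum integrable_mult_right VV) auto
  also have "\<dots> = (\<Sum>k<n. \<Sum>l<n. a k * a l * (if k = l then 2 else 0))"
    using EVV by (intro sum.cong refl) auto
  also have "\<dots> = 2 * (\<Sum>k<n. (a k)\<^sup>2)"
    by (simp add: power2_eq_square sum_distrib_left if_distrib mult_ac cong: if_cong)
  finally have ET: "(\<integral>\<omega>. (T \<omega>)\<^sup>2 \<partial>M) = 2 * (\<Sum>k<n. (a k)\<^sup>2)" .
  have "{\<omega>\<in>space M. t \<le> \<bar>T \<omega>\<bar>} = {\<omega>\<in>space M. t\<^sup>2 \<le> (T \<omega>)\<^sup>2}"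
    using t by (auto simp: abs_le_square_iff[symmetric])
  moreover have "prob {\<omega>\<in>space M. t\<^sup>2 \<le> (T \<omega>)\<^sup>2} \<le> (\<integral>\<omega>. (T \<omega>)\<^sup>2 \<partial>M) / t\<^sup>2"
    using t by (intro integral_Markov_inequality_measure[OF intT, of "{}"]) auto
  ultimately show ?thesis using ET by (simp add: T_def V_def)
qed

text \<open>The definition of a Gaussian field speaks of combinations over sets of locations; this translates
  combinations over indices into that form.\<close>

lemma sum_over_image:
  assumes "inj_on s {..<n::nat}"
  shows "\<exists>b. \<forall>f. (\<Sum>x\<in>s ` {..<n}. b x * f x) = (\<Sum>i<n. a i * (f (s i) :: real))"
proof (intro exI allI)
  fix f
  show "(\<Sum>x\<in>s ` {..<n}. a (the_inv_into {..<n} s x) * f x) = (\<Sum>i<n. a i * f (s i))"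
    using assms by (simp add: sum.reindex the_inv_into_f_f)
qed

lemma (in prob_space) gaussian_field_combinations:
  fixes Z :: "real^'d \<Rightarrow> 'a \<Rightarrow> real" and s :: "nat \<Rightarrow> real^'d"
  assumes Z: "centered_gaussian_field M Z c" and inj: "inj_on s {..<n}"
  defines "Y \<equiv> \<lambda>a \<omega>. \<Sum>i<n. a i * Z (s i) \<omega>"
  shows "gaussian_rv M (Y a)" "integrable M (Y a)" "(\<integral>\<omega>. Y a \<omega> \<partial>M) = 0"
    "(\<integral>\<omega>. Y a \<omega> * Y b \<omega> \<partial>M) = (\<Sum>i<n. \<Sum>j<n. a i * c (s i - s j) * b j)"
proof -
  obtain a' where a': "\<forall>f. (\<Sum>x\<in>s ` {..<n}. a' x * f x) = (\<Sum>i<n. a i * f (s i))"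
    using sum_over_image[OF inj] by blast
  have "gaussian_rv M (\<lambda>\<omega>. \<Sum>x\<in>s ` {..<n}. a' x * Z x \<omega>)"
    using Z by (auto simp: centered_gaussian_field_def)
  moreover have "(\<lambda>\<omega>. \<Sum>x\<in>s ` {..<n}. a' x * Z x \<omega>) = Y a"
    unfolding Y_def by (intro ext, rule a'[rule_format, of "\<lambda>x. Z x _"])
  ultimately show "gaussian_rv M (Y a)" by simp
  have Zg: "gaussian_rv M (Z x)" for x
    using Z[unfolded centered_gaussian_field_def, THEN conjunct1, rule_format, of "{x}" "\<lambda>_. 1"]
    by simp
  have Z0: "(\<integral>\<omega>. Z x \<omega> \<partial>M) = 0" for x using Z by (auto simp: centered_gaussian_field_def)
  have Zc: "(\<integral>\<omega>. Z x \<omega> * Z y \<omega> \<partial>M) = c (x - y)" for x y using Z by (auto simp: centered_gaussian_field_def)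
  note m = centered_gaussian_moments[OF Zg Z0]
  have ZZ: "integrable M (\<lambda>\<omega>. Z x \<omega> * Z y \<omega>)" for x y
    by (rule integrable_mult_of_squares) (use m in auto)
  have Zi: "integrable M (Z x)" for x
    using integrable_mult_of_squares[of "Z x" "\<lambda>_. 1"] m by simp
  show "integrable M (Y a)" "(\<integral>\<omega>. Y a \<omega> \<partial>M) = 0"
    unfolding Y_def using Zi Z0 by (auto simp: Bochner_Integration.integral_sum)
  have "Y a \<omega> * Y b \<omega> = (\<Sum>i<n. \<Sum>j<n. a i * b j * (Z (s i) \<omega> * Z (s j) \<omega>))" for \<omega>
    by (simp add: Y_def sum_product mult_ac)
  then have "(\<integral>\<omega>. Y a \<omega> * Y b \<omega> \<partial>M) = (\<Sum>i<n. \<Sum>j<n. a i * b j * c (s i - s j))"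
    using ZZ Zc by (simp add: Bochner_Integration.integral_sum)
  then show "(\<integral>\<omega>. Y a \<omega> * Y b \<omega> \<partial>M) = (\<Sum>i<n. \<Sum>j<n. a i * c (s i - s j) * b j)"
    by (simp add: mult_ac)
qed

section \<open>The likelihood contrast at fixed locations\<close>

text \<open>The likelihood is split into a determinant and a quadratic part, since the argument also needs an
  upper bound of the quadratic part alone. The \<open>contrast\<close> is \<open>n\<close> times the negative log-likelihood.\<close>

definition mahalanobis :: "real mat \<Rightarrow> nat \<Rightarrow> (nat \<Rightarrow> real) \<Rightarrow> real" where
  "mahalanobis A n z = scalar_prod (Matrix.vec n z) (mult_mat_vec (moore_penrose A) (Matrix.vec n z))"

definition contrast :: "real mat \<Rightarrow> nat \<Rightarrow> (nat \<Rightarrow> real) \<Rightarrow> real" where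
  "contrast A n z = ln (det_plus A) + mahalanobis A n z"

lemma neg_log_lik_contrast:
  "neg_log_lik c Z S n \<omega> \<theta> =
    contrast (cov_matrix (c \<theta>) (\<lambda>i. S i \<omega>) n) n (\<lambda>i. Z (S (Suc i) \<omega>) \<omega>) / real n"
  by (simp add: neg_log_lik_def contrast_def mahalanobis_def Let_def add_divide_distrib)

definition form_bounds :: "nat \<Rightarrow> real mat \<Rightarrow> real \<Rightarrow> real \<Rightarrow> bool" where
  "form_bounds n A \<delta> K \<longleftrightarrow> (\<forall>x. \<delta> * (\<Sum>i<n. (x i)\<^sup>2) \<le> quadratic_form n A x \<and>
     quadratic_form n A x \<le> K * (\<Sum>i<n. (x i)\<^sup>2))"

text \<open>The elementary inequality behind the positivity of the Kullback-Leibler divergence, with a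
  quadratic remainder. It is \<open>ln (1 / \<mu>) \<le> 2 (sqrt (1 / \<mu>) - 1)\<close>.\<close>

lemma ln_remainder_ge:
  fixes \<mu> h :: real
  assumes \<mu>: "1 / h \<le> \<mu>" "\<mu> \<le> h" and h: "0 < h"
  shows "(\<mu> - 1)\<^sup>2 / (2 * (1 + h) * h\<^sup>2) \<le> ln \<mu> + 1 / \<mu> - 1"
proof -
  have \<mu>0: "0 < \<mu>" using \<mu>(1) h by (smt (verit) divide_pos_pos)
  define r where "r = sqrt (1 / \<mu>)"
  have r: "0 < r" "r\<^sup>2 = 1 / \<mu>" using \<mu>0 by (auto simp: r_def)
  have "ln (1 / \<mu>) = 2 * ln r" using r by (metis ln_realpow of_nat_numeral)
  moreover have "ln r \<le> r - 1" using r(1) by (rule ln_le_minus_one)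
  ultimately have "ln (1 / \<mu>) \<le> 2 * (r - 1)" by simp
  then have "(r - 1)\<^sup>2 \<le> ln \<mu> + 1 / \<mu> - 1"
    using \<mu>0 r(2) by (simp add: ln_div power2_diff algebra_simps)
  moreover have "(\<mu> - 1)\<^sup>2 / (2 * (1 + h) * h\<^sup>2) \<le> (r - 1)\<^sup>2"
  proof -
    have "1 / \<mu> \<le> h" using \<mu>(1) \<mu>0 h by (simp add: field_simps)
    then have rh: "(r + 1)\<^sup>2 \<le> 2 * (1 + h)"
      using r(2) sum_squares_bound[of r 1] by (simp add: power2_sum algebra_simps)
    have "(r - 1) * (r + 1) = 1 / \<mu> - 1" using r(2) by (simp add: power2_eq_square algebra_simps)
    then have "\<mu> - 1 = - \<mu> * ((r - 1) * (r + 1))" using \<mu>0 by (simp add: right_diff_distrib)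
    then have "(\<mu> - 1)\<^sup>2 = \<mu>\<^sup>2 * ((r + 1)\<^sup>2 * (r - 1)\<^sup>2)" by (simp add: power_mult_distrib mult_ac)
    also have "\<dots> \<le> h\<^sup>2 * (2 * (1 + h) * (r - 1)\<^sup>2)"
    proof (rule mult_mono)
      show "\<mu>\<^sup>2 \<le> h\<^sup>2" using \<mu>(2) \<mu>0 by (intro power_mono) auto
      show "(r + 1)\<^sup>2 * (r - 1)\<^sup>2 \<le> 2 * (1 + h) * (r - 1)\<^sup>2" by (intro mult_right_mono rh) auto
    qed auto
    finally show ?thesis using h by (simp add: divide_le_eq mult_ac)
  qed
  ultimately show ?thesis by linarith
qed

lemma pencil_eigenvalue_bounds:
  assumes "form_bounds n A \<delta> K" "form_bounds n B \<delta> K" "0 < \<delta>" "0 < K"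
    and "quadratic_form n A x = 1" "quadratic_form n B x = \<mu>"
  shows "1 / (K / \<delta>) \<le> \<mu>" "\<mu> \<le> K / \<delta>"
proof -
  define s where "s = (\<Sum>i<n. (x i)\<^sup>2)"
  have *: "\<delta> * s \<le> 1" "1 \<le> K * s" "\<delta> * s \<le> \<mu>" "\<mu> \<le> K * s"
    using assms unfolding form_bounds_def s_def by metis+
  have "\<delta> * 1 \<le> \<delta> * (K * s)" using * assms by (intro mult_left_mono) auto
  also have "\<dots> = K * (\<delta> * s)" by simp
  also have "\<dots> \<le> K * \<mu>" using * assms by (intro mult_left_mono) auto
  finally show "1 / (K / \<delta>) \<le> \<mu>" using assms by (simp add: field_simps)
  have "\<delta> * \<mu> \<le> \<delta> * (K * s)" using * assms by (intro mult_left_mono) auto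
  also have "\<dots> = K * (\<delta> * s)" by simp
  also have "\<dots> \<le> K * 1" using * assms by (intro mult_left_mono) auto
  finally show "\<mu> \<le> K / \<delta>" using assms by (simp add: field_simps)
qed

lemma mahalanobis_le:
  assumes A: "pos_def_mat n A" and B: "pos_def_mat n B"
    and fb: "form_bounds n A \<delta> K" "form_bounds n B \<delta> K" and c: "0 < \<delta>" "0 < K"
  shows "mahalanobis B n z \<le> K / \<delta> * mahalanobis A n z"
proof -
  obtain P \<mu> where P: "\<And>k. k < n \<Longrightarrow> 0 < \<mu> k"
    "\<And>k l. k < n \<Longrightarrow> l < n \<Longrightarrow> (\<Sum>i<n. \<Sum>j<n. P i k * A $$ (i, j) * P j l) = (if k = l then 1 else 0)"
    "\<And>k. k < n \<Longrightarrow> quadratic_form n B (\<lambda>i. P i k) = \<mu> k"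
    "mahalanobis A n z = (\<Sum>k<n. (\<Sum>i<n. P i k * z i)\<^sup>2)"
    "mahalanobis B n z = (\<Sum>k<n. (\<Sum>i<n. P i k * z i)\<^sup>2 / \<mu> k)"
    unfolding mahalanobis_def by (rule pencil_coordinates[OF A B]) blast
  show ?thesis unfolding P sum_distrib_left
  proof (intro sum_mono)
    fix k assume k: "k \<in> {..<n}"
    have "1 / (K / \<delta>) \<le> \<mu> k"
      by (rule pencil_eigenvalue_bounds[OF fb c _ P(3)])
         (use k P(2)[of k k] in \<open>auto simp: quadratic_form_def\<close>)
    then have "1 / \<mu> k \<le> K / \<delta>" using c P(1) k by (simp add: field_simps)
    then have "(\<Sum>i<n. P i k * z i)\<^sup>2 * (1 / \<mu> k) \<le> (\<Sum>i<n. P i k * z i)\<^sup>2 * (K / \<delta>)"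
      by (intro mult_left_mono) auto
    then show "(\<Sum>i<n. P i k * z i)\<^sup>2 / \<mu> k \<le> K / \<delta> * (\<Sum>i<n. P i k * z i)\<^sup>2"
      by (simp add: mult.commute)
  qed
qed

text \<open>A relative perturbation of the covariance matrix moves the generalized eigenvalues by at most
  \<open>\<eta>\<close>, uniformly in the dimension.\<close>

lemma contrast_perturbation:
  assumes A: "pos_def_mat n A" and B: "pos_def_mat n B" and \<eta>: "0 \<le> \<eta>" "\<eta> < 1"
    and near: "\<And>x. \<bar>quadratic_form n B x - quadratic_form n A x\<bar> \<le> \<eta> * quadratic_form n A x"
  shows "contrast A n z + real n * ln (1 - \<eta>) - \<eta> * mahalanobis A n z \<le> contrast B n z"
proof -
  obtain P \<mu> where P: "\<And>k. k < n \<Longrightarrow> 0 < \<mu> k"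
    "\<And>k l. k < n \<Longrightarrow> l < n \<Longrightarrow> (\<Sum>i<n. \<Sum>j<n. P i k * A $$ (i, j) * P j l) = (if k = l then 1 else 0)"
    "\<And>k. k < n \<Longrightarrow> quadratic_form n B (\<lambda>i. P i k) = \<mu> k"
    "ln (det_plus B) - ln (det_plus A) = (\<Sum>k<n. ln (\<mu> k))"
    "mahalanobis A n z = (\<Sum>k<n. (\<Sum>i<n. P i k * z i)\<^sup>2)"
    "mahalanobis B n z = (\<Sum>k<n. (\<Sum>i<n. P i k * z i)\<^sup>2 / \<mu> k)"
    unfolding mahalanobis_def by (rule pencil_coordinates[OF A B]) blast
  have \<mu>: "1 - \<eta> \<le> \<mu> k" "\<mu> k \<le> 1 + \<eta>" if k: "k < n" for k
  proof -
    have "quadratic_form n A (\<lambda>i. P i k) = 1" using P(2)[OF k k] by (simp add: quadratic_form_def)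
    then have "\<bar>\<mu> k - 1\<bar> \<le> \<eta>" using near[of "\<lambda>i. P i k"] P(3)[OF k] by simp
    then show "1 - \<eta> \<le> \<mu> k" "\<mu> k \<le> 1 + \<eta>" by auto
  qed
  have "real n * ln (1 - \<eta>) = (\<Sum>k<n. ln (1 - \<eta>))" by simp
  also have "\<dots> \<le> (\<Sum>k<n. ln (\<mu> k))"
    using \<mu> \<eta> P(1) by (intro sum_mono) (simp add: ln_le_cancel_iff)
  finally have 1: "real n * ln (1 - \<eta>) \<le> ln (det_plus B) - ln (det_plus A)" using P(4) by simp
  have "(1 - \<eta>) * mahalanobis A n z \<le> mahalanobis B n z"
    unfolding P(5,6) sum_distrib_left
  proof (intro sum_mono)
    fix k assume k: "k \<in> {..<n}"
    have "(1 - \<eta>) * \<mu> k \<le> (1 - \<eta>) * (1 + \<eta>)" using \<mu> k \<eta> by (intro mult_left_mono) auto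
    also have "\<dots> \<le> 1" by (simp add: algebra_simps)
    finally have "1 - \<eta> \<le> 1 / \<mu> k" using P(1) k by (simp add: le_divide_eq)
    then have "(1 - \<eta>) * (\<Sum>i<n. P i k * z i)\<^sup>2 \<le> 1 / \<mu> k * (\<Sum>i<n. P i k * z i)\<^sup>2"
      by (intro mult_right_mono) auto
    then show "(1 - \<eta>) * (\<Sum>i<n. P i k * z i)\<^sup>2 \<le> (\<Sum>i<n. P i k * z i)\<^sup>2 / \<mu> k" by simp
  qed
  with 1 show ?thesis unfolding contrast_def by (simp add: algebra_simps)
qed

text \<open>In the coordinates \<open>y\<close> of the pencil the contrast difference is
  \<open>\<Sum> (ln \<mu>\<^sub>k + 1 / \<mu>\<^sub>k - 1) + \<Sum> (1 / \<mu>\<^sub>k - 1) (y\<^sub>k\<^sup>2 - 1)\<close> with uncorrelated standard Gaussian \<open>y\<^sub>k\<close>: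
  the first sum is of order \<open>n\<close> by the Frobenius distance of the two matrices, the second one
  of order \<open>sqrt n\<close> in mean square.\<close>

theorem (in prob_space) contrast_separation:
  fixes Z :: "real^'d \<Rightarrow> 'a \<Rightarrow> real"
  assumes Z: "centered_gaussian_field M Z c" and const: "0 < \<delta>" "0 < K" "0 < \<beta>"
  shows "\<exists>\<gamma>>0. \<exists>C. \<forall>n\<ge>1. \<forall>s B.
    inj_on s {1..n} \<longrightarrow> pos_def_mat n (cov_matrix c s n) \<longrightarrow> pos_def_mat n B \<longrightarrow>
    form_bounds n (cov_matrix c s n) \<delta> K \<longrightarrow> form_bounds n B \<delta> K \<longrightarrow>
    \<beta> * real n \<le> (\<Sum>i<n. \<Sum>j<n. (B $$ (i, j) - cov_matrix c s n $$ (i, j))\<^sup>2) \<longrightarrow>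
    prob {\<omega>\<in>space M. contrast B n (\<lambda>i. Z (s (Suc i)) \<omega>) - contrast (cov_matrix c s n) n (\<lambda>i. Z (s (Suc i)) \<omega>)
         < \<gamma> * real n \<or> 2 * real n < mahalanobis (cov_matrix c s n) n (\<lambda>i. Z (s (Suc i)) \<omega>)} \<le> C / real n"
proof -
  define h where "h = K / \<delta>"
  have h: "0 < h" using const by (simp add: h_def)
  \<comment> \<open>All generalized eigenvalues lie in \<open>[1 / h, h]\<close>; \<open>\<kappa>\<close> is the constant of \<open>ln_remainder_ge\<close>, and the
    mean of the contrast difference is at least \<open>2 \<gamma> n\<close>.\<close>
  define \<kappa> where "\<kappa> = 1 / (2 * (1 + h) * h\<^sup>2)"
  have \<kappa>: "0 < \<kappa>" using h by (simp add: \<kappa>_def)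
  define \<gamma> where "\<gamma> = \<kappa> * \<beta> / (2 * K\<^sup>2)"
  have \<gamma>: "0 < \<gamma>" using \<kappa> const by (simp add: \<gamma>_def)
  show ?thesis
  proof (rule exI[of _ \<gamma>], rule conjI[OF \<gamma>], rule exI[of _ "2 * (h + 1)\<^sup>2 / \<gamma>\<^sup>2 + 2"], intro allI impI)
    fix n :: nat and s :: "nat \<Rightarrow> real^'d" and B
    define A where "A = cov_matrix c s n"
    assume n: "1 \<le> n" and inj: "inj_on s {1..n}" and pd: "pos_def_mat n (cov_matrix c s n)" "pos_def_mat n B"
      and fb: "form_bounds n (cov_matrix c s n) \<delta> K" "form_bounds n B \<delta> K"
      and frob: "\<beta> * real n \<le> (\<Sum>i<n. \<Sum>j<n. (B $$ (i, j) - cov_matrix c s n $$ (i, j))\<^sup>2)"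
    note pd = pd[folded A_def] and fb = fb[folded A_def] and frob = frob[folded A_def]
    define z where "z \<omega> = (\<lambda>i. Z (s (Suc i)) \<omega>)" for \<omega>
    obtain P \<mu> where P: "\<And>k. k < n \<Longrightarrow> 0 < \<mu> k"
      "\<And>k l. k < n \<Longrightarrow> l < n \<Longrightarrow> (\<Sum>i<n. \<Sum>j<n. P i k * A $$ (i, j) * P j l) = (if k = l then 1 else 0)"
      "\<And>k. k < n \<Longrightarrow> quadratic_form n B (\<lambda>i. P i k) = \<mu> k"
      "ln (det_plus B) - ln (det_plus A) = (\<Sum>k<n. ln (\<mu> k))"
      "\<And>z. mahalanobis A n z = (\<Sum>k<n. (\<Sum>i<n. P i k * z i)\<^sup>2)"
      "\<And>z. mahalanobis B n z = (\<Sum>k<n. (\<Sum>i<n. P i k * z i)\<^sup>2 / \<mu> k)"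
      "\<And>K. 0 \<le> K \<Longrightarrow> (\<And>x. quadratic_form n A x \<le> K * (\<Sum>i<n. (x i)\<^sup>2)) \<Longrightarrow>
         (\<Sum>i<n. \<Sum>j<n. (B $$ (i, j) - A $$ (i, j))\<^sup>2) \<le> K\<^sup>2 * (\<Sum>k<n. (\<mu> k - 1)\<^sup>2)"
      unfolding mahalanobis_def by (rule pencil_coordinates[OF pd]) blast
    have \<mu>: "1 / h \<le> \<mu> k" "\<mu> k \<le> h" if k: "k < n" for k
    proof -
      have "quadratic_form n A (\<lambda>i. P i k) = 1" using P(2)[OF k k] by (simp add: quadratic_form_def)
      from pencil_eigenvalue_bounds[OF fb const(1,2) this P(3)[OF k]]
      show "1 / h \<le> \<mu> k" "\<mu> k \<le> h" by (simp_all add: h_def)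
    qed
    have "\<beta> * real n \<le> K\<^sup>2 * (\<Sum>k<n. (\<mu> k - 1)\<^sup>2)"
    proof (rule order_trans[OF frob P(7)])
      show "quadratic_form n A x \<le> K * (\<Sum>i<n. (x i)\<^sup>2)" for x
        using fb(1) by (simp add: form_bounds_def)
    qed (use const in simp)
    then have "\<kappa> * (\<beta> * real n) \<le> \<kappa> * (K\<^sup>2 * (\<Sum>k<n. (\<mu> k - 1)\<^sup>2))"
      using \<kappa> by (intro mult_left_mono) auto
    then have "2 * \<gamma> * real n \<le> \<kappa> * (\<Sum>k<n. (\<mu> k - 1)\<^sup>2)"
      using const by (simp add: \<gamma>_def field_simps)
    also have "\<dots> = (\<Sum>k<n. (\<mu> k - 1)\<^sup>2 / (2 * (1 + h) * h\<^sup>2))"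
      by (simp add: \<kappa>_def sum_divide_distrib)
    also have "\<dots> \<le> (\<Sum>k<n. ln (\<mu> k) + 1 / \<mu> k - 1)"
      using \<mu> h by (intro sum_mono ln_remainder_ge) auto
    finally have mean: "2 * \<gamma> * real n \<le> (\<Sum>k<n. ln (\<mu> k) + 1 / \<mu> k - 1)" .
    have inj': "inj_on (\<lambda>i. s (Suc i)) {..<n}"
    proof -
      have "inj_on s (Suc ` {..<n})" by (rule inj_on_subset[OF inj]) auto
      from comp_inj_on[OF _ this] show ?thesis by (simp add: comp_def)
    qed
    define y where "y k \<omega> = (\<Sum>i<n. P i k * Z (s (Suc i)) \<omega>)" for k \<omega>
    note comb = gaussian_field_combinations[OF Z inj']
    have gy: "gaussian_rv M (y k)" "integrable M (y k)" "expectation (y k) = 0" for k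
      unfolding y_def[abs_def] by (rule comb)+
    have gs: "gaussian_rv M (\<lambda>\<omega>. y k \<omega> + y l \<omega>)" "gaussian_rv M (\<lambda>\<omega>. y k \<omega> - y l \<omega>)" for k l
    proof -
      have "(\<lambda>\<omega>. y k \<omega> + y l \<omega>) = (\<lambda>\<omega>. \<Sum>i<n. (P i k + P i l) * Z (s (Suc i)) \<omega>)"
        "(\<lambda>\<omega>. y k \<omega> - y l \<omega>) = (\<lambda>\<omega>. \<Sum>i<n. (P i k - P i l) * Z (s (Suc i)) \<omega>)"
        by (auto simp: y_def sum.distrib[symmetric] sum_subtractf[symmetric] algebra_simps)
      then show "gaussian_rv M (\<lambda>\<omega>. y k \<omega> + y l \<omega>)" "gaussian_rv M (\<lambda>\<omega>. y k \<omega> - y l \<omega>)"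
        using comb(1) by simp_all
    qed
    have cy: "expectation (\<lambda>\<omega>. y k \<omega> * y l \<omega>) = (if k = l then 1 else 0)" if "k < n" "l < n" for k l
    proof -
      have "expectation (\<lambda>\<omega>. y k \<omega> * y l \<omega>) = (\<Sum>i<n. \<Sum>j<n. P i k * c (s (Suc i) - s (Suc j)) * P j l)"
        unfolding y_def by (rule comb(4))
      also have "\<dots> = (\<Sum>i<n. \<Sum>j<n. P i k * A $$ (i, j) * P j l)"
        by (intro sum.cong refl) (auto simp: A_def cov_matrix_def)
      finally show ?thesis using P(2)[OF that] by simp
    qed
    have ym: "y k \<in> borel_measurable M" for k using gy(1) by (simp add: gaussian_rv_def)
    note dev = gaussian_squares_deviation[OF gy(1) gs(1) gs(2) gy(3) gy(2) cy]
    define D1 where "D1 = {\<omega>\<in>space M. \<gamma> * real n \<le> \<bar>\<Sum>k<n. (1 / \<mu> k - 1) * (y k \<omega> ^ 2 - 1)\<bar>}"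
    define D2 where "D2 = {\<omega>\<in>space M. real n \<le> \<bar>\<Sum>k<n. 1 * (y k \<omega> ^ 2 - 1)\<bar>}"
    have n0: "0 < real n" using n by simp
    have "prob D1 \<le> 2 * (\<Sum>k<n. (1 / \<mu> k - 1)\<^sup>2) / (\<gamma> * real n)\<^sup>2"
      unfolding D1_def by (rule dev) (use \<gamma> n0 in auto)
    also have "\<dots> \<le> 2 * (\<Sum>k<n. (h + 1)\<^sup>2) / (\<gamma> * real n)\<^sup>2"
    proof (intro divide_right_mono mult_left_mono sum_mono)
      fix k assume k: "k \<in> {..<n}"
      have "1 / \<mu> k \<le> h" "0 < 1 / \<mu> k" using \<mu>[of k] P(1)[of k] h k by (auto simp: field_simps)
      then have "\<bar>1 / \<mu> k - 1\<bar> \<le> \<bar>h + 1\<bar>" using h by linarith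
      then show "(1 / \<mu> k - 1)\<^sup>2 \<le> (h + 1)\<^sup>2" by (simp only: abs_le_square_iff)
    qed auto
    also have "\<dots> = 2 * (h + 1)\<^sup>2 / \<gamma>\<^sup>2 / real n"
      using n0 \<gamma> by (simp add: power2_eq_square)
    finally have p1: "prob D1 \<le> 2 * (h + 1)\<^sup>2 / \<gamma>\<^sup>2 / real n" .
    have "prob D2 \<le> 2 * (\<Sum>k<n. 1\<^sup>2) / (real n)\<^sup>2"
      unfolding D2_def by (rule dev) (use n0 in auto)
    also have "\<dots> = 2 / real n" using n0 by (simp add: power2_eq_square)
    finally have p2: "prob D2 \<le> 2 / real n" .
    have maha: "mahalanobis A n (z \<omega>) = (\<Sum>k<n. 1 * (y k \<omega> ^ 2 - 1)) + real n" for \<omega>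
      unfolding P(5) by (simp add: z_def y_def sum_subtractf)
    have diff: "contrast B n (z \<omega>) - contrast A n (z \<omega>) =
       (\<Sum>k<n. ln (\<mu> k) + 1 / \<mu> k - 1) + (\<Sum>k<n. (1 / \<mu> k - 1) * (y k \<omega> ^ 2 - 1))" for \<omega>
    proof -
      have "contrast B n (z \<omega>) - contrast A n (z \<omega>) =
        (\<Sum>k<n. ln (\<mu> k)) + ((\<Sum>k<n. (y k \<omega>)\<^sup>2 / \<mu> k) - (\<Sum>k<n. (y k \<omega>)\<^sup>2))"
        unfolding contrast_def P(5,6) P(4)[symmetric] by (simp add: z_def y_def)
      also have "\<dots> = (\<Sum>k<n. (ln (\<mu> k) + 1 / \<mu> k - 1) + (1 / \<mu> k - 1) * (y k \<omega> ^ 2 - 1))"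
        unfolding sum_subtractf[symmetric] sum.distrib[symmetric]
        by (intro sum.cong refl) (simp add: algebra_simps)
      finally show ?thesis by (simp only: sum.distrib)
    qed
    have "prob {\<omega>\<in>space M. contrast B n (z \<omega>) - contrast A n (z \<omega>) < \<gamma> * real n \<or> 2 * real n < mahalanobis A n (z \<omega>)}
      \<le> prob (D1 \<union> D2)"
    proof (rule finite_measure_mono)
      show "{\<omega>\<in>space M. contrast B n (z \<omega>) - contrast A n (z \<omega>) < \<gamma> * real n \<or> 2 * real n < mahalanobis A n (z \<omega>)} \<subseteq> D1 \<union> D2"
      proof safe
        fix \<omega> assume \<omega>: "\<omega> \<in> space M" "\<omega> \<notin> D2" "contrast B n (z \<omega>) - contrast A n (z \<omega>) < \<gamma> * real n"
        then have "\<gamma> * real n \<le> \<bar>\<Sum>k<n. (1 / \<mu> k - 1) * (y k \<omega> ^ 2 - 1)\<bar>"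
          using mean unfolding diff by linarith
        then show "\<omega> \<in> D1" using \<omega> by (simp add: D1_def)
      next
        fix \<omega> assume \<omega>: "\<omega> \<in> space M" "2 * real n < mahalanobis A n (z \<omega>)" "\<omega> \<notin> D2"
        then have "real n \<le> \<bar>\<Sum>k<n. 1 * (y k \<omega> ^ 2 - 1)\<bar>" unfolding maha by linarith
        then show "\<omega> \<in> D1" using \<omega> by (simp add: D2_def)
      qed
      show "D1 \<union> D2 \<in> events" unfolding D1_def D2_def using ym by measurable
    qed
    also have "\<dots> \<le> prob D1 + prob D2"
      by (rule measure_Un_le) (use ym in \<open>auto simp: D1_def D2_def\<close>)
    also have "\<dots> \<le> (2 * (h + 1)\<^sup>2 / \<gamma>\<^sup>2 + 2) / real n" using p1 p2 by (simp add: add_divide_distrib)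
    finally show "prob {\<omega>\<in>space M. contrast B n (\<lambda>i. Z (s (Suc i)) \<omega>) - contrast (cov_matrix c s n) n (\<lambda>i. Z (s (Suc i)) \<omega>)
         < \<gamma> * real n \<or> 2 * real n < mahalanobis (cov_matrix c s n) n (\<lambda>i. Z (s (Suc i)) \<omega>)}
       \<le> (2 * (h + 1)\<^sup>2 / \<gamma>\<^sup>2 + 2) / real n"
      unfolding z_def A_def .
  qed
qed

section \<open>Pairs of locations with a prescribed lag\<close>

text \<open>The first \<open>I\<^sup>d\<close> indices are mapped onto a box with \<open>I\<^sup>d\<close> points, hence injectively.\<close>

lemma grid_enumeration_bij:
  fixes v :: "nat \<Rightarrow> nat^'d"
  assumes v: "grid_enumeration v" and I: "1 \<le> I"
  shows "bij_betw v {1..I ^ CARD('d)} {u. \<forall>k. 1 \<le> u $ k \<and> u $ k \<le> I}"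
proof -
  let ?B = "{u :: nat^'d. \<forall>k. 1 \<le> u $ k \<and> u $ k \<le> I}"
  have img: "v ` {1..I ^ CARD('d)} = ?B" using v I by (auto simp: grid_enumeration_def)
  have "card ?B = card (PiE (UNIV :: 'd set) (\<lambda>_. {1..I}))"
    by (rule bij_betw_same_card[of "vec_nth"], rule bij_betwI[where g = "\<lambda>f. \<chi> k. f k"]) auto
  also have "\<dots> = I ^ CARD('d)" by (simp add: card_PiE)
  finally have "card (v ` {1..I ^ CARD('d)}) = card {1..I ^ CARD('d)}" using img by simp
  then have "inj_on v {1..I ^ CARD('d)}" by (intro eq_card_imp_inj_on) auto
  with img show ?thesis by (simp add: bij_betw_def)
qed

lemma grid_enumeration_inj:
  fixes v :: "nat \<Rightarrow> nat^'d"
  assumes v: "grid_enumeration v"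
  shows "inj_on v {1..}"
proof (rule inj_onI)
  fix i j :: nat assume ij: "i \<in> {1..}" "j \<in> {1..}" "v i = v j"
  define I where "I = max i j"
  have I: "1 \<le> I" using ij by (simp add: I_def)
  have "I \<le> I ^ CARD('d)" using I by (simp add: self_le_power)
  then have "i \<in> {1..I ^ CARD('d)}" "j \<in> {1..I ^ CARD('d)}" using ij by (auto simp: I_def)
  then show "i = j" using grid_enumeration_bij[OF v I] ij(3) by (auto simp: bij_betw_def dest: inj_onD)
qed

definition lag_indices :: "(nat \<Rightarrow> nat^'d) \<Rightarrow> int^'d \<Rightarrow> nat \<Rightarrow> nat set" where
  "lag_indices v z n = {i\<in>{1..n}. \<exists>j\<in>{1..n}. \<forall>k. int (v i $ k) - int (v j $ k) = z $ k}"

text \<open>The largest box inside the first \<open>n\<close> grid points has a side \<open>I\<close> with \<open>n < (I + 1)\<^sup>d\<close>; all points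
  of the box that are farther than the lag from its boundary have a partner in the box.\<close>

lemma card_lag_indices_ge:
  fixes v :: "nat \<Rightarrow> nat^'d" and z :: "int^'d"
  assumes v: "grid_enumeration v"
  shows "\<exists>N. \<forall>n\<ge>N. real n / 2 ^ CARD('d) \<le> real (card (lag_indices v z n))"
proof -
  let ?d = "CARD('d)"
  define R where "R = (\<Sum>k\<in>UNIV. nat \<bar>z $ k\<bar>)"
  have R: "\<bar>z $ k\<bar> \<le> int R" for k
  proof -
    have "nat \<bar>z $ k\<bar> \<le> R" unfolding R_def by (intro member_le_sum) auto
    then show ?thesis by linarith
  qed
  show ?thesis
  proof (intro exI[of _ "(4 * R + 1) ^ ?d"] allI impI)
    fix n assume n: "(4 * R + 1) ^ ?d \<le> n"
    define I where "I = (GREATEST I. I ^ ?d \<le> n)"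
    have bnd: "J ^ ?d \<le> n \<Longrightarrow> J \<le> n" for J :: nat
      using self_le_power[of J ?d] by (cases "J = 0") auto
    have I1: "I ^ ?d \<le> n" unfolding I_def
      by (rule GreatestI_nat[of _ "4 * R + 1" n]) (use n bnd in auto)
    have I2: "4 * R + 1 \<le> I" unfolding I_def
      by (rule Greatest_le_nat[of _ _ n]) (use n bnd in auto)
    have I3: "n < (I + 1) ^ ?d"
    proof (rule ccontr)
      assume "\<not> ?thesis"
      then have "(I + 1) ^ ?d \<le> n" by simp
      then have "I + 1 \<le> I" unfolding I_def
        by (intro Greatest_le_nat[of _ _ n]) (use bnd in auto)
      then show False by simp
    qed
    have bij: "bij_betw v {1..I ^ ?d} {u. \<forall>k. 1 \<le> u $ k \<and> u $ k \<le> I}"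
      using I2 by (intro grid_enumeration_bij[OF v]) simp
    define C where "C = {u :: nat^'d. \<forall>k. u $ k \<in> {R + 1..I - R}}"
    have cardC: "card C = (I - 2 * R) ^ ?d"
    proof -
      have "card C = card (PiE (UNIV :: 'd set) (\<lambda>_. {R + 1..I - R}))" unfolding C_def
        by (rule bij_betw_same_card[of "vec_nth"], rule bij_betwI[where g = "\<lambda>f. \<chi> k. f k"]) auto
      also have "\<dots> = (I - 2 * R) ^ ?d" by (simp add: card_PiE mult_2)
      finally show ?thesis .
    qed
    have "C \<subseteq> v ` lag_indices v z n"
    proof
      fix u assume u: "u \<in> C"
      define u' where "u' = (\<chi> k. nat (int (u $ k) - z $ k))"
      have box: "1 \<le> u $ k" "u $ k \<le> I" "1 \<le> u' $ k" "u' $ k \<le> I" "int (u' $ k) = int (u $ k) - z $ k" for k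
      proof -
        have uk: "R + 1 \<le> u $ k" "u $ k \<le> I - R" using u by (auto simp: C_def)
        show "1 \<le> u $ k" "u $ k \<le> I" using uk by auto
        have "int R + 1 \<le> int (u $ k)" "int (u $ k) \<le> int I - int R" using uk I2 by auto
        then show "1 \<le> u' $ k" "u' $ k \<le> I" "int (u' $ k) = int (u $ k) - z $ k"
          using R[of k] by (auto simp: u'_def)
      qed
      have im: "{u. \<forall>k. 1 \<le> u $ k \<and> u $ k \<le> I} = v ` {1..I ^ ?d}"
        using bij by (simp add: bij_betw_def)
      have "u \<in> v ` {1..I ^ ?d}" "u' \<in> v ` {1..I ^ ?d}" unfolding im[symmetric] using box by auto
      then obtain i j where ij: "i \<in> {1..I ^ ?d}" "u = v i" "j \<in> {1..I ^ ?d}" "u' = v j" by blast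
      then have "i \<in> lag_indices v z n" using I1 box(5)
        by (auto simp: lag_indices_def intro!: bexI[of _ j])
      then show "u \<in> v ` lag_indices v z n" using ij by auto
    qed
    then have "card C \<le> card (lag_indices v z n)"
      by (intro surj_card_le) (auto simp: lag_indices_def)
    moreover have "real n / 2 ^ ?d \<le> real (card C)"
    proof -
      have "real n \<le> real ((I + 1) ^ ?d)" using I3 by (intro of_nat_mono) simp
      also have "\<dots> = (real I + 1) ^ ?d" by (simp add: add.commute)
      also have "\<dots> \<le> (2 * real (I - 2 * R)) ^ ?d" using I2 by (intro power_mono) auto
      also have "\<dots> = 2 ^ ?d * real (card C)" by (simp add: cardC power_mult_distrib)
      finally show ?thesis by (simp add: field_simps)
    qed
    ultimately show "real n / 2 ^ ?d \<le> real (card (lag_indices v z n))" by linarith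
  qed
qed

text \<open>Second moment method for a sum of indicator-like variables in which each term is
  independent of all but boundedly many others.\<close>

lemma (in prob_space) weakly_dependent_lower_tail:
  fixes Y :: "nat \<Rightarrow> 'a \<Rightarrow> real"
  assumes J: "finite J" and meas: "\<And>i. i \<in> J \<Longrightarrow> Y i \<in> borel_measurable M"
    and bound: "\<And>i \<omega>. i \<in> J \<Longrightarrow> 0 \<le> Y i \<omega> \<and> Y i \<omega> \<le> 1"
    and mean: "\<And>i. i \<in> J \<Longrightarrow> expectation (Y i) = p" and p: "0 < p"
    and prod: "\<And>i j. i \<in> J \<Longrightarrow> j \<in> J \<Longrightarrow> \<not> E i j \<Longrightarrow> expectation (\<lambda>\<omega>. Y i \<omega> * Y j \<omega>) = p * p"
    and deg: "\<And>i. i \<in> J \<Longrightarrow> card {j\<in>J. E i j} \<le> m"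
    and ne: "J \<noteq> {}"
  shows "prob {\<omega>\<in>space M. (\<Sum>i\<in>J. Y i \<omega>) \<le> p * real (card J) / 2} \<le> 4 * real m / (p\<^sup>2 * real (card J))"
proof -
  define N where "N = real (card J)"
  have N: "0 < N" using J ne by (simp add: N_def card_gt_0_iff)
  have iY: "integrable M (Y i)" if "i \<in> J" for i
    by (rule integrable_const_bound[of _ 1]) (use that bound meas in auto)
  have YY: "integrable M (\<lambda>\<omega>. Y i \<omega> * Y j \<omega>)" if "i \<in> J" "j \<in> J" for i j
    by (rule integrable_const_bound[of _ 1]) (use that bound meas in \<open>auto intro!: mult_le_one\<close>)
  define V where "V i \<omega> = Y i \<omega> - p" for i \<omega>
  have VV: "V i \<omega> * V j \<omega> = Y i \<omega> * Y j \<omega> - p * Y i \<omega> - p * Y j \<omega> + p * p" for i j \<omega>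
    by (simp add: V_def algebra_simps)
  have iVV: "integrable M (\<lambda>\<omega>. V i \<omega> * V j \<omega>)" if "i \<in> J" "j \<in> J" for i j
    unfolding VV using iY YY that by auto
  have EVV: "expectation (\<lambda>\<omega>. V i \<omega> * V j \<omega>) = expectation (\<lambda>\<omega>. Y i \<omega> * Y j \<omega>) - p * p" if "i \<in> J" "j \<in> J" for i j
    unfolding VV using iY YY that mean by (simp add: prob_space)
  have cov: "expectation (\<lambda>\<omega>. V i \<omega> * V j \<omega>) \<le> (if E i j then 1 else 0)" if ij: "i \<in> J" "j \<in> J" for i j
  proof (cases "E i j")
    case True
    have "expectation (\<lambda>\<omega>. Y i \<omega> * Y j \<omega>) \<le> expectation (\<lambda>\<omega>. 1)"
      by (intro integral_mono YY ij) (use bound ij in \<open>auto intro!: mult_le_one\<close>)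
    then show ?thesis using EVV[OF ij] True p by (simp add: prob_space) (smt (verit) mult_pos_pos)
  next
    case False
    then show ?thesis using EVV[OF ij] prod[OF ij] by simp
  qed
  define T where "T \<omega> = (\<Sum>i\<in>J. V i \<omega>)" for \<omega>
  have T2: "(T \<omega>)\<^sup>2 = (\<Sum>i\<in>J. \<Sum>j\<in>J. V i \<omega> * V j \<omega>)" for \<omega>
    by (simp add: T_def power2_eq_square sum_product)
  have iT: "integrable M (\<lambda>\<omega>. (T \<omega>)\<^sup>2)" unfolding T2
    by (intro Bochner_Integration.integrable_sum iVV)
  have "expectation (\<lambda>\<omega>. (T \<omega>)\<^sup>2) = (\<Sum>i\<in>J. expectation (\<lambda>\<omega>. \<Sum>j\<in>J. V i \<omega> * V j \<omega>))"
    unfolding T2 by (intro Bochner_Integration.integral_sum Bochner_Integration.integrable_sum iVV)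
  also have "\<dots> = (\<Sum>i\<in>J. \<Sum>j\<in>J. expectation (\<lambda>\<omega>. V i \<omega> * V j \<omega>))"
    by (intro sum.cong refl Bochner_Integration.integral_sum iVV)
  also have "\<dots> \<le> (\<Sum>i\<in>J. \<Sum>j\<in>J. if E i j then 1 else 0)" by (intro sum_mono cov)
  also have "\<dots> = (\<Sum>i\<in>J. real (card {j\<in>J. E i j}))"
    using J by (intro sum.cong refl) (simp add: sum.If_cases Int_def)
  also have "\<dots> \<le> (\<Sum>i\<in>J. real m)" using deg by (intro sum_mono) simp
  also have "\<dots> = N * real m" by (simp add: N_def)
  finally have ET: "expectation (\<lambda>\<omega>. (T \<omega>)\<^sup>2) \<le> N * real m" .
  have Tm: "T \<in> borel_measurable M" unfolding T_def V_def using meas by auto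
  have pos: "0 < p * N / 2" using p N by simp
  have "prob {\<omega>\<in>space M. (\<Sum>i\<in>J. Y i \<omega>) \<le> p * real (card J) / 2} \<le> prob {\<omega>\<in>space M. (p * N / 2)\<^sup>2 \<le> (T \<omega>)\<^sup>2}"
  proof (rule finite_measure_mono)
    show "{\<omega>\<in>space M. (\<Sum>i\<in>J. Y i \<omega>) \<le> p * real (card J) / 2} \<subseteq> {\<omega>\<in>space M. (p * N / 2)\<^sup>2 \<le> (T \<omega>)\<^sup>2}"
    proof safe
      fix \<omega> assume "(\<Sum>i\<in>J. Y i \<omega>) \<le> p * real (card J) / 2"
      then have "p * N / 2 \<le> - T \<omega>" by (simp add: T_def V_def sum_subtractf N_def field_simps)
      then have "(p * N / 2)\<^sup>2 \<le> (- T \<omega>)\<^sup>2" using pos by (intro power_mono) auto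
      then show "(p * N / 2)\<^sup>2 \<le> (T \<omega>)\<^sup>2" by simp
    qed
    show "{\<omega>\<in>space M. (p * N / 2)\<^sup>2 \<le> (T \<omega>)\<^sup>2} \<in> events" using Tm by measurable
  qed
  also have "\<dots> \<le> expectation (\<lambda>\<omega>. (T \<omega>)\<^sup>2) / (p * N / 2)\<^sup>2"
    using pos by (intro integral_Markov_inequality_measure[OF iT, of "{}"]) auto
  also have "\<dots> \<le> N * real m / (p * N / 2)\<^sup>2"
    using ET by (intro divide_right_mono) auto
  also have "\<dots> = 4 * real m / (p\<^sup>2 * real (card J))"
    using N p by (simp add: N_def power2_eq_square field_simps)
  finally show ?thesis .
qed

lemma fourier_pair_isCont:
  fixes g :: "real^'d \<Rightarrow> real"
  assumes "fourier_pair h g"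
  shows "isCont g s"
  unfolding continuous_at_sequentially comp_def
proof (intro allI impI)
  fix x :: "nat \<Rightarrow> real^'d" assume x: "x \<longlonglongrightarrow> s"
  let ?f = "\<lambda>s f. complex_of_real (h f) * exp (\<i> * complex_of_real (f \<bullet> s))"
  have hb: "has_bochner_integral lborel (?f s) (complex_of_real (g s))" for s
    using assms by (simp add: fourier_pair_def)
  have int: "integrable lborel (?f s)" "integral\<^sup>L lborel (?f s) = complex_of_real (g s)" for s
    using hb[of s] by (auto simp: has_bochner_integral_iff)
  have "(\<lambda>n. integral\<^sup>L lborel (?f (x n))) \<longlonglongrightarrow> integral\<^sup>L lborel (?f s)"
  proof (rule integral_dominated_convergence[where w = "\<lambda>f. \<bar>h f\<bar>"])
    show "integrable lborel (\<lambda>f. \<bar>h f\<bar>)" using fourier_pair_integrable[OF assms] by auto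
    show "AE f in lborel. (\<lambda>n. ?f (x n) f) \<longlonglongrightarrow> ?f s f"
      by (intro AE_I2 tendsto_intros x)
  qed (use int(1) in \<open>auto simp: norm_mult intro: borel_measurable_integrable\<close>)
  then have "(\<lambda>n. complex_of_real (g (x n))) \<longlonglongrightarrow> complex_of_real (g s)" unfolding int(2) .
  then show "(\<lambda>n. g (x n)) \<longlonglongrightarrow> g s" by (simp only: tendsto_of_real_iff)
qed

text \<open>Agreement at every point of the lag set would be agreement almost everywhere, so identifiability yields
  a single point of disagreement. A disagreement at the origin is represented by \<open>z = 0\<close> and \<open>u\<^sub>1 = u\<^sub>2\<close>.\<close>

lemma identifiable_distinguishing_lag:
  fixes c :: "real^'p \<Rightarrow> real^'d \<Rightarrow> real"
  assumes id: "asymptotically_identifiable \<Theta> c \<tau> \<theta>0" and \<theta>: "\<theta> \<in> \<Theta>" "\<theta> \<noteq> \<theta>0"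
  obtains z :: "int^'d" and u1 u2 where "u1 \<in> unit_cube" "u2 \<in> unit_cube" "z = 0 \<Longrightarrow> u1 = u2"
    "c \<theta> ((\<chi> k. real_of_int (z $ k)) + \<tau> *\<^sub>R (u1 - u2)) \<noteq> c \<theta>0 ((\<chi> k. real_of_int (z $ k)) + \<tau> *\<^sub>R (u1 - u2))"
proof -
  have cube0: "(0 :: real^'d) \<in> unit_cube" by (simp add: unit_cube_def)
  have lattice: "(\<chi> k. real_of_int \<lfloor>z $ k\<rfloor>) = z" if "z \<in> integer_lattice" for z :: "real^'d"
    using that by (auto simp: integer_lattice_def Finite_Cartesian_Product.vec_eq_iff)
  show thesis
  proof (cases "\<tau> = 0")
    case True
    with id \<theta> obtain z where z: "z \<in> integer_lattice" "c \<theta> z \<noteq> c \<theta>0 z"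
      by (auto simp: asymptotically_identifiable_def)
    show thesis
      by (rule that[of 0 0 "\<chi> k. \<lfloor>z $ k\<rfloor>"]) (use z cube0 lattice[OF z(1)] in auto)
  next
    case False
    show thesis
    proof (cases "c \<theta> 0 = c \<theta>0 0")
      case True
      have "\<exists>s\<in>lag_set \<tau>. c \<theta> s \<noteq> c \<theta>0 s"
      proof (rule ccontr)
        assume "\<not> ?thesis"
        then have "AE s in lebesgue. s \<in> lag_set \<tau> \<longrightarrow> c \<theta> s - c \<theta>0 s = 0" by auto
        then show False using id \<theta> False True by (auto simp: asymptotically_identifiable_def)
      qed
      then obtain z u1 u2 where s: "z \<in> integer_lattice" "z \<noteq> 0" "u1 \<in> unit_cube" "u2 \<in> unit_cube"
        "c \<theta> (z + \<tau> *\<^sub>R (u1 - u2)) \<noteq> c \<theta>0 (z + \<tau> *\<^sub>R (u1 - u2))"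
        by (auto simp: lag_set_def)
      have "(\<chi> k. \<lfloor>z $ k\<rfloor>) \<noteq> 0"
      proof
        assume "(\<chi> k. \<lfloor>z $ k\<rfloor>) = 0"
        then have "\<lfloor>z $ k\<rfloor> = 0" for k by (simp add: Finite_Cartesian_Product.vec_eq_iff)
        then have "z = 0" using lattice[OF s(1)] by (simp add: Finite_Cartesian_Product.vec_eq_iff)
        then show False using s by simp
      qed
      then show thesis
        by (intro that[of u1 u2 "\<chi> k. \<lfloor>z $ k\<rfloor>"]) (use s lattice[OF s(1)] in auto)
    next
      case False
      have "(\<chi> k. real_of_int ((0 :: int^'d) $ k)) = 0" by (simp add: Finite_Cartesian_Product.vec_eq_iff)
      then show thesis by (intro that[of 0 0 0]) (use False cube0 in auto)
    qed
  qed
qed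

text \<open>A ball around a point of the cube meets the interior of the cube in a nonempty open set, which is not
  Lebesgue negligible.\<close>

lemma (in prob_space) positive_density_ball:
  fixes X :: "nat \<Rightarrow> 'a \<Rightarrow> real^'d"
  assumes iid: "iid_positive_density M X" and u: "u \<in> unit_cube" and r: "0 < r"
  shows "\<exists>p>0. \<forall>i\<ge>1. prob (X i -` ball u r \<inter> space M) = p"
proof -
  obtain g where g: "g \<in> borel_measurable borel" "\<forall>x\<in>unit_cube. 0 < g x"
    "\<forall>i\<ge>1. distributed M lborel (X i) (\<lambda>x. ennreal (g x * indicator unit_cube x))"
    using iid by (auto simp: iid_positive_density_def)
  let ?I = "\<integral>\<^sup>+ x. ennreal (g x * indicator unit_cube x) * indicator (ball u r) x \<partial>lborel"
  have em: "emeasure M (X i -` ball u r \<inter> space M) = ?I" if "1 \<le> i" for i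
    using distributed_emeasure[of M lborel "X i" _ "ball u r"] g(3) that by simp
  have "?I \<noteq> 0"
  proof
    assume "?I = 0"
    moreover have m: "(\<lambda>x. ennreal (g x * indicator unit_cube x)) \<in> borel_measurable lborel"
      using g(3) distributed_borel_measurable by blast
    ultimately have ae: "AE x in lborel. ennreal (g x * indicator unit_cube x) * indicator (ball u r) x = 0"
    proof (subst (asm) nn_integral_0_iff_AE)
      show "(\<lambda>x. ennreal (g x * indicator unit_cube x) * indicator (ball u r) x) \<in> borel_measurable lborel"
        by (intro borel_measurable_times_ennreal m borel_measurable_indicator) auto
    qed auto
    define U where "U = box (\<chi> k. - 1) (\<chi> k. 1) \<inter> ball u r"
    have cb: "unit_cube = (cbox (\<chi> k. - 1) (\<chi> k. 1) :: (real^'d) set)"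
      by (auto simp: unit_cube_def mem_box_cart)
    have "closure (box (\<chi> k. - 1) (\<chi> k. 1)) = (cbox (\<chi> k. - 1) (\<chi> k. 1) :: (real^'d) set)"
      by (rule closure_box) (auto simp: box_ne_empty Basis_vec_def inner_axis)
    then have "u \<in> closure (box (\<chi> k. - 1) (\<chi> k. 1))" using u cb by simp
    then obtain y where "y \<in> box (\<chi> k. - 1) (\<chi> k. 1)" "dist y u < r"
      using r unfolding closure_approachable by blast
    then have "y \<in> U" by (simp add: U_def dist_commute)
    then have "U \<noteq> {}" by blast
    moreover have "open U" unfolding U_def by (intro open_Int) auto
    moreover have "AE x in lborel. x \<notin> U"
      using ae
    proof eventually_elim
      case (elim x)
      show ?case
      proof
        assume "x \<in> U"
        then have x: "x \<in> unit_cube" "x \<in> ball u r" using box_subset_cbox unfolding U_def cb by auto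
        then have "0 < g x" using g(2) by auto
        then show False using elim x by (simp add: ennreal_eq_0_iff)
      qed
    qed
    ultimately have "open U" "U \<noteq> {}" "U \<in> null_sets lborel"
      by (auto simp: AE_iff_null_sets)
    then show False
      using open_not_negligible[of U] by (auto simp: negligible_iff_null_sets null_sets_completionI)
  qed
  show ?thesis
  proof (intro exI[of _ "enn2real ?I"] conjI allI impI)
    have "?I = ennreal (prob (X 1 -` ball u r \<inter> space M))" using em[of 1] emeasure_eq_measure by simp
    then have "enn2real ?I = prob (X 1 -` ball u r \<inter> space M)" "prob (X 1 -` ball u r \<inter> space M) \<noteq> 0"
      using \<open>?I \<noteq> 0\<close> by auto
    then show "0 < enn2real ?I" by (simp add: zero_less_measure_iff)
    show "prob (X i -` ball u r \<inter> space M) = enn2real ?I" if "1 \<le> i" for i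
      using em[OF that] by (simp add: measure_def)
  qed
qed


text \<open>If \<open>q\<close> is positive at the lag \<open>z + \<tau> (u\<^sub>1 - u\<^sub>2)\<close>, it is bounded below whenever two grid points at
  distance \<open>z\<close> are displaced by vectors near \<open>u\<^sub>1\<close> and \<open>u\<^sub>2\<close>. A positive fraction of the pairs
  is of this kind, and the corresponding events are independent for pairs without common point.\<close>

lemma (in prob_space) lag_statistic_lower_bound:
  fixes X :: "nat \<Rightarrow> 'a \<Rightarrow> real^'d" and q :: "real^'d \<Rightarrow> real" and z :: "int^'d"
  assumes iid: "iid_positive_density M X" and v: "grid_enumeration v" and \<tau>: "0 \<le> \<tau>" "\<tau> < 1 / 2"
    and q0: "\<And>x. 0 \<le> q x" and u: "u1 \<in> unit_cube" "u2 \<in> unit_cube" "z = 0 \<Longrightarrow> u1 = u2"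
    and q: "isCont q ((\<chi> k. real_of_int (z $ k)) + \<tau> *\<^sub>R (u1 - u2))"
      "0 < q ((\<chi> k. real_of_int (z $ k)) + \<tau> *\<^sub>R (u1 - u2))"
  shows "\<exists>\<beta>>0. (\<lambda>n. prob {\<omega>\<in>space M. (\<Sum>i<n. \<Sum>j<n. q (location v \<tau> X (Suc i) \<omega> - location v \<tau> X (Suc j) \<omega>))
     \<le> \<beta> * real n}) \<longlonglongrightarrow> 0"
proof -
  define s0 where "s0 = (\<chi> k. real_of_int (z $ k)) + \<tau> *\<^sub>R (u1 - u2)"
  define S where "S = location v \<tau> X"
  have dbl: "(\<Sum>i<n. \<Sum>j<n. q (S (Suc i) \<omega> - S (Suc j) \<omega>)) = (\<Sum>i\<in>{1..n}. \<Sum>j\<in>{1..n}. q (S i \<omega> - S j \<omega>))" for n \<omega>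
    by (simp add: sum.atLeast1_atMost_eq)
  show ?thesis
  proof (cases "z = 0")
    case True
    then have s0: "s0 = 0" using u(3) by (simp add: s0_def Finite_Cartesian_Product.vec_eq_iff)
    have empty: "{\<omega>\<in>space M. (\<Sum>i<n. \<Sum>j<n. q (S (Suc i) \<omega> - S (Suc j) \<omega>)) \<le> q 0 / 2 * real n} = {}" if n: "1 \<le> n" for n
    proof -
      have "q 0 * real n \<le> (\<Sum>i<n. \<Sum>j<n. q (S (Suc i) \<omega> - S (Suc j) \<omega>))" for \<omega>
      proof -
        have "q 0 * real n = (\<Sum>i<n. q (S (Suc i) \<omega> - S (Suc i) \<omega>))" by simp
        also have "\<dots> \<le> (\<Sum>i<n. \<Sum>j<n. q (S (Suc i) \<omega> - S (Suc j) \<omega>))"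
          by (intro sum_mono member_le_sum) (auto simp: q0)
        finally show ?thesis .
      qed
      moreover have "q 0 / 2 * real n < q 0 * real n" using q(2) n s0 by (simp add: s0_def)
      ultimately have "q 0 / 2 * real n < (\<Sum>i<n. \<Sum>j<n. q (S (Suc i) \<omega> - S (Suc j) \<omega>))" for \<omega>
        using less_le_trans by blast
      then have "\<not> (\<Sum>i<n. \<Sum>j<n. q (S (Suc i) \<omega> - S (Suc j) \<omega>)) \<le> q 0 / 2 * real n" for \<omega>
        unfolding not_le .
      then show ?thesis by blast
    qed
    then have "\<forall>\<^sub>F n in sequentially. prob {\<omega>\<in>space M. (\<Sum>i<n. \<Sum>j<n. q (S (Suc i) \<omega> - S (Suc j) \<omega>)) \<le> q 0 / 2 * real n} = 0"
      by (intro eventually_sequentiallyI[of 1]) (simp only: empty measure_empty)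
    then show ?thesis using q(2) s0 unfolding S_def
      by (intro exI[of _ "q 0 / 2"]) (auto simp: s0_def intro: tendsto_eventually)
  next
    case False
    define \<epsilon> where "\<epsilon> = q s0 / 2"
    have \<epsilon>: "0 < \<epsilon>" using q(2) by (simp add: \<epsilon>_def s0_def)
    obtain r where r: "0 < r" "\<And>x. dist x s0 < r \<Longrightarrow> \<epsilon> \<le> q x"
    proof -
      obtain r where r: "0 < r" "\<And>x. dist x s0 < r \<Longrightarrow> dist (q x) (q s0) < \<epsilon>"
        using q(1) \<epsilon> unfolding continuous_at_eps_delta s0_def[symmetric] dist_norm by metis
      have "\<epsilon> \<le> q x" if "dist x s0 < r" for x
        using r(2)[OF that] unfolding dist_real_def \<epsilon>_def by linarith
      with r(1) show thesis by (rule that)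
    qed
    obtain p1 where p1: "0 < p1" "\<And>i. 1 \<le> i \<Longrightarrow> prob (X i -` ball u1 r \<inter> space M) = p1"
      using positive_density_ball[OF iid u(1) r(1)] by blast
    obtain p2 where p2: "0 < p2" "\<And>i. 1 \<le> i \<Longrightarrow> prob (X i -` ball u2 r \<inter> space M) = p2"
      using positive_density_ball[OF iid u(2) r(1)] by blast
    define p where "p = p1 * p2"
    have p: "0 < p" using p1 p2 by (simp add: p_def)
    have ind: "indep_vars (\<lambda>_. borel) X {1..}" using iid by (simp add: iid_positive_density_def)
    have Xm [measurable]: "X i \<in> borel_measurable M" if "1 \<le> i" for i
      using ind that by (auto simp: indep_vars_def)
    define par where "par i = (SOME j. 1 \<le> j \<and> (\<forall>k. int (v i $ k) - int (v j $ k) = z $ k))" for i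
    have inj: "inj_on v {1..}" by (rule grid_enumeration_inj[OF v])
    have par: "par i \<in> {1..n} \<and> (\<forall>k. int (v i $ k) - int (v (par i) $ k) = z $ k)"
      if "i \<in> lag_indices v z n" for i n
    proof -
      from that obtain j where j: "j \<in> {1..n}" "\<forall>k. int (v i $ k) - int (v j $ k) = z $ k"
        by (auto simp: lag_indices_def)
      have ex: "1 \<le> par i \<and> (\<forall>k. int (v i $ k) - int (v (par i) $ k) = z $ k)"
        unfolding par_def by (rule someI[of _ j]) (use j in auto)
      have "v (par i) = v j"
      proof -
        have "int (v (par i) $ k) = int (v j $ k)" for k using ex j(2)[rule_format, of k] by (metis diff_left_imp_eq)
        then show ?thesis by (simp add: Finite_Cartesian_Product.vec_eq_iff)
      qed
      then have "par i = j" using ex j(1) inj by (auto dest: inj_onD)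
      then show ?thesis using j by simp
    qed
    define Y :: "nat \<Rightarrow> 'a \<Rightarrow> real" where
      "Y i \<omega> = indicator (X i -` ball u1 r \<inter> space M) \<omega> * indicator (X (par i) -` ball u2 r \<inter> space M) \<omega>" for i \<omega>
    \<comment> \<open>Since \<open>par\<close> is injective, a pair shares a point with at most three pairs, itself included.\<close>
    define E where "E i j \<longleftrightarrow> {i, par i} \<inter> {j, par j} \<noteq> {}" for i j
    have tail: "prob {\<omega>\<in>space M. (\<Sum>i\<in>lag_indices v z n. Y i \<omega>) \<le> p * real (card (lag_indices v z n)) / 2}
        \<le> 4 * real 3 / (p\<^sup>2 * real (card (lag_indices v z n)))" if ne: "lag_indices v z n \<noteq> {}" for n
    proof (rule weakly_dependent_lower_tail[where E = E])
      let ?J = "lag_indices v z n"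
      have J1: "1 \<le> i" if "i \<in> ?J" for i using that by (auto simp: lag_indices_def)
      have P1: "1 \<le> par i" if "i \<in> ?J" for i using par[OF that] by simp
      have neq: "par i \<noteq> i" if "i \<in> ?J" for i
      proof
        assume "par i = i"
        then have "z = 0" using par[OF that] by (simp add: Finite_Cartesian_Product.vec_eq_iff)
        then show False using False by simp
      qed
      have inj_par: "i = j" if "i \<in> ?J" "j \<in> ?J" "par i = par j" for i j
      proof -
        have "int (v i $ k) = int (v j $ k)" for k
          using par[OF that(1)] par[OF that(2)] that(3) by (metis diff_add_cancel)
        then have "v i = v j" by (simp add: Finite_Cartesian_Product.vec_eq_iff)
        then show ?thesis using J1 that inj by (auto dest: inj_onD)
      qed
      have probI: "prob (\<Inter>k\<in>K. X k -` A k \<inter> space M) = (\<Prod>k\<in>K. prob (X k -` A k \<inter> space M))"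
        if "finite K" "K \<noteq> {}" "K \<subseteq> {1..}" "\<And>k. A k \<in> sets borel" for K A
        using indep_varsD[OF ind that(2,1,3)] that(4) by simp
      have B: "X i -` ball w r \<inter> space M \<in> events" if "1 \<le> i" for i w
        using that by measurable
      show "finite ?J" by (simp add: lag_indices_def)
      show "?J \<noteq> {}" by (rule ne)
      show "0 < p" by (rule p)
      show "Y i \<in> borel_measurable M" if "i \<in> ?J" for i
        unfolding Y_def by (intro borel_measurable_times borel_measurable_indicator B J1[OF that] P1[OF that])
      show "0 \<le> Y i \<omega> \<and> Y i \<omega> \<le> 1" for i \<omega> by (simp add: Y_def indicator_def)
      show "expectation (Y i) = p" if i: "i \<in> ?J" for i
      proof -
        let ?A = "\<lambda>k. if k = i then ball u1 r else ball u2 r"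
        have "expectation (Y i) = expectation (indicator (\<Inter>k\<in>{i, par i}. X k -` ?A k \<inter> space M))"
          using neq[OF i] by (intro Bochner_Integration.integral_cong) (auto simp: Y_def indicator_def)
        also have "\<dots> = prob (\<Inter>k\<in>{i, par i}. X k -` ?A k \<inter> space M)"
          by (subst Bochner_Integration.integral_indicator) (auto intro!: arg_cong[where f = prob])
        also have "\<dots> = (\<Prod>k\<in>{i, par i}. prob (X k -` ?A k \<inter> space M))"
          by (rule probI) (use J1[OF i] P1[OF i] in auto)
        also have "\<dots> = p" using neq[OF i] p1(2)[OF J1[OF i]] p2(2)[OF P1[OF i]] by (simp add: p_def)
        finally show ?thesis .
      qed
      show "expectation (\<lambda>\<omega>. Y i \<omega> * Y j \<omega>) = p * p" if i: "i \<in> ?J" and j: "j \<in> ?J" and nE: "\<not> E i j" for i j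
      proof -
        let ?A = "\<lambda>k. if k = i \<or> k = j then ball u1 r else ball u2 r"
        have d: "i \<noteq> j" "i \<noteq> par j" "par i \<noteq> j" "par i \<noteq> par j" "par i \<noteq> i" "par j \<noteq> j"
          using nE neq[OF i] neq[OF j] by (auto simp: E_def)
        have "expectation (\<lambda>\<omega>. Y i \<omega> * Y j \<omega>) =
            expectation (indicator (\<Inter>k\<in>{i, par i, j, par j}. X k -` ?A k \<inter> space M))"
          using d by (intro Bochner_Integration.integral_cong) (auto simp: Y_def indicator_def)
        also have "\<dots> = prob (\<Inter>k\<in>{i, par i, j, par j}. X k -` ?A k \<inter> space M)"
          by (subst Bochner_Integration.integral_indicator) (auto intro!: arg_cong[where f = prob])
        also have "\<dots> = (\<Prod>k\<in>{i, par i, j, par j}. prob (X k -` ?A k \<inter> space M))"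
          by (rule probI) (use J1[OF i] P1[OF i] J1[OF j] P1[OF j] in auto)
        also have "\<dots> = p * p"
          using d p1(2)[OF J1[OF i]] p2(2)[OF P1[OF i]] p1(2)[OF J1[OF j]] p2(2)[OF P1[OF j]]
          by (simp add: p_def)
        finally show ?thesis .
      qed
      show "card {j\<in>?J. E i j} \<le> 3" if i: "i \<in> ?J" for i
      proof -
        have sub: "{j\<in>?J. E i j} \<subseteq> {i, par i} \<union> {j\<in>?J. par j = i}"
        proof (intro subsetI UnCI)
          fix j assume j: "j \<in> {j\<in>?J. E i j}" "j \<notin> {j\<in>?J. par j = i}"
          then have "i = j \<or> par i = j \<or> par i = par j" by (auto simp: E_def)
          then show "j \<in> {i, par i}" using inj_par[OF i] j(1) by blast
        qed
        have "card {j\<in>?J. par j = i} \<le> Suc 0"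
        proof (subst card_le_Suc0_iff_eq)
          show "finite {j\<in>?J. par j = i}" by (simp add: lag_indices_def)
          show "\<forall>a\<in>{j\<in>?J. par j = i}. \<forall>b\<in>{j\<in>?J. par j = i}. a = b"
          proof (intro ballI)
            fix a b assume "a \<in> {j\<in>?J. par j = i}" "b \<in> {j\<in>?J. par j = i}"
            then show "a = b" using inj_par[of a b] by simp
          qed
        qed
        moreover have "card {i, par i} \<le> 2" by (simp add: card_insert_if)
        moreover have "card {j\<in>?J. E i j} \<le> card ({i, par i} \<union> {j\<in>?J. par j = i})"
          by (rule card_mono[OF _ sub]) (auto simp: lag_indices_def)
        moreover have "card ({i, par i} \<union> {j\<in>?J. par j = i}) \<le> card {i, par i} + card {j\<in>?J. par j = i}"
          by (rule card_Un_le)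
        ultimately show ?thesis by linarith
      qed
    qed
    have incl: "\<epsilon> * (\<Sum>i\<in>lag_indices v z n. Y i \<omega>) \<le> (\<Sum>i<n. \<Sum>j<n. q (S (Suc i) \<omega> - S (Suc j) \<omega>))"
      for n \<omega>
    proof -
      have "\<epsilon> * Y i \<omega> \<le> q (S i \<omega> - S (par i) \<omega>)" if i: "i \<in> lag_indices v z n" for i
      proof (cases "X i \<omega> \<in> ball u1 r \<and> X (par i) \<omega> \<in> ball u2 r")
        case True
        have "(S i \<omega> - S (par i) \<omega>) $ k - s0 $ k = (\<tau> *\<^sub>R ((X i \<omega> - u1) - (X (par i) \<omega> - u2))) $ k" for k
        proof -
          have "real_of_int (int (v i $ k) - int (v (par i) $ k)) = real_of_int (z $ k)"
            using par[OF i] by simp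
          then show ?thesis by (simp add: S_def location_def s0_def algebra_simps)
        qed
        then have "S i \<omega> - S (par i) \<omega> - s0 = \<tau> *\<^sub>R ((X i \<omega> - u1) - (X (par i) \<omega> - u2))"
          by (simp add: Finite_Cartesian_Product.vec_eq_iff)
        then have "dist (S i \<omega> - S (par i) \<omega>) s0 = \<tau> * norm ((X i \<omega> - u1) - (X (par i) \<omega> - u2))"
          using \<tau> by (simp add: dist_norm)
        also have "\<dots> \<le> \<tau> * (norm (X i \<omega> - u1) + norm (X (par i) \<omega> - u2))"
          using \<tau> by (intro mult_left_mono norm_triangle_ineq4) auto
        also have "\<dots> \<le> 1 / 2 * (norm (X i \<omega> - u1) + norm (X (par i) \<omega> - u2))"
          using \<tau> by (intro mult_right_mono) auto
        also have "\<dots> < r" using True by (simp add: dist_norm norm_minus_commute)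
        finally have "\<epsilon> \<le> q (S i \<omega> - S (par i) \<omega>)" by (rule r(2))
        then show ?thesis using \<epsilon> q0[of "S i \<omega> - S (par i) \<omega>"] by (auto simp: Y_def indicator_def)
      next
        case False
        then show ?thesis using q0 by (auto simp: Y_def indicator_def)
      qed
      then have "\<epsilon> * (\<Sum>i\<in>lag_indices v z n. Y i \<omega>) \<le> (\<Sum>i\<in>lag_indices v z n. q (S i \<omega> - S (par i) \<omega>))"
        unfolding sum_distrib_left by (intro sum_mono)
      also have "\<dots> \<le> (\<Sum>i\<in>lag_indices v z n. \<Sum>j\<in>{1..n}. q (S i \<omega> - S j \<omega>))"
      proof (intro sum_mono)
        fix i assume i: "i \<in> lag_indices v z n"
        show "q (S i \<omega> - S (par i) \<omega>) \<le> (\<Sum>j\<in>{1..n}. q (S i \<omega> - S j \<omega>))"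
          using member_le_sum[of "par i" "{1..n}" "\<lambda>j. q (S i \<omega> - S j \<omega>)"] par[OF i] q0 by auto
      qed
      also have "\<dots> \<le> (\<Sum>i\<in>{1..n}. \<Sum>j\<in>{1..n}. q (S i \<omega> - S j \<omega>))"
        by (intro sum_mono2) (auto simp: lag_indices_def intro!: sum_nonneg q0)
      finally show ?thesis unfolding dbl .
    qed
    obtain N where N: "\<And>n. N \<le> n \<Longrightarrow> real n / 2 ^ CARD('d) \<le> real (card (lag_indices v z n))"
      using card_lag_indices_ge[OF v, of z] by blast
    define \<beta> where "\<beta> = \<epsilon> * p / (2 * 2 ^ CARD('d))"
    have \<beta>: "0 < \<beta>" using \<epsilon> p by (simp add: \<beta>_def)
    define c where "c = 12 * 2 ^ CARD('d) / p\<^sup>2"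
    let ?P = "\<lambda>n. prob {\<omega>\<in>space M. (\<Sum>i<n. \<Sum>j<n. q (S (Suc i) \<omega> - S (Suc j) \<omega>)) \<le> \<beta> * real n}"
    have le: "?P n \<le> c / real n" if n: "max 1 N \<le> n" for n
    proof -
      let ?J = "lag_indices v z n"
      have n0: "0 < real n" using n by simp
      have cardJ: "real n / 2 ^ CARD('d) \<le> real (card ?J)" using N n by simp
      have "0 < real n / 2 ^ CARD('d)" using n0 by simp
      with cardJ have J0: "0 < real (card ?J)" by linarith
      then have ne: "?J \<noteq> {}" by auto
      have "?P n \<le> prob {\<omega>\<in>space M. (\<Sum>i\<in>?J. Y i \<omega>) \<le> p * real (card ?J) / 2}"
      proof (rule finite_measure_mono)
        show "{\<omega>\<in>space M. (\<Sum>i<n. \<Sum>j<n. q (S (Suc i) \<omega> - S (Suc j) \<omega>)) \<le> \<beta> * real n}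
          \<subseteq> {\<omega>\<in>space M. (\<Sum>i\<in>?J. Y i \<omega>) \<le> p * real (card ?J) / 2}"
        proof safe
          fix \<omega> assume a: "(\<Sum>i<n. \<Sum>j<n. q (S (Suc i) \<omega> - S (Suc j) \<omega>)) \<le> \<beta> * real n"
          have "\<epsilon> * (\<Sum>i\<in>?J. Y i \<omega>) \<le> \<beta> * real n" by (rule order_trans[OF incl a])
          also have "\<dots> = \<epsilon> * (p / 2 * (real n / 2 ^ CARD('d)))" by (simp add: \<beta>_def)
          also have "\<dots> \<le> \<epsilon> * (p / 2 * real (card ?J))"
            using \<epsilon> p cardJ by (intro mult_left_mono) auto
          finally show "(\<Sum>i\<in>?J. Y i \<omega>) \<le> p * real (card ?J) / 2" using \<epsilon> by simp
        qed
        have "Y i \<in> borel_measurable M" if "i \<in> ?J" for i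
        proof -
          have "X i \<in> borel_measurable M" "X (par i) \<in> borel_measurable M"
            using that par[OF that] by (auto intro!: Xm simp: lag_indices_def)
          then show ?thesis unfolding Y_def
            by (intro borel_measurable_times borel_measurable_indicator measurable_sets[of _ M borel]) auto
        qed
        then have [measurable]: "(\<lambda>\<omega>. \<Sum>i\<in>?J. Y i \<omega>) \<in> borel_measurable M"
          by (rule borel_measurable_sum)
        show "{\<omega>\<in>space M. (\<Sum>i\<in>?J. Y i \<omega>) \<le> p * real (card ?J) / 2} \<in> events" by measurable
      qed
      also have "\<dots> \<le> 4 * real 3 / (p\<^sup>2 * real (card ?J))" by (rule tail[OF ne])
      also have "\<dots> \<le> 12 / (p\<^sup>2 * (real n / 2 ^ CARD('d)))"
      proof -
        have "0 < p\<^sup>2" using p by simp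
        then show ?thesis using cardJ n0 J0
          by (simp only: of_nat_numeral, intro frac_le mult_left_mono) (auto intro!: mult_pos_pos)
      qed
      also have "\<dots> = c / real n" by (simp add: c_def)
      finally show ?thesis .
    qed
    have "?P \<longlonglongrightarrow> 0"
    proof (rule tendsto_sandwich[OF _ _ tendsto_const])
      show "\<forall>\<^sub>F n in sequentially. 0 \<le> ?P n" by simp
      show "\<forall>\<^sub>F n in sequentially. ?P n \<le> c / real n"
        by (intro eventually_sequentiallyI[of "max 1 N"] le)
      show "(\<lambda>n. c / real n) \<longlonglongrightarrow> 0" by (rule lim_const_over_n)
    qed
    then show ?thesis using \<beta> unfolding S_def by blast
  qed
qed

section \<open>Conditioning on the locations\<close>

text \<open>By independence the joint law of the outcome (seen through the \<open>\<sigma>\<close>-algebra \<open>A\<close> that carries the field)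
  and the displacements is a product measure. Tonelli's theorem then reduces a probability at random
  locations to probabilities at fixed locations.\<close>

lemma (in prob_space) independent_section_bound:
  fixes Z :: "real^'d \<Rightarrow> 'a \<Rightarrow> real" and X :: "nat \<Rightarrow> 'a \<Rightarrow> real^'d"
  assumes ji: "jointly_measurable_independent M Z X"
    and Xm: "\<And>i. 1 \<le> i \<Longrightarrow> X i \<in> borel_measurable M"
  obtains A where "subalgebra M A" "(\<lambda>(s, \<omega>). Z s \<omega>) \<in> borel_measurable (borel \<Otimes>\<^sub>M A)"
    "\<And>E p. E \<in> sets (A \<Otimes>\<^sub>M Pi\<^sub>M {1..} (\<lambda>_. borel)) \<Longrightarrow>
       (\<And>x. prob {\<omega>\<in>space M. (\<omega>, x) \<in> E} \<le> p) \<Longrightarrow>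
       {\<omega>\<in>space M. (\<omega>, \<lambda>i\<in>{1..}. X i \<omega>) \<in> E} \<in> events \<and> prob {\<omega>\<in>space M. (\<omega>, \<lambda>i\<in>{1..}. X i \<omega>) \<in> E} \<le> p"
proof -
  let ?N = "Pi\<^sub>M {1::nat..} (\<lambda>_. borel :: (real^'d) measure)"
  let ?X = "\<lambda>\<omega>. \<lambda>i\<in>{1..}. X i \<omega>"
  obtain A where A: "subalgebra M A" "(\<lambda>(s, \<omega>). Z s \<omega>) \<in> borel_measurable (borel \<Otimes>\<^sub>M A)"
    "indep_set (sets A) (sets (vimage_algebra (space M) ?X ?N))"
    using ji by (auto simp: jointly_measurable_independent_def)
  have spA: "space A = space M" and subA: "sets A \<subseteq> sets M" using A(1) by (auto simp: subalgebra_def)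
  have id: "(\<lambda>\<omega>. \<omega>) \<in> measurable M A" using subA spA by (auto simp: measurable_def)
  have X: "?X \<in> measurable M ?N" using Xm by (intro measurable_restrict) auto
  interpret PA: prob_space "distr M A (\<lambda>\<omega>. \<omega>)" by (rule prob_space_distr[OF id])
  interpret PX: prob_space "distr M ?N ?X" by (rule prob_space_distr[OF X])
  interpret P: pair_prob_space "distr M A (\<lambda>\<omega>. \<omega>)" "distr M ?N ?X" ..
  have m: "(\<lambda>\<omega>. (\<omega>, ?X \<omega>)) \<in> measurable M (A \<Otimes>\<^sub>M ?N)" by (rule measurable_Pair[OF id X])
  have dist: "distr M A (\<lambda>\<omega>. \<omega>) \<Otimes>\<^sub>M distr M ?N ?X = distr M (A \<Otimes>\<^sub>M ?N) (\<lambda>\<omega>. (\<omega>, ?X \<omega>))"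
  proof (rule pair_measure_eqI)
    fix a b assume "a \<in> sets (distr M A (\<lambda>\<omega>. \<omega>))" "b \<in> sets (distr M ?N ?X)"
    then have ab: "a \<in> sets A" "b \<in> sets ?N" by auto
    have am: "a \<subseteq> space M" using sets.sets_into_space[OF ab(1)] spA by simp
    have "prob (a \<inter> (?X -` b \<inter> space M)) = prob a * prob (?X -` b \<inter> space M)"
      by (rule indep_setD[OF A(3) ab(1) in_vimage_algebra[OF ab(2)]])
    moreover have "(\<lambda>\<omega>. (\<omega>, ?X \<omega>)) -` (a \<times> b) \<inter> space M = a \<inter> (?X -` b \<inter> space M)"
      using am by auto
    moreover have "emeasure (distr M A (\<lambda>\<omega>. \<omega>)) a = prob a"
      using am by (simp add: emeasure_distr[OF id ab(1)] Int_absorb2 emeasure_eq_measure)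
    moreover have "emeasure (distr M ?N ?X) b = prob (?X -` b \<inter> space M)"
      unfolding emeasure_distr[OF X ab(2)] emeasure_eq_measure ..
    moreover have "emeasure (distr M (A \<Otimes>\<^sub>M ?N) (\<lambda>\<omega>. (\<omega>, ?X \<omega>))) (a \<times> b)
      = prob ((\<lambda>\<omega>. (\<omega>, ?X \<omega>)) -` (a \<times> b) \<inter> space M)"
      using emeasure_distr[OF m pair_measureI[OF ab]] by (simp only: emeasure_eq_measure)
    ultimately show "emeasure (distr M A (\<lambda>\<omega>. \<omega>)) a * emeasure (distr M ?N ?X) b
      = emeasure (distr M (A \<Otimes>\<^sub>M ?N) (\<lambda>\<omega>. (\<omega>, ?X \<omega>))) (a \<times> b)"
      by (simp add: ennreal_mult)
  next
    show "sets (distr M A (\<lambda>\<omega>. \<omega>) \<Otimes>\<^sub>M distr M ?N ?X) = sets (distr M (A \<Otimes>\<^sub>M ?N) (\<lambda>\<omega>. (\<omega>, ?X \<omega>)))"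
      by (simp cong: sets_pair_measure_cong)
  qed (rule PA.sigma_finite_measure_axioms PX.sigma_finite_measure_axioms)+
  have "{\<omega>\<in>space M. (\<omega>, ?X \<omega>) \<in> E} \<in> events \<and> prob {\<omega>\<in>space M. (\<omega>, ?X \<omega>) \<in> E} \<le> p"
    if E: "E \<in> sets (A \<Otimes>\<^sub>M ?N)" and p: "\<And>x. prob {\<omega>\<in>space M. (\<omega>, x) \<in> E} \<le> p" for E p
  proof -
    have set: "{\<omega>\<in>space M. (\<omega>, ?X \<omega>) \<in> E} = (\<lambda>\<omega>. (\<omega>, ?X \<omega>)) -` E \<inter> space M" by auto
    have ev: "{\<omega>\<in>space M. (\<omega>, ?X \<omega>) \<in> E} \<in> events"
      unfolding set by (rule measurable_sets[OF m E])
    have "emeasure M {\<omega>\<in>space M. (\<omega>, ?X \<omega>) \<in> E} = emeasure (distr M A (\<lambda>\<omega>. \<omega>) \<Otimes>\<^sub>M distr M ?N ?X) E"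
      unfolding dist set using emeasure_distr[OF m E] by simp
    also have "\<dots> = (\<integral>\<^sup>+ x. emeasure (distr M A (\<lambda>\<omega>. \<omega>)) ((\<lambda>\<omega>. (\<omega>, x)) -` E) \<partial>distr M ?N ?X)"
      using E by (intro P.emeasure_pair_measure_alt2) (simp only: dist sets_distr)
    also have "\<dots> \<le> (\<integral>\<^sup>+ x. ennreal p \<partial>distr M ?N ?X)"
    proof (intro nn_integral_mono)
      fix x
      have sec: "(\<lambda>\<omega>. (\<omega>, x)) -` E \<in> sets A" using E by (rule sets_Pair2)
      have "emeasure (distr M A (\<lambda>\<omega>. \<omega>)) ((\<lambda>\<omega>. (\<omega>, x)) -` E) = emeasure M {\<omega>\<in>space M. (\<omega>, x) \<in> E}"
        unfolding emeasure_distr[OF id sec]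
        by (rule arg_cong[where f = "emeasure M"]) blast
      then show "emeasure (distr M A (\<lambda>\<omega>. \<omega>)) ((\<lambda>\<omega>. (\<omega>, x)) -` E) \<le> ennreal p"
        using p[of x] by (simp add: emeasure_eq_measure ennreal_leI)
    qed
    also have "\<dots> = ennreal p" using PX.emeasure_space_1 by simp
    finally have "ennreal (prob {\<omega>\<in>space M. (\<omega>, ?X \<omega>) \<in> E}) \<le> ennreal p"
      by (simp add: emeasure_eq_measure)
    moreover have "0 \<le> p" by (rule order_trans[OF measure_nonneg p[of undefined]])
    ultimately show ?thesis using ev by (simp add: ennreal_le_iff)
  qed
  with A(1,2) show thesis by (rule that)
qed

lemma measurable_det:
  fixes A :: "'w \<Rightarrow> real mat"
  assumes "\<And>w. A w \<in> carrier_mat n n"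
    and "\<And>i j. i < n \<Longrightarrow> j < n \<Longrightarrow> (\<lambda>w. A w $$ (i, j)) \<in> borel_measurable N"
  shows "(\<lambda>w. det (A w)) \<in> borel_measurable N"
proof -
  have "(\<lambda>w. det (A w)) = (\<lambda>w. \<Sum>p\<in>{p. p permutes {0..<n}}. signof p * (\<Prod>i = 0..<n. A w $$ (i, p i)))"
    using det_def'[OF assms(1)] by (intro ext) simp
  also have "\<dots> \<in> borel_measurable N"
  proof (intro borel_measurable_sum borel_measurable_times borel_measurable_const borel_measurable_prod assms(2))
    fix p i assume "p \<in> {p. p permutes {0..<n}}" "i \<in> {0..<n}"
    then show "i < n" "p i < n" using permutes_in_image[of p "{0..<n}" i] by auto
  qed
  finally show ?thesis .
qed

text \<open>On positive definite matrices the contrast is a rational expression in the entries, up to a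
  logarithm. This form makes its measurability in the random locations evident.\<close>

definition adjugate_form :: "real mat \<Rightarrow> nat \<Rightarrow> (nat \<Rightarrow> real) \<Rightarrow> real" where
  "adjugate_form A n z = (\<Sum>i<n. \<Sum>j<n. z i * adj_mat A $$ (i, j) * z j) / det A"

lemma mahalanobis_adjugate:
  assumes A: "pos_def_mat n A"
  shows "mahalanobis A n z = adjugate_form A n z"
proof -
  have Ac: "A \<in> carrier_mat n n" using A by (simp add: pos_def_mat_def)
  have d: "0 < det A" using det_plus_pos_def[OF A] by simp
  have adj: "adj_mat A \<in> carrier_mat n n" "A * adj_mat A = det A \<cdot>\<^sub>m 1\<^sub>m n" using adj_mat[OF Ac] by auto
  let ?B = "(1 / det A) \<cdot>\<^sub>m adj_mat A"
  have B: "?B \<in> carrier_mat n n" using adj by simp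
  have "A * ?B = (1 / det A) \<cdot>\<^sub>m (A * adj_mat A)"
    using Ac adj(1) by (rule mult_smult_distrib)
  also have "\<dots> = 1\<^sub>m n" unfolding adj(2) using d by (intro eq_matI) auto
  finally have mp: "moore_penrose A = ?B" using moore_penrose_inverse[OF Ac B] by simp
  have "mahalanobis A n z = (\<Sum>i<n. z i * Matrix.vec_index (mult_mat_vec ?B (Matrix.vec n z)) i)"
    unfolding mahalanobis_def mp
    by (subst scalar_prod_sum[OF mult_mat_vec_carrier[OF B]]) (auto intro!: sum.cong)
  also have "\<dots> = (\<Sum>i<n. z i * (\<Sum>j<n. ?B $$ (i, j) * z j))"
    using mult_mat_vec_nth[OF B, of "Matrix.vec n z"] by (intro sum.cong) auto
  also have "\<dots> = adjugate_form A n z"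
    unfolding adjugate_form_def using adj(1)
    by (simp add: sum_distrib_left sum_divide_distrib mult_ac)
  finally show ?thesis .
qed

lemma measurable_adjugate_form:
  fixes A :: "'w \<Rightarrow> real mat"
  assumes carr: "\<And>w. A w \<in> carrier_mat n n"
    and ent: "\<And>i j. i < n \<Longrightarrow> j < n \<Longrightarrow> (\<lambda>w. A w $$ (i, j)) \<in> borel_measurable N"
    and z: "\<And>i. i < n \<Longrightarrow> (\<lambda>w. z w i) \<in> borel_measurable N"
  shows "(\<lambda>w. adjugate_form (A w) n (z w)) \<in> borel_measurable N"
proof -
  have cof: "(\<lambda>w. adj_mat (A w) $$ (i, j)) \<in> borel_measurable N" if ij: "i < n" "j < n" for i j
  proof -
    have "(\<lambda>w. det (mat_delete (A w) j i)) \<in> borel_measurable N"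
    proof (rule measurable_det)
      show "mat_delete (A w) j i \<in> carrier_mat (n - 1) (n - 1)" for w
        using carr[of w] by (rule mat_delete_carrier)
      fix k l assume kl: "k < n - 1" "l < n - 1"
      have "(\<lambda>w. mat_delete (A w) j i $$ (k, l)) =
          (\<lambda>w. A w $$ (if k < j then k else Suc k, if l < i then l else Suc l))"
        using kl by (intro ext) (simp add: mat_delete_def carrier_matD[OF carr])
      also have "\<dots> \<in> borel_measurable N" using kl by (intro ent) auto
      finally show "(\<lambda>w. mat_delete (A w) j i $$ (k, l)) \<in> borel_measurable N" .
    qed
    moreover have "(\<lambda>w. adj_mat (A w) $$ (i, j)) = (\<lambda>w. (- 1) ^ (j + i) * det (mat_delete (A w) j i))"
      using ij by (intro ext) (simp add: adj_mat_def cofactor_def carrier_matD[OF carr])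
    ultimately show ?thesis by simp
  qed
  show ?thesis unfolding adjugate_form_def
    by (intro borel_measurable_divide borel_measurable_sum borel_measurable_times cof z measurable_det[OF carr ent]) auto
qed

section \<open>Separation of the likelihood near a wrong parameter\<close>

lemma uniformly_supported_boundedD:
  fixes h :: "real^'p \<Rightarrow> real^'d \<Rightarrow> real"
  assumes "uniformly_supported_bounded \<Theta> h C L" "\<theta> \<in> \<Theta>"
  shows "\<bar>h \<theta> s\<bar> \<le> L" "C < norm s \<Longrightarrow> h \<theta> s = 0"
proof -
  obtain S where S: "S \<subseteq> cball 0 C" "h \<theta> \<in> compact_support_bounded S" "(SUP s. \<bar>h \<theta> s\<bar>) \<le> L"
    using assms by (auto simp: uniformly_supported_bounded_def)
  have "bounded (range (h \<theta>))" using S(2) by (simp add: compact_support_bounded_def)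
  then obtain a where "\<forall>s. \<bar>h \<theta> s\<bar> \<le> a" by (auto simp: bounded_iff)
  then have "bdd_above (range (\<lambda>s. \<bar>h \<theta> s\<bar>))" by (intro bdd_aboveI2[of _ _ a]) simp
  then have "\<bar>h \<theta> s\<bar> \<le> (SUP s. \<bar>h \<theta> s\<bar>)" by (intro cSUP_upper) auto
  then show "\<bar>h \<theta> s\<bar> \<le> L" using S(3) by linarith
  show "h \<theta> s = 0" if "C < norm s"
  proof (rule ccontr)
    assume "h \<theta> s \<noteq> 0"
    then have "s \<in> closure {x. h \<theta> x \<noteq> 0}" by (intro subsetD[OF closure_subset]) simp
    then have "s \<in> cball 0 C" using S by (auto simp: compact_support_bounded_def)
    then show False using that by simp
  qed
qed

lemma quadratic_form_cov_matrix:
  "quadratic_form n (cov_matrix f s n) x = (\<Sum>i<n. \<Sum>j<n. x i * f (s (Suc i) - s (Suc j)) * x j)"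
  unfolding quadratic_form_def by (intro sum.cong refl) (auto simp: cov_matrix_def)

lemma small_perturbation_exists:
  fixes \<gamma> h :: real
  assumes "0 < \<gamma>"
  shows "\<exists>\<eta>>0. \<eta> < 1 \<and> h * \<eta> - ln (1 - \<eta>) < \<gamma>"
proof -
  have "((\<lambda>\<eta>. h * \<eta> - ln (1 - \<eta>)) \<longlongrightarrow> h * 0 - ln (1 - 0)) (at_right 0)"
    by (intro tendsto_intros) auto
  then have "\<forall>\<^sub>F \<eta> in at_right 0. h * \<eta> - ln (1 - \<eta>) < \<gamma>"
    using assms by (intro order_tendstoD(2)) auto
  moreover have "\<forall>\<^sub>F \<eta> in at_right (0::real). \<eta> < 1" "\<forall>\<^sub>F \<eta> in at_right (0::real). 0 < \<eta>"
    by (auto simp: eventually_at_right_field intro: exI[of _ 1])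
  ultimately have "\<forall>\<^sub>F \<eta> in at_right 0. 0 < \<eta> \<and> \<eta> < 1 \<and> h * \<eta> - ln (1 - \<eta>) < \<gamma>"
    by eventually_elim simp
  then show ?thesis using eventually_happens' trivial_limit_at_right_real by blast
qed

text \<open>The location as a function of a realization \<open>x\<close> of the displacements, for conditioning on \<open>X = x\<close>.\<close>

definition displaced :: "(nat \<Rightarrow> nat^'d) \<Rightarrow> real \<Rightarrow> (nat \<Rightarrow> real^'d) \<Rightarrow> nat \<Rightarrow> real^'d" where
  "displaced v \<tau> x i = (\<chi> k. real (v i $ k)) + \<tau> *\<^sub>R x i"

lemma near_grid_displaced:
  assumes "0 \<le> \<tau>" "\<And>i. i \<in> {1..n} \<Longrightarrow> x i \<in> unit_cube"
  shows "near_grid v \<tau> n (displaced v \<tau> x)"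
  unfolding near_grid_def
proof (intro ballI allI)
  fix i k assume "i \<in> {1..n}"
  then have "\<bar>x i $ k\<bar> \<le> 1" using assms(2)[of i] by (auto simp: unit_cube_def abs_le_iff minus_le_iff)
  then have "\<tau> * \<bar>x i $ k\<bar> \<le> \<tau>" using assms(1) by (simp add: mult_left_le)
  then show "\<bar>displaced v \<tau> x i $ k - real (v i $ k)\<bar> \<le> \<tau>"
    using assms(1) by (simp add: displaced_def abs_mult)
qed

lemma near_grid_inj:
  assumes ng: "near_grid v \<tau> n s" and inj: "inj_on v {1..}" and \<tau>: "\<tau> < 1 / 2"
  shows "inj_on s {1..n}"
proof (rule inj_onI)
  fix i j assume ij: "i \<in> {1..n}" "j \<in> {1..n}" "s i = s j"
  have "v i $ k = v j $ k" for k
  proof -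
    have "\<bar>real (v i $ k) - real (v j $ k)\<bar> \<le> 2 * \<tau>"
      using near_grid_diff[OF ng ij(1,2), of k] ij(3) by simp
    then have "\<bar>real (v i $ k) - real (v j $ k)\<bar> < 1" using \<tau> by linarith
    then show ?thesis by linarith
  qed
  then have "v i = v j" by (simp add: Finite_Cartesian_Product.vec_eq_iff)
  then show "i = j" using ij inj by (auto dest: inj_onD)
qed

text \<open>The exceptional event consists of the displacements for which the Frobenius distance is too small and of
  the outcomes excluded by Chebyshev's inequality at good displacements. Outside of it the likelihood gap
  between \<open>\<theta>\<^sub>1\<close> and \<open>\<theta>\<^sub>0\<close> is at least \<open>\<gamma>\<close>, and moving from \<open>\<theta>\<^sub>1\<close> to \<open>\<theta>\<close> costs less than \<open>\<gamma>\<close>.\<close>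

theorem (in prob_space) likelihood_separation:
  fixes \<Theta> :: "(real^'p) set" and c :: "real^'p \<Rightarrow> real^'d \<Rightarrow> real"
    and Z :: "real^'d \<Rightarrow> 'a \<Rightarrow> real" and X :: "nat \<Rightarrow> 'a \<Rightarrow> real^'d"
  assumes \<Theta>: "compact \<Theta>" "\<theta>0 \<in> \<Theta>"
    and cov: "\<And>\<theta>. \<theta> \<in> \<Theta> \<Longrightarrow> covariance_function (c \<theta>)"
    and Z: "centered_gaussian_field M Z (c \<theta>0)"
    and iid: "iid_positive_density M X"
    and ji: "jointly_measurable_independent M Z X"
    and \<tau>: "0 \<le> \<tau>" "\<tau> < 1 / 2"
    and v: "grid_enumeration v"
    and reg: "first_order_regular \<Theta> c"
    and ident: "asymptotically_identifiable \<Theta> c \<tau> \<theta>0"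
    and \<theta>1: "\<theta>1 \<in> \<Theta>" "\<theta>1 \<noteq> \<theta>0"
  shows "\<exists>r>0. \<exists>p. p \<longlonglongrightarrow> 0 \<and> (\<forall>n\<ge>1. \<exists>B\<in>events. prob B \<le> p n \<and>
    (\<forall>\<omega>\<in>space M - B. \<forall>\<theta>\<in>\<Theta>. dist \<theta> \<theta>1 < r \<longrightarrow>
       neg_log_lik c Z (location v \<tau> X) n \<omega> \<theta>0 < neg_log_lik c Z (location v \<tau> X) n \<omega> \<theta>))"
proof -
  have inj: "inj_on v {1..}" by (rule grid_enumeration_inj[OF v])
  obtain C L where CL: "uniformly_supported_bounded \<Theta> c C L"
    using reg by (auto simp: first_order_regular_def)
  note bounded = uniformly_supported_boundedD[OF CL]
  obtain D where D: "continuous_partials_on \<Theta> (\<lambda>\<theta>. c \<theta> 0) D"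
    using reg unfolding first_order_regular_def by blast
  obtain chat :: "real^'p \<Rightarrow> real^'d \<Rightarrow> real" where
    cont: "continuous_on (\<Theta> \<times> UNIV) (\<lambda>(\<theta>, f). chat \<theta> f)"
    and pos: "\<And>\<theta> f. \<theta> \<in> \<Theta> \<Longrightarrow> 0 < chat \<theta> f"
    and fp: "\<And>\<theta>. \<theta> \<in> \<Theta> \<Longrightarrow> fourier_pair (chat \<theta>) (c \<theta>)"
    using reg unfolding first_order_regular_def fourier_pair_def by blast
  have sym: "c \<theta> (- s) = c \<theta> s" if "\<theta> \<in> \<Theta>" for \<theta> s
    using cov[OF that] by (simp add: covariance_function_def)
  obtain m where m: "0 < m" "\<And>(h :: real^'d \<Rightarrow> real) H n s a. near_grid v \<tau> n s \<Longrightarrow> (\<forall>x. h (- x) = h x) \<Longrightarrow>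
      (\<forall>x. \<bar>h x\<bar> \<le> H) \<Longrightarrow> (\<forall>x. C < norm x \<longrightarrow> h x = 0) \<Longrightarrow>
      \<bar>\<Sum>i<n. \<Sum>j<n. a i * h (s (Suc i) - s (Suc j)) * a j\<bar> \<le> m * H * (\<Sum>i<n. (a i)\<^sup>2)"
    using compact_support_form_bound[OF inj, of \<tau> C] \<tau> by force
  obtain \<delta> where \<delta>: "0 < \<delta>" "\<And>\<theta> n s a. \<theta> \<in> \<Theta> \<Longrightarrow> near_grid v \<tau> n s \<Longrightarrow>
    \<delta> * (\<Sum>i<n. (a i)\<^sup>2) \<le> (\<Sum>i<n. \<Sum>j<n. a i * c \<theta> (s (Suc i) - s (Suc j)) * a j)"
    using covariance_form_lower_bound[OF inj \<tau> \<Theta>(1) cont pos fp] by blast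
  define K where "K = m * (\<bar>L\<bar> + 1)"
  have K: "0 < K" using m(1) by (simp add: K_def)
  define \<Sigma> where "\<Sigma> \<theta> s n = cov_matrix (c \<theta>) s n" for \<theta> s n
  have fb: "form_bounds n (\<Sigma> \<theta> s n) \<delta> K" if "\<theta> \<in> \<Theta>" "near_grid v \<tau> n s" for \<theta> n s
    unfolding form_bounds_def \<Sigma>_def quadratic_form_cov_matrix
  proof (intro allI conjI)
    fix x :: "nat \<Rightarrow> real"
    show "\<delta> * (\<Sum>i<n. (x i)\<^sup>2) \<le> (\<Sum>i<n. \<Sum>j<n. x i * c \<theta> (s (Suc i) - s (Suc j)) * x j)"
      by (rule \<delta>(2)[OF that])
    have "\<bar>\<Sum>i<n. \<Sum>j<n. x i * c \<theta> (s (Suc i) - s (Suc j)) * x j\<bar> \<le> K * (\<Sum>i<n. (x i)\<^sup>2)"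
      unfolding K_def
    proof (rule m(2)[OF that(2)])
      show "\<forall>x. \<bar>c \<theta> x\<bar> \<le> \<bar>L\<bar> + 1" using bounded(1)[OF that(1)] by (meson abs_ge_self add_increasing2 order_trans zero_le_one)
    qed (use bounded(2)[OF that(1)] sym[OF that(1)] in auto)
    then show "(\<Sum>i<n. \<Sum>j<n. x i * c \<theta> (s (Suc i) - s (Suc j)) * x j) \<le> K * (\<Sum>i<n. (x i)\<^sup>2)"
      by (rule order_trans[OF abs_ge_self])
  qed
  have \<Sigma>c: "\<Sigma> \<theta> s n \<in> carrier_mat n n" for \<theta> s n by (simp add: \<Sigma>_def cov_matrix_def)
  have pd: "pos_def_mat n (\<Sigma> \<theta> s n)" if "\<theta> \<in> \<Theta>" "near_grid v \<tau> n s" for \<theta> n s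
    unfolding pos_def_mat_def
  proof (intro conjI allI impI \<Sigma>c)
    have "c \<theta> (s (Suc i) - s (Suc j)) = c \<theta> (s (Suc j) - s (Suc i))" for i j
      using sym[OF that(1), of "s (Suc i) - s (Suc j)"] by simp
    then show "transpose_mat (\<Sigma> \<theta> s n) = \<Sigma> \<theta> s n"
      by (intro eq_matI) (auto simp: \<Sigma>_def cov_matrix_def)
    fix x :: "nat \<Rightarrow> real" assume "\<exists>i<n. x i \<noteq> 0"
    then have "0 < (\<Sum>i<n. (x i)\<^sup>2)"
      by (metis finite_lessThan lessThan_iff sum_pos2 zero_le_power2 zero_less_power2)
    then have "0 < \<delta> * (\<Sum>i<n. (x i)\<^sup>2)" using \<delta>(1) by simp
    also have "\<dots> \<le> quadratic_form n (\<Sigma> \<theta> s n) x" using fb[OF that] by (simp add: form_bounds_def)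
    finally show "0 < quadratic_form n (\<Sigma> \<theta> s n) x" .
  qed
  define q where "q s = (c \<theta>1 s - c \<theta>0 s)\<^sup>2" for s
  have ccont: "isCont (c \<theta>) s" if "\<theta> \<in> \<Theta>" for \<theta> s by (rule fourier_pair_isCont[OF fp[OF that]])
  have cm [measurable]: "c \<theta> \<in> borel_measurable borel" if "\<theta> \<in> \<Theta>" for \<theta>
    using ccont[OF that] by (intro borel_measurable_continuous_onI continuous_at_imp_continuous_on) auto
  obtain z u1 u2 where zu: "u1 \<in> unit_cube" "u2 \<in> unit_cube" "z = (0::int^'d) \<Longrightarrow> u1 = u2"
    "c \<theta>1 ((\<chi> k. real_of_int (z $ k)) + \<tau> *\<^sub>R (u1 - u2)) \<noteq> c \<theta>0 ((\<chi> k. real_of_int (z $ k)) + \<tau> *\<^sub>R (u1 - u2))"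
    using identifiable_distinguishing_lag[OF ident \<theta>1] by metis
  let ?T = "\<lambda>s n. \<Sum>i<n. \<Sum>j<n. q (s (Suc i) - s (Suc j))"
  define S where "S = location v \<tau> X"
  obtain \<beta> where \<beta>: "0 < \<beta>"
    "(\<lambda>n. prob {\<omega>\<in>space M. ?T (\<lambda>i. S i \<omega>) n \<le> \<beta> * real n}) \<longlonglongrightarrow> 0"
  proof -
    have "\<exists>\<beta>>0. (\<lambda>n. prob {\<omega>\<in>space M. ?T (\<lambda>i. S i \<omega>) n \<le> \<beta> * real n}) \<longlonglongrightarrow> 0"
      unfolding S_def
    proof (rule lag_statistic_lower_bound[OF iid v \<tau> _ zu(1-3)])
      show "isCont q ((\<chi> k. real_of_int (z $ k)) + \<tau> *\<^sub>R (u1 - u2))"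
        unfolding q_def[abs_def] using ccont \<theta>1 \<Theta> by (intro continuous_intros) auto
    qed (use zu(4) in \<open>auto simp: q_def\<close>)
    then show thesis using that by blast
  qed
  obtain \<gamma> C' where \<gamma>: "0 < \<gamma>" and sep: "\<And>n s B. 1 \<le> n \<Longrightarrow> inj_on s {1..n} \<Longrightarrow>
      pos_def_mat n (\<Sigma> \<theta>0 s n) \<Longrightarrow> pos_def_mat n B \<Longrightarrow>
      form_bounds n (\<Sigma> \<theta>0 s n) \<delta> K \<Longrightarrow> form_bounds n B \<delta> K \<Longrightarrow>
      \<beta> * real n \<le> (\<Sum>i<n. \<Sum>j<n. (B $$ (i, j) - \<Sigma> \<theta>0 s n $$ (i, j))\<^sup>2) \<Longrightarrow>
      prob {\<omega>\<in>space M. contrast B n (\<lambda>i. Z (s (Suc i)) \<omega>) - contrast (\<Sigma> \<theta>0 s n) n (\<lambda>i. Z (s (Suc i)) \<omega>)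
           < \<gamma> * real n \<or> 2 * real n < mahalanobis (\<Sigma> \<theta>0 s n) n (\<lambda>i. Z (s (Suc i)) \<omega>)} \<le> C' / real n"
    using contrast_separation[OF Z \<delta>(1) K \<beta>(1)] unfolding \<Sigma>_def by blast
  define h where "h = K / \<delta>"
  have h: "0 < h" using K \<delta> by (simp add: h_def)
  \<comment> \<open>The relative perturbation of the covariance matrix that costs less than the gap: outside the
    exceptional event the quadratic part at \<open>\<theta>\<^sub>1\<close> is at most \<open>2 h n\<close>.\<close>
  obtain \<eta> where \<eta>: "0 < \<eta>" "\<eta> < 1" "2 * h * \<eta> - ln (1 - \<eta>) < \<gamma>"
    using small_perturbation_exists[OF \<gamma>] by blast
  have "0 < \<eta> * \<delta> / m" using \<eta> \<delta> m by simp
  from covariance_uniformly_continuous[OF cont pos fp D \<theta>1(1) this]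
  obtain r where r: "0 < r" "\<And>\<theta> s. \<theta> \<in> \<Theta> \<Longrightarrow> dist \<theta> \<theta>1 < r \<Longrightarrow> \<bar>c \<theta> s - c \<theta>1 s\<bar> \<le> \<eta> * \<delta> / m"
    by blast
  have perturb: "\<bar>quadratic_form n (\<Sigma> \<theta> s n) x - quadratic_form n (\<Sigma> \<theta>1 s n) x\<bar> \<le> \<eta> * quadratic_form n (\<Sigma> \<theta>1 s n) x"
    if ng: "near_grid v \<tau> n s" and \<theta>: "\<theta> \<in> \<Theta>" "dist \<theta> \<theta>1 < r" for n s \<theta> x
  proof -
    have "quadratic_form n (\<Sigma> \<theta> s n) x - quadratic_form n (\<Sigma> \<theta>1 s n) x
      = (\<Sum>i<n. \<Sum>j<n. x i * (\<lambda>y. c \<theta> y - c \<theta>1 y) (s (Suc i) - s (Suc j)) * x j)"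
      unfolding \<Sigma>_def quadratic_form_cov_matrix sum_subtractf[symmetric]
      by (intro sum.cong refl) (simp add: algebra_simps)
    also have "\<bar>\<dots>\<bar> \<le> m * (\<eta> * \<delta> / m) * (\<Sum>i<n. (x i)\<^sup>2)"
      by (rule m(2)[OF ng])
        (use r(2)[OF \<theta>] sym[OF \<theta>(1)] sym[OF \<theta>1(1)] bounded(2)[OF \<theta>(1)] bounded(2)[OF \<theta>1(1)] in auto)
    also have "\<dots> = \<eta> * (\<delta> * (\<Sum>i<n. (x i)\<^sup>2))" using m(1) by simp
    also have "\<dots> \<le> \<eta> * quadratic_form n (\<Sigma> \<theta>1 s n) x"
      using fb[OF \<theta>1(1) ng] \<eta>(1) by (intro mult_left_mono) (auto simp: form_bounds_def)
    finally show ?thesis .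
  qed
  have ind: "indep_vars (\<lambda>_. borel) X {1..}" and cube: "\<And>i \<omega>. 1 \<le> i \<Longrightarrow> \<omega> \<in> space M \<Longrightarrow> X i \<omega> \<in> unit_cube"
    using iid by (auto simp: iid_positive_density_def)
  have Xm [measurable]: "X i \<in> borel_measurable M" if "1 \<le> i" for i
    using ind that by (auto simp: indep_vars_def)
  let ?N = "Pi\<^sub>M {1::nat..} (\<lambda>_. borel :: (real^'d) measure)"
  obtain A where A: "subalgebra M A" "(\<lambda>(s, \<omega>). Z s \<omega>) \<in> borel_measurable (borel \<Otimes>\<^sub>M A)"
    and section_bound: "\<And>E p. E \<in> sets (A \<Otimes>\<^sub>M ?N) \<Longrightarrow> (\<And>x. prob {\<omega>\<in>space M. (\<omega>, x) \<in> E} \<le> p) \<Longrightarrow>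
       {\<omega>\<in>space M. (\<omega>, \<lambda>i\<in>{1..}. X i \<omega>) \<in> E} \<in> events \<and> prob {\<omega>\<in>space M. (\<omega>, \<lambda>i\<in>{1..}. X i \<omega>) \<in> E} \<le> p"
    using independent_section_bound[OF ji Xm] by blast
  have spA: "space A = space M" using A(1) by (simp add: subalgebra_def)
  define loc where "loc = displaced v \<tau>"
  define p where "p n = \<bar>C'\<bar> / real n + prob {\<omega>\<in>space M. ?T (\<lambda>i. S i \<omega>) n \<le> \<beta> * real n}" for n
  have "p \<longlonglongrightarrow> 0 + 0" unfolding p_def[abs_def] by (intro tendsto_add lim_const_over_n \<beta>(2))
  then have p: "p \<longlonglongrightarrow> 0" by simp
  have main: "\<exists>B\<in>events. prob B \<le> p n \<and> (\<forall>\<omega>\<in>space M - B. \<forall>\<theta>\<in>\<Theta>. dist \<theta> \<theta>1 < r \<longrightarrow>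
       neg_log_lik c Z S n \<omega> \<theta>0 < neg_log_lik c Z S n \<omega> \<theta>)" if n: "1 \<le> n" for n
  proof -
    have n0: "0 < real n" using n by simp
    define good where "good x \<longleftrightarrow> (\<forall>i\<in>{1..n}. x i \<in> unit_cube) \<and> \<beta> * real n < ?T (loc x) n" for x
    define f where "f \<theta> x \<omega> = ln (det (\<Sigma> \<theta> (loc x) n)) + adjugate_form (\<Sigma> \<theta> (loc x) n) n (\<lambda>i. Z (loc x (Suc i)) \<omega>)" for \<theta> x \<omega>
    define g where "g x \<omega> = adjugate_form (\<Sigma> \<theta>0 (loc x) n) n (\<lambda>i. Z (loc x (Suc i)) \<omega>)" for x \<omega>
    have good: "near_grid v \<tau> n (loc x)" if "good x" for x
      unfolding loc_def using that \<tau>(1) by (intro near_grid_displaced) (auto simp: good_def)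
    have fg: "contrast (\<Sigma> \<theta> (loc x) n) n (\<lambda>i. Z (loc x (Suc i)) \<omega>) = f \<theta> x \<omega>"
      "mahalanobis (\<Sigma> \<theta>0 (loc x) n) n (\<lambda>i. Z (loc x (Suc i)) \<omega>) = g x \<omega>"
      if "good x" "\<theta> \<in> \<Theta>" for x \<omega> \<theta>
      using det_plus_pos_def(1)[OF pd[OF that(2) good[OF that(1)]]]
        mahalanobis_adjugate[OF pd[OF that(2) good[OF that(1)]]]
        mahalanobis_adjugate[OF pd[OF \<Theta>(2) good[OF that(1)]]]
      by (simp_all add: contrast_def f_def g_def)
    define E where "E = {w \<in> space (A \<Otimes>\<^sub>M ?N). good (snd w) \<and>
      (f \<theta>1 (snd w) (fst w) - f \<theta>0 (snd w) (fst w) < \<gamma> * real n \<or> 2 * real n < g (snd w) (fst w))}"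
    have locm [measurable]: "(\<lambda>w. loc (snd w) (Suc i)) \<in> borel_measurable (A \<Otimes>\<^sub>M ?N)" for i
      unfolding loc_def displaced_def by measurable
    have Zm [measurable]: "(\<lambda>w. Z (loc (snd w) (Suc i)) (fst w)) \<in> borel_measurable (A \<Otimes>\<^sub>M ?N)" for i
    proof -
      have "(\<lambda>w. (loc (snd w) (Suc i), fst w)) \<in> measurable (A \<Otimes>\<^sub>M ?N) (borel \<Otimes>\<^sub>M A)"
        by measurable
      from measurable_compose[OF this A(2)] show ?thesis by simp
    qed
    have em: "(\<lambda>w. \<Sigma> \<theta> (loc (snd w)) n $$ (i, j)) \<in> borel_measurable (A \<Otimes>\<^sub>M ?N)"
      if "\<theta> \<in> \<Theta>" "i < n" "j < n" for \<theta> i j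
    proof -
      have "(\<lambda>w. \<Sigma> \<theta> (loc (snd w)) n $$ (i, j)) = (\<lambda>w. c \<theta> (loc (snd w) (Suc i) - loc (snd w) (Suc j)))"
        using that by (simp add: \<Sigma>_def cov_matrix_def)
      also have "\<dots> \<in> borel_measurable (A \<Otimes>\<^sub>M ?N)"
        by (rule measurable_compose[OF _ cm[OF that(1)]]) measurable
      finally show ?thesis .
    qed
    have detm: "(\<lambda>w. det (\<Sigma> \<theta> (loc (snd w)) n)) \<in> borel_measurable (A \<Otimes>\<^sub>M ?N)" if "\<theta> \<in> \<Theta>" for \<theta>
      by (rule measurable_det[OF \<Sigma>c em[OF that]])
    have adjm: "(\<lambda>w. adjugate_form (\<Sigma> \<theta> (loc (snd w)) n) n (\<lambda>i. Z (loc (snd w) (Suc i)) (fst w))) \<in> borel_measurable (A \<Otimes>\<^sub>M ?N)"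
      if "\<theta> \<in> \<Theta>" for \<theta>
      by (rule measurable_adjugate_form[OF \<Sigma>c em[OF that] Zm])
    have fm: "(\<lambda>w. f \<theta> (snd w) (fst w)) \<in> borel_measurable (A \<Otimes>\<^sub>M ?N)" if "\<theta> \<in> \<Theta>" for \<theta>
      unfolding f_def using detm[OF that] adjm[OF that] by (intro borel_measurable_add borel_measurable_ln)
    have gm [measurable]: "(\<lambda>w. g (snd w) (fst w)) \<in> borel_measurable (A \<Otimes>\<^sub>M ?N)"
      unfolding g_def by (rule adjm[OF \<Theta>(2)])
    note fm' [measurable] = fm[OF \<theta>1(1)] fm[OF \<Theta>(2)]
    have qm [measurable]: "q \<in> borel_measurable borel"
      unfolding q_def[abs_def] using cm[OF \<theta>1(1)] cm[OF \<Theta>(2)] by measurable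
    have unit_cube_borel [measurable]: "(unit_cube :: (real^'d) set) \<in> sets borel"
    proof -
      have cube: "unit_cube = (cbox (\<chi> k. - 1) (\<chi> k. 1) :: (real^'d) set)"
        by (auto simp: unit_cube_def mem_box_cart)
      show ?thesis unfolding cube by (intro borel_closed closed_cbox)
    qed
    have goodm: "Measurable.pred (A \<Otimes>\<^sub>M ?N) (\<lambda>w. good (snd w))"
    proof -
      have "Measurable.pred (A \<Otimes>\<^sub>M ?N) (\<lambda>w. \<forall>i\<in>{1..n}. snd w i \<in> unit_cube)"
      proof (rule pred_intros_finite(3))
        fix i assume "i \<in> {1..n}"
        then have "(\<lambda>w. snd w i) \<in> borel_measurable (A \<Otimes>\<^sub>M ?N)"
          by (intro measurable_compose[OF measurable_snd measurable_component_singleton]) auto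
        then show "Measurable.pred (A \<Otimes>\<^sub>M ?N) (\<lambda>w. snd w i \<in> unit_cube)" by measurable
      qed simp
      moreover have "Measurable.pred (A \<Otimes>\<^sub>M ?N) (\<lambda>w. \<beta> * real n < ?T (loc (snd w)) n)" by measurable
      ultimately show ?thesis unfolding good_def by (rule pred_intros_logic)
    qed
    have E: "E \<in> sets (A \<Otimes>\<^sub>M ?N)" unfolding E_def using goodm by measurable
    have Esec: "prob {\<omega>\<in>space M. (\<omega>, x) \<in> E} \<le> \<bar>C'\<bar> / real n" for x
    proof (cases "good x \<and> x \<in> space ?N")
      case True
      then have gx: "good x" by simp
      note ng = good[OF gx]
      have "{\<omega>\<in>space M. (\<omega>, x) \<in> E} = {\<omega>\<in>space M. contrast (\<Sigma> \<theta>1 (loc x) n) n (\<lambda>i. Z (loc x (Suc i)) \<omega>)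
          - contrast (\<Sigma> \<theta>0 (loc x) n) n (\<lambda>i. Z (loc x (Suc i)) \<omega>) < \<gamma> * real n \<or>
          2 * real n < mahalanobis (\<Sigma> \<theta>0 (loc x) n) n (\<lambda>i. Z (loc x (Suc i)) \<omega>)}"
        unfolding fg(1)[OF gx \<theta>1(1)] fg(1)[OF gx \<Theta>(2)] fg(2)[OF gx \<Theta>(2)]
        using True by (auto simp: E_def space_pair_measure spA)
      also have "prob \<dots> \<le> C' / real n"
      proof (rule sep[OF n near_grid_inj[OF ng inj \<tau>(2)] pd[OF \<Theta>(2) ng] pd[OF \<theta>1(1) ng]
            fb[OF \<Theta>(2) ng] fb[OF \<theta>1(1) ng]])
        have "?T (loc x) n = (\<Sum>i<n. \<Sum>j<n. (\<Sigma> \<theta>1 (loc x) n $$ (i, j) - \<Sigma> \<theta>0 (loc x) n $$ (i, j))\<^sup>2)"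
          by (intro sum.cong refl) (auto simp: q_def \<Sigma>_def cov_matrix_def)
        then show "\<beta> * real n \<le> (\<Sum>i<n. \<Sum>j<n. (\<Sigma> \<theta>1 (loc x) n $$ (i, j) - \<Sigma> \<theta>0 (loc x) n $$ (i, j))\<^sup>2)"
          using gx by (simp add: good_def)
      qed
      also have "\<dots> \<le> \<bar>C'\<bar> / real n" using n0 by (intro divide_right_mono) auto
      finally show ?thesis .
    next
      case False
      then have "{\<omega>\<in>space M. (\<omega>, x) \<in> E} = {}" by (auto simp: E_def space_pair_measure)
      then show ?thesis by (simp only: measure_empty) simp
    qed
    define xi where "xi \<omega> = (\<lambda>i\<in>{1..}. X i \<omega>)" for \<omega>
    define B1 where "B1 = {\<omega>\<in>space M. (\<omega>, xi \<omega>) \<in> E}"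
    define B2 where "B2 = {\<omega>\<in>space M. ?T (\<lambda>i. S i \<omega>) n \<le> \<beta> * real n}"
    have B1: "B1 \<in> events" "prob B1 \<le> \<bar>C'\<bar> / real n"
      using section_bound[OF E Esec] by (auto simp: B1_def xi_def)
    have Sm [measurable]: "(\<lambda>\<omega>. S (Suc i) \<omega>) \<in> borel_measurable M" for i
      unfolding S_def location_def by measurable
    have B2: "B2 \<in> events" unfolding B2_def by measurable
    have Sloc: "S (Suc i) \<omega> = loc (xi \<omega>) (Suc i)" for i \<omega>
      by (simp add: S_def loc_def xi_def location_def displaced_def)
    have Scov: "cov_matrix (c \<theta>) (\<lambda>i. S i \<omega>) n = \<Sigma> \<theta> (loc (xi \<omega>)) n" for \<theta> \<omega>
      unfolding \<Sigma>_def cov_matrix_def Sloc ..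
    show ?thesis
    proof (intro bexI[of _ "B1 \<union> B2"] conjI ballI impI)
      show "B1 \<union> B2 \<in> events" using B1 B2 by auto
      have "prob (B1 \<union> B2) \<le> prob B1 + prob B2" by (rule measure_Un_le) (use B1 B2 in auto)
      then show "prob (B1 \<union> B2) \<le> p n" using B1(2) by (simp add: p_def B2_def)
      fix \<omega> \<theta> assume \<omega>: "\<omega> \<in> space M - (B1 \<union> B2)" and \<theta>: "\<theta> \<in> \<Theta>" "dist \<theta> \<theta>1 < r"
      define x where "x = xi \<omega>"
      let ?z = "\<lambda>i. Z (loc x (Suc i)) \<omega>"
      have gx: "good x"
        using \<omega> cube unfolding good_def by (auto simp: x_def B2_def Sloc not_le xi_def[of \<omega>])
      note ng = good[OF gx]
      have xN: "x \<in> space ?N" by (auto simp: x_def xi_def space_PiM)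
      have "\<not> (f \<theta>1 x \<omega> - f \<theta>0 x \<omega> < \<gamma> * real n \<or> 2 * real n < g x \<omega>)"
        using \<omega> gx xN by (auto simp: B1_def E_def space_pair_measure spA x_def[symmetric])
      then have 1: "\<gamma> * real n \<le> contrast (\<Sigma> \<theta>1 (loc x) n) n ?z - contrast (\<Sigma> \<theta>0 (loc x) n) n ?z"
        and 2: "mahalanobis (\<Sigma> \<theta>0 (loc x) n) n ?z \<le> 2 * real n"
        unfolding fg(1)[OF gx \<theta>1(1)] fg(1)[OF gx \<Theta>(2)] fg(2)[OF gx \<Theta>(2)] by auto
      have "mahalanobis (\<Sigma> \<theta>1 (loc x) n) n ?z \<le> h * mahalanobis (\<Sigma> \<theta>0 (loc x) n) n ?z"
        unfolding h_def
        by (rule mahalanobis_le[OF pd[OF \<Theta>(2) ng] pd[OF \<theta>1(1) ng] fb[OF \<Theta>(2) ng] fb[OF \<theta>1(1) ng] \<delta>(1) K])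
      also have "\<dots> \<le> h * (2 * real n)" using 2 h by (intro mult_left_mono) auto
      finally have "\<eta> * mahalanobis (\<Sigma> \<theta>1 (loc x) n) n ?z \<le> \<eta> * (h * (2 * real n))"
        using \<eta>(1) by (intro mult_left_mono) auto
      moreover have "contrast (\<Sigma> \<theta>1 (loc x) n) n ?z + real n * ln (1 - \<eta>) - \<eta> * mahalanobis (\<Sigma> \<theta>1 (loc x) n) n ?z
          \<le> contrast (\<Sigma> \<theta> (loc x) n) n ?z"
        using \<eta> by (intro contrast_perturbation pd[OF \<theta>1(1) ng] pd[OF \<theta>(1) ng] perturb[OF ng \<theta>]) auto
      moreover have "real n * (2 * h * \<eta> - ln (1 - \<eta>)) < real n * \<gamma>"
        using \<eta>(3) n0 by (intro mult_strict_left_mono) auto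
      then have "\<eta> * (h * (2 * real n)) - real n * ln (1 - \<eta>) < \<gamma> * real n"
        by (simp add: algebra_simps)
      ultimately have "contrast (\<Sigma> \<theta>0 (loc x) n) n ?z < contrast (\<Sigma> \<theta> (loc x) n) n ?z"
        using 1 by linarith
      then show "neg_log_lik c Z S n \<omega> \<theta>0 < neg_log_lik c Z S n \<omega> \<theta>"
        unfolding neg_log_lik_contrast Scov Sloc x_def[symmetric]
        using n0 by (intro divide_strict_right_mono)
    qed
  qed
  show ?thesis
    by (rule exI[of _ r], rule conjI[OF r(1)], rule exI[of _ p], rule conjI[OF p])
       (use main in \<open>simp add: S_def\<close>)
qed

theorem corollary5p3:
  fixes M :: "'w measure"
    and \<Theta> :: "(real^'p) set" and \<theta>0 :: "real^'p"
    and c :: "real^'p \<Rightarrow> real^'d \<Rightarrow> real"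
    and Z :: "real^'d \<Rightarrow> 'w \<Rightarrow> real"
    and X :: "nat \<Rightarrow> 'w \<Rightarrow> real^'d"
    and v :: "nat \<Rightarrow> nat^'d" and \<tau> :: real
    and est :: "nat \<Rightarrow> 'w \<Rightarrow> real^'p"
  assumes "prob_space M"
    and "compact \<Theta>" and "convex \<Theta>" and "\<theta>0 \<in> \<Theta>"
    and "\<And>\<theta>. \<theta> \<in> \<Theta> \<Longrightarrow> covariance_function (c \<theta>)"
    and "centered_gaussian_field M Z (c \<theta>0)"
    and "iid_positive_density M X"
    and "jointly_measurable_independent M Z X"
    and "0 \<le> \<tau>" and "\<tau> < 1 / 2"
    and "grid_enumeration v"
    and "first_order_regular \<Theta> c"
    and "asymptotically_identifiable \<Theta> c \<tau> \<theta>0"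
    and "ml_estimators M \<Theta> c Z (location v \<tau> X) est"
  shows "tendsto_in_probability M est \<theta>0"
  unfolding tendsto_in_probability_def
proof (intro allI impI)
  interpret prob_space M by fact
  fix \<epsilon> :: real assume \<epsilon>: "0 < \<epsilon>"
  let ?l = "neg_log_lik c Z (location v \<tau> X)"
  define K where "K = \<Theta> - ball \<theta>0 \<epsilon>"
  have "compact K" unfolding K_def using assms(2) by (intro compact_diff) auto
  have ex: "\<forall>\<theta>1\<in>K. \<exists>r p. 0 < r \<and> p \<longlonglongrightarrow> 0 \<and> (\<forall>n\<ge>1. \<exists>B\<in>events. prob B \<le> p n \<and>
    (\<forall>\<omega>\<in>space M - B. \<forall>\<theta>\<in>\<Theta>. dist \<theta> \<theta>1 < r \<longrightarrow> ?l n \<omega> \<theta>0 < ?l n \<omega> \<theta>))"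
  proof
    fix \<theta>1 assume "\<theta>1 \<in> K"
    then have "\<theta>1 \<in> \<Theta>" "\<theta>1 \<noteq> \<theta>0" using \<epsilon> by (auto simp: K_def)
    from likelihood_separation[OF assms(2,4-13) this]
    show "\<exists>r p. 0 < r \<and> p \<longlonglongrightarrow> 0 \<and> (\<forall>n\<ge>1. \<exists>B\<in>events. prob B \<le> p n \<and>
      (\<forall>\<omega>\<in>space M - B. \<forall>\<theta>\<in>\<Theta>. dist \<theta> \<theta>1 < r \<longrightarrow> ?l n \<omega> \<theta>0 < ?l n \<omega> \<theta>))" by blast
  qed
  from bchoice[OF ex] obtain r where r: "\<forall>t\<in>K. \<exists>p. 0 < r t \<and> p \<longlonglongrightarrow> (0::real) \<and> (\<forall>n\<ge>1. \<exists>B\<in>events. prob B \<le> p n \<and>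
    (\<forall>\<omega>\<in>space M - B. \<forall>\<theta>\<in>\<Theta>. dist \<theta> t < r t \<longrightarrow> ?l n \<omega> \<theta>0 < ?l n \<omega> \<theta>))"
    by blast
  from bchoice[OF r] obtain p where *: "\<forall>t\<in>K. 0 < r t \<and> p t \<longlonglongrightarrow> (0::real) \<and> (\<forall>n\<ge>1. \<exists>B\<in>events. prob B \<le> p t n \<and>
    (\<forall>\<omega>\<in>space M - B. \<forall>\<theta>\<in>\<Theta>. dist \<theta> t < r t \<longrightarrow> ?l n \<omega> \<theta>0 < ?l n \<omega> \<theta>))"
    by blast
  have rp: "\<And>t. t \<in> K \<Longrightarrow> 0 < r t" "\<And>t. t \<in> K \<Longrightarrow> p t \<longlonglongrightarrow> 0"
    "\<And>t n. t \<in> K \<Longrightarrow> 1 \<le> n \<Longrightarrow> \<exists>B\<in>events. prob B \<le> p t n \<and>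
      (\<forall>\<omega>\<in>space M - B. \<forall>\<theta>\<in>\<Theta>. dist \<theta> t < r t \<longrightarrow> ?l n \<omega> \<theta>0 < ?l n \<omega> \<theta>)"
    by (simp_all only: *[rule_format])
  obtain T where T: "T \<subseteq> K" "finite T" "K \<subseteq> (\<Union>t\<in>T. ball t (r t))"
  proof (rule compactE_image[OF \<open>compact K\<close>, of K "\<lambda>t. ball t (r t)"])
    show "K \<subseteq> (\<Union>t\<in>K. ball t (r t))" using rp(1) by (auto intro: centre_in_ball[THEN iffD2])
  qed auto
  have bound: "prob {\<omega>\<in>space M. \<epsilon> < dist (est n \<omega>) \<theta>0} \<le> (\<Sum>t\<in>T. p t n)" if n: "1 \<le> n" for n
  proof -
    obtain B where B: "\<And>t. t \<in> T \<Longrightarrow> B t \<in> events" "\<And>t. t \<in> T \<Longrightarrow> prob (B t) \<le> p t n"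
      "\<And>t \<omega> \<theta>. t \<in> T \<Longrightarrow> \<omega> \<in> space M - B t \<Longrightarrow> \<theta> \<in> \<Theta> \<Longrightarrow> dist \<theta> t < r t \<Longrightarrow> ?l n \<omega> \<theta>0 < ?l n \<omega> \<theta>"
    proof -
      have "\<forall>t\<in>T. \<exists>B. B \<in> events \<and> prob B \<le> p t n \<and>
        (\<forall>\<omega>\<in>space M - B. \<forall>\<theta>\<in>\<Theta>. dist \<theta> t < r t \<longrightarrow> ?l n \<omega> \<theta>0 < ?l n \<omega> \<theta>)"
        using rp(3)[OF _ n] T(1) by blast
      then obtain B where "\<forall>t\<in>T. B t \<in> events \<and> prob (B t) \<le> p t n \<and>
        (\<forall>\<omega>\<in>space M - B t. \<forall>\<theta>\<in>\<Theta>. dist \<theta> t < r t \<longrightarrow> ?l n \<omega> \<theta>0 < ?l n \<omega> \<theta>)"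
        unfolding bchoice_iff by blast
      then show thesis by (intro that[of B]) auto
    qed
    have "prob {\<omega>\<in>space M. \<epsilon> < dist (est n \<omega>) \<theta>0} \<le> prob (\<Union>t\<in>T. B t)"
    proof (rule finite_measure_mono)
      show "{\<omega>\<in>space M. \<epsilon> < dist (est n \<omega>) \<theta>0} \<subseteq> (\<Union>t\<in>T. B t)"
      proof (rule subsetI, rule ccontr)
        fix \<omega> assume \<omega>: "\<omega> \<in> {\<omega>\<in>space M. \<epsilon> < dist (est n \<omega>) \<theta>0}" "\<omega> \<notin> (\<Union>t\<in>T. B t)"
        have est: "est n \<omega> \<in> \<Theta>" "?l n \<omega> (est n \<omega>) \<le> ?l n \<omega> \<theta>0"
          using assms(4,14) n \<omega>(1) by (auto simp: ml_estimators_def)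
        then have "est n \<omega> \<in> K" using \<omega>(1) by (auto simp: K_def dist_commute)
        then obtain t where t: "t \<in> T" "dist (est n \<omega>) t < r t"
          using T(3) by (auto simp: dist_commute)
        have "?l n \<omega> \<theta>0 < ?l n \<omega> (est n \<omega>)"
          by (rule B(3)[OF t(1) _ est(1) t(2)]) (use \<omega> t in auto)
        then show False using est(2) by simp
      qed
      show "(\<Union>t\<in>T. B t) \<in> events" using B(1) T(2) by auto
    qed
    also have "\<dots> \<le> (\<Sum>t\<in>T. prob (B t))" using B(1) T(2) by (intro measure_UNION_le) auto
    also have "\<dots> \<le> (\<Sum>t\<in>T. p t n)" using B(2) by (intro sum_mono)
    finally show ?thesis .
  qed
  show "(\<lambda>n. prob {\<omega>\<in>space M. \<epsilon> < dist (est n \<omega>) \<theta>0}) \<longlonglongrightarrow> 0"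
  proof (rule tendsto_sandwich[OF _ _ tendsto_const])
    show "\<forall>\<^sub>F n in sequentially. 0 \<le> prob {\<omega>\<in>space M. \<epsilon> < dist (est n \<omega>) \<theta>0}" by simp
    show "\<forall>\<^sub>F n in sequentially. prob {\<omega>\<in>space M. \<epsilon> < dist (est n \<omega>) \<theta>0} \<le> (\<Sum>t\<in>T. p t n)"
      by (intro eventually_sequentiallyI[of 1] bound)
    have "(\<lambda>n. \<Sum>t\<in>T. p t n) \<longlonglongrightarrow> (\<Sum>t\<in>T. 0)" using rp(2) T(1) by (intro tendsto_sum) auto
    then show "(\<lambda>n. \<Sum>t\<in>T. p t n) \<longlonglongrightarrow> 0" by simp
  qed
qed

end
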